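(* Let $\epsilon\in(0,1]$, let $\Omega\subset\mathbb{R}^2$, the mesh $\mathcal{T}$, the polynomial degrees $\mathbf{p}$, the space $\mathcal{W}_{DG}=H^1_0(\Omega)+\mathcal{V}_{DG}$, the norm $\|\cdot\|_{DG}$, the operator $A_{DG}$ with constant $C_A$, the constant $C_{\mathrm{stab}}=\sqrt{2\max(1,C_A)}$, the residual operator $R_\epsilon$ and the norm $|||R_\epsilon(\cdot)|||$ be as described in the context, and let $f:\overline\Omega\times\mathbb{R}\to\mathbb{R}$ be continuously differentiable, with $f'=\partial_u f$ the derivative in the second argument. Suppose that there exist constants $\varrho_0>-1$ and $L\ge 0$ such that $$\varrho_0\le -f'\qquad\text{and}\qquad |f'|\le L\qquad\text{on }\overline\Omega\times\mathbb{R}.$$ Set $c_0=1+\min(0,\varrho_0)>0$, and assume that the penalty parameter $C_\sigma$ satisfies $$C_\sigma\ge\frac{c_0}{2}+\frac{C_A(1+L)^2}{2c_0}.$$ Then, for any weak solution $u\in H^1_0(\Omega)$ of $-\epsilon\Delta u+u=f(\cdot,u)$ in $\Omega$, $u=0$ on $\partial\Omega$, the bounds $$\frac{c_0}{2}\|u-w\|_{DG}\le|||R_\epsilon(w)|||\le\sqrt2\,\max\bigl(C_{\mathrm{stab}}(1+L),C_\sigma\bigr)\,\|u-w\|_{DG}$$ hold for all $w\in\mathcal{W}_{DG}$.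
   Context: $\Omega\subset\mathbb{R}^2$ is an open bounded Lipschitz domain. We write $f(u)$ for $f(\cdot,u)$. A weak solution of the boundary value problem is a function $u\in H^1_0(\Omega)$ with $\int_\Omega\{\epsilon\nabla u\cdot\nabla v+uv-f(u)v\}\,dx=0$ for all $v\in H^1_0(\Omega)$. $\|\cdot\|_0$ is the $L^2(\Omega)$-norm. Mesh: $\mathcal{T}$ is a shape-regular subdivision of $\Omega$ into disjoint open parallelograms $\kappa$, $\overline\Omega=\bigcup_{\kappa\in\mathcal{T}}\overline\kappa$, each an affine image $\kappa=\Psi_\kappa(\widehat\kappa)$ of $\widehat\kappa=(0,1)^2$; $h_\kappa$ is the diameter and $\mathbf{n}_\kappa$ the unit outward normal of $\kappa$. The mesh may be 1-irregular: each edge of an element may contain at most one hanging node, located at the midpoint of the edge. $\mathcal{T}$ is of bounded local variation: there is a constant $\rho_1\ge1$ with $\rho_1^{-1}\le h_\kappa/h_{\kappa'}\le\rho_1$ for elements sharing a common edge. $\mathcal{E}$ is the set of all open edges: interior edges $e=(\partial\kappa\cap\partial\kappa')^\circ$ contained in $\Omega$, and boundary edges contained in $\partial\Omega$. $h_e$ is the length of $e$. $\int_{\mathcal{E}}$ means $\sum_{e\in\mathcal{E}}\int_e$. Spaces: each $\kappa$ carries a degree $p_\kappa\ge1$, with $\rho_2^{-1}\le p_\kappa/p_{\kappa'}\le\rho_2$ for neighbouring elements and a constant $\rho_2\ge1$. With $\mathcal{Q}_k(\widehat\kappa)$ the tensor-product polynomials of degree $k$ in each coordinate, $\mathcal{V}_{DG}=\{v\in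 L^2(\Omega): v|_\kappa\circ\Psi_\kappa\in\mathcal{Q}_{p_\kappa}(\widehat\kappa)\ \forall\kappa\in\mathcal{T}\}$. Also $\mathcal{W}_{DG}=H^1_0(\Omega)+\mathcal{V}_{DG}$. For interior $e$, $p_e=\frac12(p_\kappa+p_{\kappa'})$; for a boundary edge of $\kappa$, $p_e=p_\kappa$. Set $\sigma|_e=p_e^2/h_e$. Jumps: on $e=(\partial\kappa\cap\partial\kappa')^\circ$, $[\![v]\!]=v|_\kappa\mathbf{n}_\kappa+v|_{\kappa'}\mathbf{n}_{\kappa'}$; on a boundary edge $[\![v]\!]=v\mathbf{n}$ with $\mathbf n$ the unit outward normal on $\partial\Omega$. $\nabla_{\mathcal{T}}$ is the elementwise gradient. DG norm and inner product: $\|v\|_{DG}^2=(v,v)_{DG}$ with $(v,w)_{DG}=\int_\Omega\{\epsilon\nabla_{\mathcal{T}}v\cdot\nabla_{\mathcal{T}}w+vw\}\,dx+\int_{\mathcal{E}}(\epsilon\sigma+\sigma^{-1})[\![v]\!]\cdot[\![w]\!]\,ds$. Operator $A_{DG}$: let $I_{hp}:\mathcal{V}_{DG}\to H^1_0(\Omega)$ be a (known, fixed) linear averaging operator satisfying, with a constant $C_A>0$ independent of $\mathcal{T}$ and $\mathbf{p}$, $\|v-I_{hp}v\|_0^2\le C_A\sum_{e\in\mathcal{E}}\int_e\sigma^{-1}|[\![v]\!]|^2ds$ and $\|\nabla_{\mathcal{T}}(v-I_{hp}v)\|_0^2\le C_A\sum_{e\in\mathcal{E}}\int_e\sigma|[\![v]\!]|^2ds$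 for all $v\in\mathcal{V}_{DG}$. Let $\mathcal{V}^{\perp}$ be the orthogonal complement, with respect to $(\cdot,\cdot)_{DG}$, of $\mathcal{V}_{DG}\cap H^1_0(\Omega)$ in $\mathcal{V}_{DG}$; then $\mathcal{W}_{DG}=H^1_0(\Omega)\oplus\mathcal{V}^\perp$. For $w=w_0+w^\perp$ with $w_0\in H^1_0(\Omega)$, $w^\perp\in\mathcal{V}^\perp$, set $A_{DG}w=w_0+I_{hp}w^\perp$. Then $A_{DG}:\mathcal{W}_{DG}\to H^1_0(\Omega)$ is linear and satisfies, for all $w\in\mathcal{W}_{DG}$, $\|w-A_{DG}w\|_0^2\le C_A\sum_{e}\int_e\sigma^{-1}|[\![w]\!]|^2ds$ and $\|\nabla_{\mathcal{T}}(w-A_{DG}w)\|_0^2\le C_A\sum_e\int_e\sigma|[\![w]\!]|^2ds$. With $C_{\mathrm{stab}}=\sqrt{2\max(1,C_A)}$ one has $\bigl(\epsilon\|\nabla A_{DG}w\|_0^2+\|A_{DG}w\|_0^2\bigr)^{1/2}\le C_{\mathrm{stab}}\|w\|_{DG}$ for all $w\in\mathcal{W}_{DG}$. Residual: $C_\sigma\ge 0$ is a penalty parameter. $R_\epsilon:\mathcal{W}_{DG}\to\mathcal{W}_{DG}'$ (the dual space) is defined, for $w,v\in\mathcal{W}_{DG}$, by $$\langle R_\epsilon(w),v\rangle=\int_\Omega\{\epsilon\nabla_{\mathcal{T}}w\cdot\nabla A_{DG}v+wA_{DG}v-f(w)A_{DG}v\}\,dx+C_\sigma\int_{\mathcal{E}}(\epsilon\sigma+\sigma^{-1})[\![w]\!]\cdot[\![v]\!]\,ds,$$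 and $|||R_\epsilon(w)|||=\sup_{\phi\in\mathcal{W}_{DG},\,\phi\ne0}\langle R_\epsilon(w),\phi\rangle/\|\phi\|_{DG}$. *)

theory Defs
  imports "HOL-Analysis.Analysis"
begin

section \<open>Function spaces\<close>

text \<open>Elements of \<open>L\<^sup>2\<close> and of the Sobolev spaces are represented by functions; two functions that
  agree almost everywhere on the underlying domain represent the same element. The Sobolev and
  discontinuous Galerkin spaces below are closed under almost-everywhere modification, and values
  outside the domain are irrelevant.\<close>

definition L2 :: "'a measure \<Rightarrow> ('a \<Rightarrow> 'b::euclidean_space) set" where
  "L2 M = {g \<in> borel_measurable M. integrable M (\<lambda>x. (norm (g x))\<^sup>2)}"

definition L2_norm :: "'a measure \<Rightarrow> ('a \<Rightarrow> 'b::euclidean_space) \<Rightarrow> real" where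
  "L2_norm M g = sqrt (LINT x|M. (norm (g x))\<^sup>2)"

primrec Ck :: "nat \<Rightarrow> ('a::euclidean_space \<Rightarrow> real) \<Rightarrow> bool" where
  "Ck 0 \<phi> \<longleftrightarrow> continuous_on UNIV \<phi>"
| "Ck (Suc k) \<phi> \<longleftrightarrow> (\<forall>x. \<phi> differentiable (at x)) \<and>
     (\<forall>v. Ck k (\<lambda>x. frechet_derivative \<phi> (at x) v))"

definition smooth :: "('a::euclidean_space \<Rightarrow> real) \<Rightarrow> bool" where
  "smooth \<phi> \<longleftrightarrow> (\<forall>k. Ck k \<phi>)"

definition test_functions :: "'a::euclidean_space set \<Rightarrow> ('a \<Rightarrow> real) set" where
  "test_functions S = {\<phi>. smooth \<phi> \<and> (\<exists>K. compact K \<and> K \<subseteq> S \<and> (\<forall>x. x \<notin> K \<longrightarrow> \<phi> x = 0))}"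

definition grad :: "('a::euclidean_space \<Rightarrow> real) \<Rightarrow> 'a \<Rightarrow> 'a" where
  "grad \<phi> x = (\<Sum>i\<in>Basis. frechet_derivative \<phi> (at x) i *\<^sub>R i)"

definition has_weak_grad ::
    "'a::euclidean_space set \<Rightarrow> ('a \<Rightarrow> real) \<Rightarrow> ('a \<Rightarrow> 'a) \<Rightarrow> bool" where
  "has_weak_grad S u G \<longleftrightarrow> (\<forall>\<phi>\<in>test_functions S.
     (LINT x|lebesgue_on S. u x *\<^sub>R grad \<phi> x) = - (LINT x|lebesgue_on S. \<phi> x *\<^sub>R G x))"

definition H1 :: "'a::euclidean_space set \<Rightarrow> ('a \<Rightarrow> real) set" where
  "H1 S = {u \<in> L2 (lebesgue_on S). \<exists>G\<in>L2 (lebesgue_on S). has_weak_grad S u G}"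

definition wgrad :: "'a::euclidean_space set \<Rightarrow> ('a \<Rightarrow> real) \<Rightarrow> 'a \<Rightarrow> 'a" where
  "wgrad S u = (SOME G. G \<in> L2 (lebesgue_on S) \<and> has_weak_grad S u G)"

definition H1_norm :: "'a::euclidean_space set \<Rightarrow> ('a \<Rightarrow> real) \<Rightarrow> real" where
  "H1_norm S u = sqrt ((L2_norm (lebesgue_on S) u)\<^sup>2 + (L2_norm (lebesgue_on S) (wgrad S u))\<^sup>2)"

definition H10 :: "'a::euclidean_space set \<Rightarrow> ('a \<Rightarrow> real) set" where
  "H10 S = {u \<in> H1 S. \<exists>\<phi>. (\<forall>n::nat. \<phi> n \<in> test_functions S) \<and>
     (\<lambda>n. H1_norm S (\<lambda>x. \<phi> n x - u x)) \<longlonglongrightarrow> 0}"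

text \<open>Arc length on a segment; the measure does not depend on the order of the two end points.\<close>

definition arc_length :: "'a::euclidean_space set \<Rightarrow> 'a measure" where
  "arc_length e = (case (SOME (a, b). e = open_segment a b) of (a, b) \<Rightarrow>
     scale_measure (ennreal (dist a b))
       (distr (restrict_space lborel {0..1::real}) borel (linepath a b)))"

text \<open>The trace on \<open>e \<subseteq> \<partial>\<kappa>\<close> of a function in \<open>H\<^sup>1(\<kappa>)\<close>: the continuous extension of the restriction
  map \<open>\<phi> \<mapsto> \<phi>|\<^sub>e\<close> from smooth functions (up to the boundary) to \<open>H\<^sup>1(\<kappa>)\<close>.\<close>

definition is_trace ::
    "'a::euclidean_space set \<Rightarrow> 'a set \<Rightarrow> ('a \<Rightarrow> real) \<Rightarrow> ('a \<Rightarrow> real) \<Rightarrow> bool" where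
  "is_trace \<kappa> e v g \<longleftrightarrow> g \<in> L2 (arc_length e) \<and>
     (\<exists>\<phi>. (\<forall>n::nat. smooth (\<phi> n)) \<and>
          (\<lambda>n. H1_norm \<kappa> (\<lambda>x. \<phi> n x - v x)) \<longlonglongrightarrow> 0 \<and>
          (\<lambda>n. L2_norm (arc_length e) (\<lambda>x. \<phi> n x - g x)) \<longlonglongrightarrow> 0)"

definition edge_trace :: "'a::euclidean_space set \<Rightarrow> 'a set \<Rightarrow> ('a \<Rightarrow> real) \<Rightarrow> 'a \<Rightarrow> real" where
  "edge_trace \<kappa> e v = (SOME g. is_trace \<kappa> e v g)"


section \<open>Domain and mesh\<close>

text \<open>Near every boundary point the domain is, in suitable orthonormal coordinates \<open>(s, t)\<close>, the
  region below the graph of a Lipschitz function.\<close>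

definition lipschitz_domain :: "(real^2) set \<Rightarrow> bool" where
  "lipschitz_domain \<Omega> \<longleftrightarrow> open \<Omega> \<and> connected \<Omega> \<and> \<Omega> \<noteq> {} \<and> bounded \<Omega> \<and>
     (\<forall>x\<in>frontier \<Omega>. \<exists>r>0. \<exists>s t. \<exists>\<gamma>::real \<Rightarrow> real. \<exists>M.
        norm s = 1 \<and> norm t = 1 \<and> s \<bullet> t = 0 \<and> M-lipschitz_on UNIV \<gamma> \<and>
        \<Omega> \<inter> ball x r = {y \<in> ball x r. y \<bullet> t < \<gamma> (y \<bullet> s)})"

definition ref_square :: "(real^2) set" where
  "ref_square = {x. \<forall>i. 0 < x $ i \<and> x $ i < 1}"

definition affine_param :: "(real^2 \<Rightarrow> real^2) \<Rightarrow> (real^2) set \<Rightarrow> bool" where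
  "affine_param F \<kappa> \<longleftrightarrow>
     (\<exists>(A::real^2^2) b. invertible A \<and> F = (\<lambda>x. A *v x + b)) \<and> \<kappa> = F ` ref_square"

text \<open>The closed edges of a parallelogram are the facets of its closure, its vertices the extreme
  points of its closure. A hanging node is a vertex of some element that lies in the relative
  interior of an edge of another element. The requirement \<open>a \<noteq> b\<close> discards one-point intersections of
  closed elements, and the relative interior discards isolated points of a closed edge on the
  boundary of \<open>\<Omega>\<close>; a boundary edge may be half of an edge of an element.\<close>

definition interior_edges :: "(real^2) set \<Rightarrow> (real^2) set set \<Rightarrow> (real^2) set set" where
  "interior_edges \<Omega> \<T> = {e. (\<exists>\<kappa>\<in>\<T>. \<exists>\<kappa>'\<in>\<T>. \<kappa> \<noteq> \<kappa>' \<and>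
       e = rel_interior (frontier \<kappa> \<inter> frontier \<kappa>')) \<and>
     e \<subseteq> \<Omega> \<and> (\<exists>a b. a \<noteq> b \<and> e = open_segment a b)}"

definition boundary_edges :: "(real^2) set \<Rightarrow> (real^2) set set \<Rightarrow> (real^2) set set" where
  "boundary_edges \<Omega> \<T> = {e. (\<exists>\<kappa>\<in>\<T>. \<exists>s. s facet_of closure \<kappa> \<and>
       e = rel_interior (s \<inter> frontier \<Omega>)) \<and>
     (\<exists>a b. a \<noteq> b \<and> e = open_segment a b)}"

definition edges :: "(real^2) set \<Rightarrow> (real^2) set set \<Rightarrow> (real^2) set set" where
  "edges \<Omega> \<T> = interior_edges \<Omega> \<T> \<union> boundary_edges \<Omega> \<T>"

definition edge_elements :: "(real^2) set set \<Rightarrow> (real^2) set \<Rightarrow> (real^2) set set" where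
  "edge_elements \<T> e = {\<kappa>\<in>\<T>. e \<subseteq> frontier \<kappa>}"

definition subdivision :: "(real^2) set \<Rightarrow> (real^2) set set \<Rightarrow> ((real^2) set \<Rightarrow> real^2 \<Rightarrow> real^2) \<Rightarrow> bool"
  where
  "subdivision \<Omega> \<T> \<Psi> \<longleftrightarrow> finite \<T> \<and> disjoint \<T> \<and>
     (\<forall>\<kappa>\<in>\<T>. \<kappa> \<subseteq> \<Omega> \<and> affine_param (\<Psi> \<kappa>) \<kappa>) \<and> closure \<Omega> = (\<Union>\<kappa>\<in>\<T>. closure \<kappa>)"

definition shape_regular :: "(real^2) set set \<Rightarrow> real \<Rightarrow> bool" where
  "shape_regular \<T> \<theta> \<longleftrightarrow> (\<forall>\<kappa>\<in>\<T>. \<exists>z. \<exists>r>0. ball z r \<subseteq> \<kappa> \<and> diameter \<kappa> \<le> \<theta> * r)"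

definition one_irregular :: "(real^2) set set \<Rightarrow> bool" where
  "one_irregular \<T> \<longleftrightarrow> (\<forall>\<kappa>\<in>\<T>. \<forall>a b. closed_segment a b facet_of closure \<kappa> \<longrightarrow>
     (\<forall>\<kappa>'\<in>\<T>. \<forall>x\<in>open_segment a b. x extreme_point_of closure \<kappa>' \<longrightarrow> x = midpoint a b))"

definition locally_comparable ::
    "(real^2) set \<Rightarrow> (real^2) set set \<Rightarrow> real \<Rightarrow> ((real^2) set \<Rightarrow> real) \<Rightarrow> bool" where
  "locally_comparable \<Omega> \<T> \<rho> q \<longleftrightarrow>
     (\<forall>e\<in>interior_edges \<Omega> \<T>. \<forall>\<kappa>\<in>edge_elements \<T> e. \<forall>\<kappa>'\<in>edge_elements \<T> e.
        1 / \<rho> \<le> q \<kappa> / q \<kappa>' \<and> q \<kappa> / q \<kappa>' \<le> \<rho>)"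

definition admissible_mesh ::
    "(real^2) set \<Rightarrow> (real^2) set set \<Rightarrow> ((real^2) set \<Rightarrow> real^2 \<Rightarrow> real^2) \<Rightarrow> real \<Rightarrow> real \<Rightarrow> bool" where
  "admissible_mesh \<Omega> \<T> \<Psi> \<theta> \<rho>\<^sub>1 \<longleftrightarrow> subdivision \<Omega> \<T> \<Psi> \<and> shape_regular \<T> \<theta> \<and> one_irregular \<T> \<and>
     1 \<le> \<rho>\<^sub>1 \<and> locally_comparable \<Omega> \<T> \<rho>\<^sub>1 diameter"

definition admissible_degrees ::
    "(real^2) set \<Rightarrow> (real^2) set set \<Rightarrow> ((real^2) set \<Rightarrow> nat) \<Rightarrow> real \<Rightarrow> bool" where
  "admissible_degrees \<Omega> \<T> p \<rho>\<^sub>2 \<longleftrightarrow> (\<forall>\<kappa>\<in>\<T>. 1 \<le> p \<kappa>) \<and>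
     1 \<le> \<rho>\<^sub>2 \<and> locally_comparable \<Omega> \<T> \<rho>\<^sub>2 (\<lambda>\<kappa>. real (p \<kappa>))"


section \<open>Discontinuous Galerkin spaces\<close>

definition tensor_polys :: "nat \<Rightarrow> (real^2 \<Rightarrow> real) set" where
  "tensor_polys k = {q. \<exists>c. q = (\<lambda>x. \<Sum>i\<le>k. \<Sum>j\<le>k. c i j * (x $ 1)^i * (x $ 2)^j)}"

definition V_DG ::
    "(real^2) set \<Rightarrow> (real^2) set set \<Rightarrow> ((real^2) set \<Rightarrow> real^2 \<Rightarrow> real^2) \<Rightarrow> ((real^2) set \<Rightarrow> nat) \<Rightarrow>
     (real^2 \<Rightarrow> real) set" where
  "V_DG \<Omega> \<T> \<Psi> p = {v \<in> L2 (lebesgue_on \<Omega>).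
     \<forall>\<kappa>\<in>\<T>. \<exists>q\<in>tensor_polys (p \<kappa>). AE x in lebesgue_on ref_square. v (\<Psi> \<kappa> x) = q x}"

definition W_DG ::
    "(real^2) set \<Rightarrow> (real^2) set set \<Rightarrow> ((real^2) set \<Rightarrow> real^2 \<Rightarrow> real^2) \<Rightarrow> ((real^2) set \<Rightarrow> nat) \<Rightarrow>
     (real^2 \<Rightarrow> real) set" where
  "W_DG \<Omega> \<T> \<Psi> p = {\<lambda>x. w\<^sub>0 x + v x | w\<^sub>0 v. w\<^sub>0 \<in> H10 \<Omega> \<and> v \<in> V_DG \<Omega> \<T> \<Psi> p}"

definition outward_normal :: "(real^2) set \<Rightarrow> (real^2) set \<Rightarrow> real^2" where
  "outward_normal \<kappa> e = (THE n. norm n = 1 \<and> (\<forall>x\<in>e. \<forall>y\<in>\<kappa>. n \<bullet> (y - x) \<le> 0))"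

text \<open>An interior edge is contained in the boundaries of exactly two elements, a boundary edge in the
  boundary of exactly one, whose outward normal is then that of \<open>\<Omega>\<close>. The sum in the jump and
  the mean value in the edge degree therefore cover both cases.\<close>

definition jump :: "(real^2) set set \<Rightarrow> (real^2) set \<Rightarrow> (real^2 \<Rightarrow> real) \<Rightarrow> real^2 \<Rightarrow> real^2" where
  "jump \<T> e v x = (\<Sum>\<kappa>\<in>edge_elements \<T> e. edge_trace \<kappa> e v x *\<^sub>R outward_normal \<kappa> e)"

definition edge_degree :: "(real^2) set set \<Rightarrow> ((real^2) set \<Rightarrow> nat) \<Rightarrow> (real^2) set \<Rightarrow> real" where
  "edge_degree \<T> p e =
     (\<Sum>\<kappa>\<in>edge_elements \<T> e. real (p \<kappa>)) / real (card (edge_elements \<T> e))"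

definition edge_sigma :: "(real^2) set set \<Rightarrow> ((real^2) set \<Rightarrow> nat) \<Rightarrow> (real^2) set \<Rightarrow> real" where
  "edge_sigma \<T> p e = (edge_degree \<T> p e)\<^sup>2 / diameter e"

definition broken_grad :: "(real^2) set set \<Rightarrow> (real^2 \<Rightarrow> real) \<Rightarrow> real^2 \<Rightarrow> real^2" where
  "broken_grad \<T> v x = (\<Sum>\<kappa>\<in>\<T>. indicator \<kappa> x *\<^sub>R wgrad \<kappa> v x)"

definition edge_integral ::
    "(real^2) set \<Rightarrow> (real^2) set set \<Rightarrow> ((real^2) set \<Rightarrow> real^2 \<Rightarrow> real) \<Rightarrow> real" where
  "edge_integral \<Omega> \<T> g = (\<Sum>e\<in>edges \<Omega> \<T>. LINT x|arc_length e. g e x)"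

definition DG_inner ::
    "(real^2) set \<Rightarrow> (real^2) set set \<Rightarrow> ((real^2) set \<Rightarrow> nat) \<Rightarrow> real \<Rightarrow>
     (real^2 \<Rightarrow> real) \<Rightarrow> (real^2 \<Rightarrow> real) \<Rightarrow> real" where
  "DG_inner \<Omega> \<T> p \<epsilon> v w =
     (LINT x|lebesgue_on \<Omega>. \<epsilon> * (broken_grad \<T> v x \<bullet> broken_grad \<T> w x) + v x * w x) +
     edge_integral \<Omega> \<T> (\<lambda>e x. (\<epsilon> * edge_sigma \<T> p e + 1 / edge_sigma \<T> p e) * (jump \<T> e v x \<bullet> jump \<T> e w x))"

definition DG_norm ::
    "(real^2) set \<Rightarrow> (real^2) set set \<Rightarrow> ((real^2) set \<Rightarrow> nat) \<Rightarrow> real \<Rightarrow> (real^2 \<Rightarrow> real) \<Rightarrow> real" where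
  "DG_norm \<Omega> \<T> p \<epsilon> v = sqrt (DG_inner \<Omega> \<T> p \<epsilon> v v)"


section \<open>The operator \<open>A\<^sub>D\<^sub>G\<close> and the residual\<close>

definition averaging_operator ::
    "(real^2) set \<Rightarrow> (real^2) set set \<Rightarrow> ((real^2) set \<Rightarrow> real^2 \<Rightarrow> real^2) \<Rightarrow> ((real^2) set \<Rightarrow> nat) \<Rightarrow>
     real \<Rightarrow> ((real^2 \<Rightarrow> real) \<Rightarrow> (real^2 \<Rightarrow> real)) \<Rightarrow> bool" where
  "averaging_operator \<Omega> \<T> \<Psi> p C I \<longleftrightarrow>
     (\<forall>v\<in>V_DG \<Omega> \<T> \<Psi> p. I v \<in> H10 \<Omega>) \<and>
     (\<forall>v\<in>V_DG \<Omega> \<T> \<Psi> p. \<forall>w\<in>V_DG \<Omega> \<T> \<Psi> p. \<forall>a b.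
        AE x in lebesgue_on \<Omega>. I (\<lambda>y. a * v y + b * w y) x = a * I v x + b * I w x) \<and>
     (\<forall>v\<in>V_DG \<Omega> \<T> \<Psi> p.
        (L2_norm (lebesgue_on \<Omega>) (\<lambda>x. v x - I v x))\<^sup>2
          \<le> C * edge_integral \<Omega> \<T> (\<lambda>e x. 1 / edge_sigma \<T> p e * (norm (jump \<T> e v x))\<^sup>2) \<and>
        (L2_norm (lebesgue_on \<Omega>) (broken_grad \<T> (\<lambda>x. v x - I v x)))\<^sup>2
          \<le> C * edge_integral \<Omega> \<T> (\<lambda>e x. edge_sigma \<T> p e * (norm (jump \<T> e v x))\<^sup>2))"

definition V_perp ::
    "(real^2) set \<Rightarrow> (real^2) set set \<Rightarrow> ((real^2) set \<Rightarrow> real^2 \<Rightarrow> real^2) \<Rightarrow> ((real^2) set \<Rightarrow> nat) \<Rightarrow>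
     real \<Rightarrow> (real^2 \<Rightarrow> real) set" where
  "V_perp \<Omega> \<T> \<Psi> p \<epsilon> =
     {v \<in> V_DG \<Omega> \<T> \<Psi> p. \<forall>z \<in> V_DG \<Omega> \<T> \<Psi> p \<inter> H10 \<Omega>. DG_inner \<Omega> \<T> p \<epsilon> v z = 0}"

text \<open>The splitting \<open>w = w\<^sub>0 + w\<^sub>1\<close> is unique up to almost-everywhere equality, and so is the value of
  the operator.\<close>

definition A_DG ::
    "(real^2) set \<Rightarrow> (real^2) set set \<Rightarrow> ((real^2) set \<Rightarrow> real^2 \<Rightarrow> real^2) \<Rightarrow> ((real^2) set \<Rightarrow> nat) \<Rightarrow>
     real \<Rightarrow> ((real^2 \<Rightarrow> real) \<Rightarrow> (real^2 \<Rightarrow> real)) \<Rightarrow> (real^2 \<Rightarrow> real) \<Rightarrow> (real^2 \<Rightarrow> real)" where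
  "A_DG \<Omega> \<T> \<Psi> p \<epsilon> I w = (SOME z. \<exists>w\<^sub>0 \<in> H10 \<Omega>. \<exists>w\<^sub>1 \<in> V_perp \<Omega> \<T> \<Psi> p \<epsilon>.
     w = (\<lambda>x. w\<^sub>0 x + w\<^sub>1 x) \<and> z = (\<lambda>x. w\<^sub>0 x + I w\<^sub>1 x))"

definition residual ::
    "(real^2) set \<Rightarrow> (real^2) set set \<Rightarrow> ((real^2) set \<Rightarrow> real^2 \<Rightarrow> real^2) \<Rightarrow> ((real^2) set \<Rightarrow> nat) \<Rightarrow>
     real \<Rightarrow> ((real^2 \<Rightarrow> real) \<Rightarrow> (real^2 \<Rightarrow> real)) \<Rightarrow> (real^2 \<Rightarrow> real \<Rightarrow> real) \<Rightarrow> real \<Rightarrow>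
     (real^2 \<Rightarrow> real) \<Rightarrow> (real^2 \<Rightarrow> real) \<Rightarrow> real" where
  "residual \<Omega> \<T> \<Psi> p \<epsilon> I f C\<^sub>\<sigma> w v =
     (let Av = A_DG \<Omega> \<T> \<Psi> p \<epsilon> I v in
      (LINT x|lebesgue_on \<Omega>.
         \<epsilon> * (broken_grad \<T> w x \<bullet> wgrad \<Omega> Av x) + w x * Av x - f x (w x) * Av x)) +
     C\<^sub>\<sigma> * edge_integral \<Omega> \<T>
       (\<lambda>e x. (\<epsilon> * edge_sigma \<T> p e + 1 / edge_sigma \<T> p e) * (jump \<T> e w x \<bullet> jump \<T> e v x))"

text \<open>The supremum is taken in the extended reals, so that an upper bound for it includes the
  boundedness of the functional. The condition \<open>\<phi> \<noteq> 0\<close> is meant in \<open>L\<^sup>2(\<Omega>)\<close>.\<close>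

definition residual_norm ::
    "(real^2) set \<Rightarrow> (real^2) set set \<Rightarrow> ((real^2) set \<Rightarrow> real^2 \<Rightarrow> real^2) \<Rightarrow> ((real^2) set \<Rightarrow> nat) \<Rightarrow>
     real \<Rightarrow> ((real^2 \<Rightarrow> real) \<Rightarrow> (real^2 \<Rightarrow> real)) \<Rightarrow> (real^2 \<Rightarrow> real \<Rightarrow> real) \<Rightarrow> real \<Rightarrow>
     (real^2 \<Rightarrow> real) \<Rightarrow> ereal" where
  "residual_norm \<Omega> \<T> \<Psi> p \<epsilon> I f C\<^sub>\<sigma> w =
     (SUP \<phi> \<in> {\<phi> \<in> W_DG \<Omega> \<T> \<Psi> p. \<not> (AE x in lebesgue_on \<Omega>. \<phi> x = 0)}.
        ereal (residual \<Omega> \<T> \<Psi> p \<epsilon> I f C\<^sub>\<sigma> w \<phi> / DG_norm \<Omega> \<T> p \<epsilon> \<phi>))"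


section \<open>The boundary value problem\<close>

definition C1_on :: "'a::real_normed_vector set \<Rightarrow> ('a \<Rightarrow> 'b::real_normed_vector) \<Rightarrow> bool" where
  "C1_on S g \<longleftrightarrow> (\<exists>D::'a \<Rightarrow> 'a \<Rightarrow>\<^sub>L 'b. continuous_on S D \<and>
     (\<forall>z\<in>S. (g has_derivative blinfun_apply (D z)) (at z within S)))"

definition weak_solution ::
    "(real^2) set \<Rightarrow> real \<Rightarrow> (real^2 \<Rightarrow> real \<Rightarrow> real) \<Rightarrow> (real^2 \<Rightarrow> real) \<Rightarrow> bool" where
  "weak_solution \<Omega> \<epsilon> f u \<longleftrightarrow> u \<in> H10 \<Omega> \<and>
     (\<forall>v\<in>H10 \<Omega>. (LINT x|lebesgue_on \<Omega>.
        \<epsilon> * (wgrad \<Omega> u x \<bullet> wgrad \<Omega> v x) + u x * v x - f x (u x) * v x) = 0)"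

end

theory Submission
  imports Defs
begin

text \<open>Since \<open>A\<^sub>D\<^sub>G \<phi>\<close> lies in \<open>H\<^sup>1\<^sub>0(\<Omega>)\<close> and \<open>u\<close> is a weak solution without jumps, the residual at \<open>w\<close> depends only
  on \<open>v = w - u\<close> and \<open>d = f(w) - f(u)\<close>:
  \<open>\<langle>R(w), \<phi>\<rangle> = E(v, A\<^sub>D\<^sub>G \<phi>) - \<integral> d A\<^sub>D\<^sub>G \<phi> + C\<^sub>\<sigma> J(v, \<phi>)\<close>, where \<open>E\<close> and \<open>J\<close> are the volume and the jump part
  of the inner product. The Lipschitz bound on \<open>f\<close> and the stability of \<open>A\<^sub>D\<^sub>G\<close> give the upper bound.
  For the lower bound take \<open>\<phi> = v\<close>: the one-sided bound on \<open>f'\<close> yields \<open>E(v, v) - \<integral> d v \<ge> c\<^sub>0 E(v, v)\<close>, and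
  the perturbation caused by \<open>v - A\<^sub>D\<^sub>G v\<close>, whose energy is at most \<open>C\<^sub>A J(v, v)\<close>, is absorbed by the penalty
  term through Young's inequality. Linearity of \<open>A\<^sub>D\<^sub>G\<close> is never needed.

  The ingredients about the concrete spaces are these: weak gradients are unique (fundamental lemma);
  traces on edges exist and are unique (trace inequality and completeness of \<open>L\<^sup>2\<close>); functions in
  \<open>H\<^sup>1\<^sub>0(\<Omega>)\<close> have no jumps, because the outward normals on the two sides of an interior edge are opposite;
  and the splitting that defines \<open>A\<^sub>D\<^sub>G\<close> exists by projection onto \<open>V\<^sub>D\<^sub>G \<inter> H\<^sup>1\<^sub>0(\<Omega>)\<close>.\<close>

subsection \<open>Smooth functions\<close>

text \<open>Weak gradients and traces are picked by \<open>SOME\<close>; their properties are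
  transferred from explicit witnesses by almost-everywhere uniqueness, and linearity becomes exact
  only under the integral. \<open>broken_space\<close> contains \<open>W_DG\<close> and is chosen so
  that the volume form, the jump form and their sum are positive semidefinite bilinear forms on it.

  Traces are exhibited for the two kinds of summand in \<open>W_DG\<close>: a piecewise polynomial
  agrees with a smooth function on each element, and a function of \<open>H10\<close> brings one
  approximating sequence of test functions on the whole domain. That one sequence serves every
  element at an edge, which is why the traces from both sides coincide.

  Constants: sqrt 2 comes from bounding sqrt E + sqrt J by sqrt (2 (E + J)). Half of the coercivity
  c_0 E is spent in Young's inequality, so the penalty has to pay C_A (1 + L)^2 / (2 c_0) for the
  perturbation and c_0 / 2 for the jump part of the norm. If u = w, the lower bound still asks for a
  nonzero test function, since the supremum must not fall below 0.\<close>

lemma Ck_SucI: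
  assumes "\<And>x. (\<phi> has_derivative D x) (at x)" "\<And>v. Ck k (\<lambda>x. D x v)"
  shows "Ck (Suc k) \<phi>"
proof -
  have "frechet_derivative \<phi> (at x) = D x" for x
    using frechet_derivative_at[OF assms(1)[of x]] by simp
  then show ?thesis
    using assms by (auto simp: differentiable_def)
qed

lemma Ck_differentiable: "Ck (Suc k) \<phi> \<Longrightarrow> (\<phi> has_derivative frechet_derivative \<phi> (at x)) (at x)"
  by (simp add: frechet_derivative_works)

text \<open>\<open>Ck (Suc k)\<close> asks for differentiability but does not mention continuity of
  the function itself; the base case recovers it from differentiability.\<close>

lemma Ck_SucD: "Ck (Suc k) \<phi> \<Longrightarrow> Ck k \<phi>"
proof (induction k arbitrary: \<phi>)
  case 0
  then show ?case
    by (auto simp: continuous_on_eq_continuous_at differentiable_imp_continuous_within)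
next
  case (Suc k)
  then show ?case
    by (meson Ck.simps(2))
qed

lemma Ck_const: "Ck k (\<lambda>x. c)"
proof (induction k arbitrary: c)
  case (Suc k)
  show ?case
    by (rule Ck_SucI[where D = "\<lambda>x v. 0"]) (auto intro: Suc)
qed auto

lemma Ck_add: "Ck k \<phi> \<Longrightarrow> Ck k \<psi> \<Longrightarrow> Ck k (\<lambda>x. \<phi> x + \<psi> x)"
proof (induction k arbitrary: \<phi> \<psi>)
  case (Suc k)
  show ?case
    by (rule Ck_SucI[OF has_derivative_add[OF Ck_differentiable[OF Suc.prems(1)] Ck_differentiable[OF Suc.prems(2)]]])
      (use Suc in auto)
qed (auto intro: continuous_intros)

text \<open>The product rule leaves one factor undifferentiated in each summand;
  \<open>Ck_SucD\<close> lowers its class so that the induction hypothesis applies.\<close>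

lemma Ck_mult: "Ck k \<phi> \<Longrightarrow> Ck k \<psi> \<Longrightarrow> Ck k (\<lambda>x. \<phi> x * \<psi> x)"
proof (induction k arbitrary: \<phi> \<psi>)
  case (Suc k)
  note Suc.prems[THEN Ck_SucD, simp]
  show ?case
    by (rule Ck_SucI[OF has_derivative_mult[OF Ck_differentiable[OF Suc.prems(1)] Ck_differentiable[OF Suc.prems(2)]]])
      (use Suc in \<open>auto intro!: Ck_add Suc.IH\<close>)
qed (auto intro: continuous_intros)

lemma smooth_const: "smooth (\<lambda>x. c)"
  by (simp add: smooth_def Ck_const)

lemma smooth_add: "smooth \<phi> \<Longrightarrow> smooth \<psi> \<Longrightarrow> smooth (\<lambda>x. \<phi> x + \<psi> x)"
  by (simp add: smooth_def Ck_add)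

lemma smooth_mult: "smooth \<phi> \<Longrightarrow> smooth \<psi> \<Longrightarrow> smooth (\<lambda>x. \<phi> x * \<psi> x)"
  by (simp add: smooth_def Ck_mult)

lemma smooth_power: "smooth \<phi> \<Longrightarrow> smooth (\<lambda>x. \<phi> x ^ n)"
  by (induction n) (auto intro: smooth_const smooth_mult)

lemma smooth_sum: "(\<And>i. i \<in> A \<Longrightarrow> smooth (\<phi> i)) \<Longrightarrow> smooth (\<lambda>x. \<Sum>i\<in>A. \<phi> i x)"
  by (induction A rule: infinite_finite_induct) (auto intro: smooth_const smooth_add)

lemma smooth_prod: "(\<And>i. i \<in> A \<Longrightarrow> smooth (\<phi> i)) \<Longrightarrow> smooth (\<lambda>x. \<Prod>i\<in>A. \<phi> i x)"
  by (induction A rule: infinite_finite_induct) (auto intro: smooth_const smooth_mult)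

text \<open>The shape \<open>u + c * v\<close> is the form in which linearity is stated throughout:
  \<open>c = 1\<close> gives sums and \<open>c = -1\<close> differences.\<close>

lemma smooth_lincomb: "smooth \<phi> \<Longrightarrow> smooth \<psi> \<Longrightarrow> smooth (\<lambda>x. \<phi> x + c * \<psi> x)"
  by (intro smooth_add smooth_mult smooth_const)

lemma smooth_bounded_linear:
  assumes "bounded_linear l"
  shows "smooth l"
proof -
  have "Ck k l" for k
  proof (cases k)
    case (Suc m)
    show ?thesis unfolding Suc
      by (rule Ck_SucI[where D = "\<lambda>x. l"]) (auto intro: Ck_const bounded_linear_imp_has_derivative assms)
  qed (auto intro: linear_continuous_on assms)
  then show ?thesis by (simp add: smooth_def)
qed

lemma smooth_imp_has_derivative:
  "smooth \<phi> \<Longrightarrow> (\<phi> has_derivative frechet_derivative \<phi> (at x)) (at x)"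
  unfolding smooth_def using Ck_differentiable by blast

lemma smooth_imp_continuous_on: "smooth \<phi> \<Longrightarrow> continuous_on S \<phi>"
  using continuous_on_subset unfolding smooth_def by (metis Ck.simps(1) subset_UNIV)

lemma frechet_derivative_eq_inner_grad:
  assumes "smooth \<phi>"
  shows "frechet_derivative \<phi> (at x) v = grad \<phi> x \<bullet> v"
proof -
  interpret D: bounded_linear "frechet_derivative \<phi> (at x)"
    using smooth_imp_has_derivative[OF assms] has_derivative_bounded_linear by blast
  have "frechet_derivative \<phi> (at x) v = frechet_derivative \<phi> (at x) (\<Sum>i\<in>Basis. (v \<bullet> i) *\<^sub>R i)"
    by (simp add: euclidean_representation)
  also have "\<dots> = (\<Sum>i\<in>Basis. (v \<bullet> i) * frechet_derivative \<phi> (at x) i)"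
    by (simp add: D.sum D.scaleR)
  also have "\<dots> = grad \<phi> x \<bullet> v"
    by (simp add: grad_def inner_sum_left inner_commute[of v] mult.commute)
  finally show ?thesis .
qed

lemma smooth_has_derivative_grad:
  "smooth \<phi> \<Longrightarrow> (\<phi> has_derivative (\<lambda>v. grad \<phi> x \<bullet> v)) (at x)"
  using smooth_imp_has_derivative[of \<phi> x] frechet_derivative_eq_inner_grad[of \<phi> x]
  by (metis (no_types, lifting) ext)

lemma smooth_frechet_derivative: "smooth \<phi> \<Longrightarrow> smooth (\<lambda>x. frechet_derivative \<phi> (at x) v)"
  unfolding smooth_def using Ck.simps(2) by blast

lemma smooth_grad_component: "smooth \<phi> \<Longrightarrow> smooth (\<lambda>x. grad \<phi> x \<bullet> v)"
  using smooth_frechet_derivative[of \<phi> v] by (simp add: frechet_derivative_eq_inner_grad)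

lemma continuous_on_grad: "smooth \<phi> \<Longrightarrow> continuous_on S (grad \<phi>)"
  unfolding grad_def[abs_def]
  by (intro continuous_intros smooth_imp_continuous_on smooth_frechet_derivative)

lemma grad_eqI:
  assumes "(\<phi> has_derivative (\<lambda>v. g \<bullet> v)) (at x)"
  shows "grad \<phi> x = g"
  using frechet_derivative_at[OF assms, symmetric]
  by (simp add: grad_def euclidean_representation)

lemma grad_mult:
  assumes "smooth \<phi>" "smooth \<psi>"
  shows "grad (\<lambda>x. \<phi> x * \<psi> x) x = \<phi> x *\<^sub>R grad \<psi> x + \<psi> x *\<^sub>R grad \<phi> x"
  by (rule grad_eqI)
    (use has_derivative_mult[OF smooth_has_derivative_grad[OF assms(1), of x] smooth_has_derivative_grad[OF assms(2), of x]]
      in \<open>simp add: inner_add_left algebra_simps\<close>)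

text \<open>The complement of a compact set is open, so the function vanishes in a whole
  neighbourhood of \<open>x\<close>.\<close>

lemma grad_eq_0_outside:
  assumes "compact K" "\<And>x. x \<notin> K \<Longrightarrow> \<phi> x = 0" "x \<notin> K"
  shows "grad \<phi> x = 0"
proof (rule grad_eqI)
  have "((\<lambda>x. 0) has_derivative (\<lambda>v. 0)) (at x)" by simp
  then have "(\<phi> has_derivative (\<lambda>v. 0)) (at x)"
    by (rule has_derivative_transform_within_open[where s = "- K"]) (use assms in \<open>auto simp: compact_imp_closed\<close>)
  then show "(\<phi> has_derivative (\<lambda>v. 0 \<bullet> v)) (at x)" by simp
qed

subsection \<open>A smooth cut-off\<close>

text \<open>The family is closed under differentiation up to linear combinations.\<close>

definition flat_exp :: "nat \<Rightarrow> real \<Rightarrow> real" where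
  "flat_exp m t = (if t > 0 then (1 / t) ^ m * exp (- (1 / t)) else 0)"

text \<open>Substituting \<open>t = 1 / s\<close> turns the right-hand limit into that of
  \<open>s ^ m / exp s\<close> at infinity; on the left the function is zero.\<close>

lemma flat_exp_tendsto_0: "(flat_exp m \<longlongrightarrow> 0) (at 0)"
proof -
  have "((\<lambda>t::real. t ^ m / exp t) \<longlongrightarrow> 0) at_top"
    by (rule tendsto_power_div_exp_0)
  then have "((\<lambda>t::real. inverse t ^ m / exp (inverse t)) \<longlongrightarrow> 0) (at_right 0)"
    by (rule filterlim_compose) (rule filterlim_inverse_at_top_right)
  then have "(flat_exp m \<longlongrightarrow> 0) (at_right 0)"
    by (rule Lim_transform_eventually)
      (auto simp: eventually_at_filter flat_exp_def exp_minus field_simps)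
  moreover have "(flat_exp m \<longlongrightarrow> 0) (at_left 0)"
    by (rule Lim_transform_eventually[OF tendsto_const])
      (auto simp: eventually_at_filter flat_exp_def)
  ultimately show ?thesis
    by (simp add: filterlim_at_split)
qed

lemma flat_exp_has_derivative:
  "(flat_exp m has_real_derivative (flat_exp (m + 2) t - real m * flat_exp (m + 1) t)) (at t)"
proof -
  consider "t > 0" | "t = 0" | "t < 0" by linarith
  then show ?thesis
  proof cases
    case 1
    \<comment> \<open>The power rule produces the exponent \<open>m - 1\<close> with truncated
      subtraction; for \<open>m = 0\<close> its term carries the factor 0.\<close>
    have "m = 0 \<or> t * t ^ (m - 1) = t ^ m"
      by (cases m) auto
    then have "((\<lambda>t. (1 / t) ^ m * exp (- (1 / t))) has_real_derivative
        (flat_exp (m + 2) t - real m * flat_exp (m + 1) t)) (at t)"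
      using 1
      by (auto intro!: derivative_eq_intros simp: flat_exp_def field_simps power2_eq_square)
    then show ?thesis
      by (rule has_field_derivative_transform_within_open[where S = "{0<..}"]) (use 1 in \<open>auto simp: flat_exp_def\<close>)
  next
    case 2
    \<comment> \<open>The difference quotient at 0 is again a member of the family. At
      \<open>h = 0\<close> both sides are 0, because division by 0 gives 0.\<close>
    have "(\<lambda>h. (flat_exp m h - flat_exp m 0) / h) = flat_exp (m + 1)"
      by (auto simp: flat_exp_def fun_eq_iff)
    then have "(flat_exp m has_real_derivative 0) (at 0)"
      using flat_exp_tendsto_0[of "m + 1"] by (simp add: has_field_derivative_iff)
    then show ?thesis
      using 2 by (simp add: flat_exp_def)
  next
    case 3
    have "((\<lambda>t. 0) has_real_derivative (flat_exp (m + 2) t - real m * flat_exp (m + 1) t)) (at t)"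
      using 3 by (simp add: flat_exp_def)
    then show ?thesis
      by (rule has_field_derivative_transform_within_open[where S = "{..<0}"]) (use 3 in \<open>auto simp: flat_exp_def\<close>)
  qed
qed

text \<open>Induction over the order of differentiability for all \<open>m\<close> at once, since a
  derivative raises the exponents. The affine argument covers both kinds of factor in
  \<open>box_bump\<close>.\<close>

lemma smooth_flat_exp: "smooth (\<lambda>x. flat_exp m (x \<bullet> i + c))"
proof -
  have "Ck k (\<lambda>x. flat_exp m (x \<bullet> i + c))" for k
  proof (induction k arbitrary: m)
    case 0
    have "continuous_on UNIV (flat_exp m)"
      using flat_exp_has_derivative DERIV_isCont continuous_at_imp_continuous_on by blast
    then show ?case
      by (auto intro!: continuous_on_compose2[of UNIV "flat_exp m"] continuous_intros)
  next
    case (Suc k)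
    show ?case
    proof (rule Ck_SucI)
      fix x
      have d: "((\<lambda>x. x \<bullet> i + c) has_derivative (\<lambda>v. v \<bullet> i)) (at x)"
        by (auto intro!: derivative_eq_intros)
      show "((\<lambda>x. flat_exp m (x \<bullet> i + c)) has_derivative
        (\<lambda>v. v \<bullet> i * (flat_exp (m + 2) (x \<bullet> i + c) + - real m * flat_exp (m + 1) (x \<bullet> i + c)))) (at x)"
        using has_derivative_compose[OF d flat_exp_has_derivative[of m "x \<bullet> i + c", unfolded has_field_derivative_def]]
        by (simp add: algebra_simps)
    next
      show "Ck k (\<lambda>x. v \<bullet> i * (flat_exp (m + 2) (x \<bullet> i + c) + - real m * flat_exp (m + 1) (x \<bullet> i + c)))" for v
        by (intro Ck_mult Ck_add Ck_const Suc)
    qed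
  qed
  then show ?thesis by (simp add: smooth_def)
qed

text \<open>The exponents shrink with \<open>k\<close>, so that the products increase to the indicator of the box.\<close>

definition box_bump :: "'a::euclidean_space \<Rightarrow> 'a \<Rightarrow> nat \<Rightarrow> 'a \<Rightarrow> real" where
  "box_bump a b k x = (\<Prod>i\<in>Basis. flat_exp 0 (real (Suc k) * (x \<bullet> i - a \<bullet> i)) *
     flat_exp 0 (real (Suc k) * (b \<bullet> i - x \<bullet> i)))"

lemma flat_exp_0_bounds: "0 \<le> flat_exp 0 t" "flat_exp 0 t \<le> 1"
  by (auto simp: flat_exp_def)

lemma box_bump_bounds: "0 \<le> box_bump a b k x" "box_bump a b k x \<le> 1"
  unfolding box_bump_def
  by (intro prod_nonneg prod_le_1 ballI mult_nonneg_nonneg mult_le_one conjI flat_exp_0_bounds)+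

lemma smooth_box_bump: "smooth (box_bump a b k)"
proof -
  have 1: "smooth (\<lambda>x. flat_exp 0 (real (Suc k) * (x \<bullet> i - a \<bullet> i)))" for i
    using smooth_flat_exp[of 0 "real (Suc k) *\<^sub>R i" "- real (Suc k) * (a \<bullet> i)"] by (simp add: algebra_simps)
  have 2: "smooth (\<lambda>x. flat_exp 0 (real (Suc k) * (b \<bullet> i - x \<bullet> i)))" for i
    using smooth_flat_exp[of 0 "- real (Suc k) *\<^sub>R i" "real (Suc k) * (b \<bullet> i)"] by (simp add: algebra_simps)
  show ?thesis
    unfolding box_bump_def[abs_def] by (intro smooth_prod smooth_mult 1 2)
qed

lemma box_bump_eq_0:
  assumes "x \<notin> box a b"
  shows "box_bump a b k x = 0"
proof -
  obtain i where "i \<in> Basis" "x \<bullet> i \<le> a \<bullet> i \<or> b \<bullet> i \<le> x \<bullet> i"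
    using assms by (auto simp: mem_box not_less)
  then show ?thesis
    unfolding box_bump_def
    by (intro prod_zero) (auto simp: flat_exp_def zero_less_mult_iff intro!: bexI[of _ i])
qed

text \<open>Inside the box each factor has the form \<open>exp (- 1 / ((k + 1) t))\<close> with
  fixed \<open>t > 0\<close> and tends to 1; outside, the product is 0 for every
  \<open>k\<close>.\<close>

lemma box_bump_tendsto: "(\<lambda>k. box_bump a b k x) \<longlonglongrightarrow> indicator (box a b) x"
proof (cases "x \<in> box a b")
  case True
  have *: "(\<lambda>k. flat_exp 0 (real (Suc k) * t)) \<longlonglongrightarrow> 1" if "t > 0" for t
    unfolding flat_exp_def using that by simp real_asymp
  have "(\<lambda>k. box_bump a b k x) \<longlonglongrightarrow> (\<Prod>i\<in>(Basis::'a set). 1 * 1)"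
    unfolding box_bump_def
    by (intro tendsto_prod tendsto_mult *) (use True in \<open>auto simp: mem_box\<close>)
  then show ?thesis using True by simp
next
  case False
  then show ?thesis by (simp add: box_bump_eq_0)
qed

text \<open>The bump lives on the open box, but a test function needs a compact set inside
  \<open>S\<close>; the closed box provides it.\<close>

lemma box_bump_test_function:
  assumes "cbox a b \<subseteq> S"
  shows "box_bump a b k \<in> test_functions S"
  unfolding test_functions_def using assms subsetD[OF box_subset_cbox]
  by (auto intro!: exI[of _ "cbox a b"] box_bump_eq_0 smooth_box_bump)

subsection \<open>Square integrable functions\<close>

lemma L2_measurable: "g \<in> L2 M \<Longrightarrow> g \<in> borel_measurable M"
  by (simp add: L2_def)

lemma L2_integrable: "g \<in> L2 M \<Longrightarrow> integrable M (\<lambda>x. (norm (g x))\<^sup>2)"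
  by (simp add: L2_def)

lemma L2_norm_nonneg: "0 \<le> L2_norm M g"
  by (simp add: L2_norm_def)

lemma L2_norm_squared: "(L2_norm M g)\<^sup>2 = (LINT x|M. (norm (g x))\<^sup>2)"
  by (simp add: L2_norm_def)

lemma L2_dominated:
  assumes "g \<in> borel_measurable M" "h \<in> L2 M" "AE x in M. norm (g x) \<le> C * norm (h x)"
  shows "g \<in> L2 M"
proof -
  have "integrable M (\<lambda>x. (norm (g x))\<^sup>2)"
  proof (rule Bochner_Integration.integrable_bound)
    show "integrable M (\<lambda>x. C\<^sup>2 * (norm (h x))\<^sup>2)"
      using assms(2) by (simp add: L2_def)
    show "AE x in M. norm ((norm (g x))\<^sup>2) \<le> norm (C\<^sup>2 * (norm (h x))\<^sup>2)"
      using assms(3)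
    proof eventually_elim
      case (elim x)
      then have "(norm (g x))\<^sup>2 \<le> (C * norm (h x))\<^sup>2"
        by (intro power_mono) auto
      then show ?case by (simp add: power_mult_distrib)
    qed
  qed (use assms(1) in auto)
  with assms(1) show ?thesis by (simp add: L2_def)
qed

lemma L2_inner_integrable:
  fixes g h :: "'a \<Rightarrow> 'b::euclidean_space"
  assumes "g \<in> L2 M" "h \<in> L2 M"
  shows "integrable M (\<lambda>x. g x \<bullet> h x)"
proof (rule Bochner_Integration.integrable_bound)
  show "integrable M (\<lambda>x. (norm (g x))\<^sup>2 + (norm (h x))\<^sup>2)"
    using assms by (simp add: L2_def)
  show "(\<lambda>x. g x \<bullet> h x) \<in> borel_measurable M"
    using assms by (intro borel_measurable_inner L2_measurable)
  have "\<bar>a \<bullet> b\<bar> \<le> (norm a)\<^sup>2 + (norm b)\<^sup>2" for a b :: 'b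
  proof -
    have "2 * (norm a * norm b) \<le> (norm a)\<^sup>2 + (norm b)\<^sup>2"
      using sum_squares_bound[of "norm a" "norm b"] by simp
    then show ?thesis
      using Cauchy_Schwarz_ineq2[of a b] mult_nonneg_nonneg[of "norm a" "norm b"] by auto
  qed
  then show "AE x in M. norm (g x \<bullet> h x) \<le> norm ((norm (g x))\<^sup>2 + (norm (h x))\<^sup>2)"
    by auto
qed

lemma L2_mult_integrable:
  fixes g h :: "'a \<Rightarrow> real"
  shows "g \<in> L2 M \<Longrightarrow> h \<in> L2 M \<Longrightarrow> integrable M (\<lambda>x. g x * h x)"
  using L2_inner_integrable[of g M h] by simp

lemma L2_scaleR_integrable:
  fixes g :: "'a \<Rightarrow> real" and h :: "'a \<Rightarrow> 'b::euclidean_space"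
  assumes "g \<in> L2 M" "h \<in> L2 M"
  shows "integrable M (\<lambda>x. g x *\<^sub>R h x)"
proof (rule Bochner_Integration.integrable_bound)
  have "(\<lambda>x. norm (h x)) \<in> L2 M" "(\<lambda>x. norm (g x)) \<in> L2 M"
    using assms by (auto simp: L2_def)
  then show "integrable M (\<lambda>x. norm (g x) * norm (h x))"
    by (rule L2_mult_integrable[rotated])
qed (use assms in \<open>auto simp: L2_def\<close>)

text \<open>The two sides differ by the square of \<open>norm (a - b)\<close>. This bound takes the
  place of the triangle inequality in the limit arguments below.\<close>

lemma norm_add_squared_le:
  fixes a b :: "'a::real_inner"
  shows "(norm (a + b))\<^sup>2 \<le> 2 * (norm a)\<^sup>2 + 2 * (norm b)\<^sup>2"
proof -
  have "0 \<le> (norm (a - b))\<^sup>2" by simp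
  then show ?thesis
    unfolding power2_norm_eq_inner by (simp add: inner_diff inner_add inner_commute)
qed

lemma L2_add:
  assumes "g \<in> L2 M" "h \<in> L2 M"
  shows "(\<lambda>x. g x + h x) \<in> L2 M"
proof -
  have "integrable M (\<lambda>x. (norm (g x + h x))\<^sup>2)"
  proof (rule Bochner_Integration.integrable_bound)
    show "integrable M (\<lambda>x. 2 * (norm (g x))\<^sup>2 + 2 * (norm (h x))\<^sup>2)"
      using assms by (simp add: L2_def)
    show "AE x in M. norm ((norm (g x + h x))\<^sup>2) \<le> norm (2 * (norm (g x))\<^sup>2 + 2 * (norm (h x))\<^sup>2)"
      using norm_add_squared_le by auto
  qed (use assms in \<open>auto simp: L2_def\<close>)
  moreover have "(\<lambda>x. g x + h x) \<in> borel_measurable M"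
    using assms by (intro borel_measurable_add L2_measurable)
  ultimately show ?thesis by (simp add: L2_def)
qed

lemma L2_scaleR: "g \<in> L2 M \<Longrightarrow> (\<lambda>x. c *\<^sub>R g x) \<in> L2 M"
  by (auto simp: L2_def power_mult_distrib)

lemma L2_cmult:
  fixes g :: "'a \<Rightarrow> real"
  shows "g \<in> L2 M \<Longrightarrow> (\<lambda>x. c * g x) \<in> L2 M"
  using L2_scaleR[of g M c] by simp

lemma L2_diff: "g \<in> L2 M \<Longrightarrow> h \<in> L2 M \<Longrightarrow> (\<lambda>x. g x - h x) \<in> L2 M"
  using L2_add[of g M "\<lambda>x. (-1) *\<^sub>R h x"] L2_scaleR[of h M "-1"] by simp

lemma L2_zero: "(\<lambda>x. 0) \<in> L2 M"
  by (simp add: L2_def)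

lemma L2_inner_const: "G \<in> L2 M \<Longrightarrow> (\<lambda>x. G x \<bullet> i) \<in> L2 M"
  by (rule L2_dominated[of _ _ G "norm i"])
    (auto simp: L2_def Cauchy_Schwarz_ineq2 mult.commute[of "norm i"])

lemma (in finite_measure) L2_bounded:
  assumes "g \<in> borel_measurable M" "\<And>x. x \<in> space M \<Longrightarrow> norm (g x) \<le> B"
  shows "g \<in> L2 M"
proof -
  have "integrable M (\<lambda>x. (norm (g x))\<^sup>2)"
  proof (rule integrable_const_bound[where B = "B\<^sup>2"])
    show "AE x in M. norm ((norm (g x))\<^sup>2) \<le> B\<^sup>2"
      using assms(2) by (auto intro!: AE_I2 power_mono)
  qed (use assms(1) in auto)
  then show ?thesis using assms(1) by (simp add: L2_def)
qed

lemma (in finite_measure) L2_imp_integrable: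
  assumes "g \<in> L2 M"
  shows "integrable M g"
proof -
  have "(\<lambda>x. 1::real) \<in> L2 M"
    by (rule L2_bounded[where B = 1]) auto
  then show ?thesis
    using L2_scaleR_integrable[of "\<lambda>x. 1" M g] assms by simp
qed

lemma integral_squared_add_le:
  assumes "g \<in> L2 M" "h \<in> L2 M"
  shows "(LINT x|M. (norm (g x + h x))\<^sup>2) \<le> 2 * (LINT x|M. (norm (g x))\<^sup>2) + 2 * (LINT x|M. (norm (h x))\<^sup>2)"
proof -
  have "(LINT x|M. (norm (g x + h x))\<^sup>2) \<le> (LINT x|M. 2 * (norm (g x))\<^sup>2 + 2 * (norm (h x))\<^sup>2)"
    by (rule integral_mono) (use assms L2_add[OF assms] norm_add_squared_le in \<open>auto simp: L2_def\<close>)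
  also have "\<dots> = 2 * (LINT x|M. (norm (g x))\<^sup>2) + 2 * (LINT x|M. (norm (h x))\<^sup>2)"
    using assms by (simp add: L2_def)
  finally show ?thesis .
qed

lemma integral_squared_eq_0_iff:
  assumes "g \<in> L2 M"
  shows "(LINT x|M. (norm (g x))\<^sup>2) = 0 \<longleftrightarrow> (AE x in M. g x = 0)"
  using integral_nonneg_eq_0_iff_AE[OF L2_integrable[OF assms]] by simp

lemma discriminant_le:
  fixes a b c :: real
  assumes "\<And>t. 0 \<le> a + 2 * t * b + t\<^sup>2 * c"
  shows "\<bar>b\<bar> \<le> sqrt a * sqrt c"
proof -
  have a: "0 \<le> a" using assms[of 0] by simp
  have "b\<^sup>2 \<le> a * c"
  proof (cases "c = 0")
    case True
    have "b = 0"
    proof (rule ccontr)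
      assume "b \<noteq> 0"
      \<comment> \<open>At the chosen \<open>t\<close> the polynomial, which is affine here, takes
        the value -1.\<close>
      then show False
        using assms[of "- (a + 1) / (2 * b)"] a True by (simp add: field_simps)
    qed
    then show ?thesis using True by simp
  next
    case False
    have "0 \<le> c"
    proof (rule ccontr)
      assume "\<not> 0 \<le> c"
      then have "filterlim (\<lambda>t. a + 2 * t * b + t\<^sup>2 * c) at_bot at_top"
        by real_asymp
      then have "\<forall>\<^sub>F t in at_top. a + 2 * t * b + t\<^sup>2 * c < 0"
        by (simp add: filterlim_at_bot_dense)
      then show False
        using assms eventually_happens'[OF trivial_limit_at_top_linorder] by (meson not_less)
    qed
    then have c: "c > 0" using False by simp
    \<comment> \<open>\<open>- b / c\<close> is the minimiser of the quadratic.\<close>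
    have "0 \<le> a + 2 * (- b / c) * b + (- b / c)\<^sup>2 * c" by (rule assms)
    also have "\<dots> = a - b\<^sup>2 / c" using c by (simp add: field_simps power2_eq_square)
    finally show ?thesis using c by (simp add: field_simps)
  qed
  then show ?thesis
    using real_sqrt_le_mono[of "b\<^sup>2" "a * c"] by (simp add: real_sqrt_mult)
qed

lemma L2_Cauchy_Schwarz:
  assumes "g \<in> L2 M" "h \<in> L2 M"
  shows "\<bar>LINT x|M. g x \<bullet> h x\<bar> \<le> L2_norm M g * L2_norm M h"
  unfolding L2_norm_def
proof (rule discriminant_le)
  fix t
  have "0 \<le> (LINT x|M. (norm (g x + t *\<^sub>R h x))\<^sup>2)" by simp
  also have "\<dots> = (LINT x|M. (norm (g x))\<^sup>2 + 2 * t * (g x \<bullet> h x) + t\<^sup>2 * (norm (h x))\<^sup>2)"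
    unfolding power2_norm_eq_inner
    by (simp add: inner_add inner_commute algebra_simps power2_eq_square)
  also have "\<dots> = (LINT x|M. (norm (g x))\<^sup>2) + 2 * t * (LINT x|M. g x \<bullet> h x) + t\<^sup>2 * (LINT x|M. (norm (h x))\<^sup>2)"
    using L2_inner_integrable[OF assms] L2_integrable[OF assms(1)] L2_integrable[OF assms(2)] by simp
  finally show "0 \<le> \<dots>" .
qed

subsection \<open>The fundamental lemma of the calculus of variations\<close>

text \<open>Dynkin's argument: boxes form an intersection-stable generator of the Borel sets, so
  integrals that vanish over boxes vanish over all Borel sets, and such a density is null.\<close>

lemma AE_zero_if_integral_box_zero:
  fixes g :: "'a::euclidean_space \<Rightarrow> real"
  assumes g: "integrable lebesgue g"
    and box: "\<And>a b. (LINT x|lebesgue. indicator (box a b) x * g x) = 0"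
  shows "AE x in lebesgue. g x = 0"
proof -
  \<comment> \<open>The argument takes place among Borel sets, so \<open>g\<close> is replaced by a
    Borel function that agrees with it almost everywhere.\<close>
  obtain h where h[measurable]: "h \<in> borel_measurable lborel" and gh: "AE x in lborel. g x = h x"
    using completion_ex_borel_measurable_real[of g lborel] g by blast
  have gh': "AE x in lebesgue. g x = h x"
    using gh by (rule AE_completion)
  have gm[measurable]: "g \<in> borel_measurable lebesgue" using g by auto
  have [measurable]: "h \<in> borel_measurable lebesgue" using h by (rule measurable_completion)
  have "integrable lebesgue h"
    using g gh' by (subst integrable_cong_AE[of h _ g]) (auto elim: eventually_mono)
  then have ih: "integrable lborel h"
    by (simp add: integrable_completion)
  have box': "(LINT x:box a b|lborel. h x) = 0" for a b
  proof -
    have [measurable]: "(indicator (box a b) :: 'a \<Rightarrow> real) \<in> borel_measurable lebesgue"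
      by (intro borel_measurable_indicator) auto
    have "(LINT x:box a b|lborel. h x) = (LINT x|lebesgue. indicator (box a b) x * h x)"
      unfolding set_lebesgue_integral_def by (simp add: integral_completion)
    also have "\<dots> = (LINT x|lebesgue. indicator (box a b) x * g x)"
      by (rule integral_cong_AE) (use gh' in \<open>auto elim: eventually_mono\<close>)
    finally show ?thesis using box by simp
  qed
  have si: "set_integrable lborel A h" if "A \<in> sets borel" for A
    unfolding set_integrable_def using ih that by (intro integrable_mult_indicator) auto
  \<comment> \<open>Complements in the Dynkin induction need the integral over the whole space,
    obtained as a limit over growing boxes.\<close>
  have univ: "(LINT x:UNIV|lborel. h x) = 0"
  proof -
    have "(\<lambda>n. LINT x|lborel. indicator (box (- (real n *\<^sub>R One)) (real n *\<^sub>R One)) x *\<^sub>R h x)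
        \<longlonglongrightarrow> (LINT x|lborel. h x)"
    proof (rule integral_dominated_convergence[where w = "\<lambda>x. norm (h x)"])
      show "AE x in lborel. (\<lambda>n. indicator (box (- (real n *\<^sub>R One)) (real n *\<^sub>R One)) x *\<^sub>R h x) \<longlonglongrightarrow> h x"
      proof (intro AE_I2)
        fix x :: 'a
        obtain N :: nat where N: "norm x < real N" using reals_Archimedean2 by blast
        have "indicator (box (- (real n *\<^sub>R One)) (real n *\<^sub>R One)) x *\<^sub>R h x = h x" if "n \<ge> N" for n
        proof -
          have "\<bar>x \<bullet> i\<bar> < real n" if "i \<in> Basis" for i
            using Basis_le_norm[OF that, of x] N \<open>n \<ge> N\<close> by linarith
          then have "x \<in> box (- (real n *\<^sub>R One)) (real n *\<^sub>R One)"
            by (force simp: mem_box abs_less_iff)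
          then show ?thesis by simp
        qed
        then show "(\<lambda>n. indicator (box (- (real n *\<^sub>R One)) (real n *\<^sub>R One)) x *\<^sub>R h x) \<longlonglongrightarrow> h x"
          by (intro tendsto_eventually) (auto simp: eventually_sequentially)
      qed
    qed (use ih in \<open>auto simp: indicator_def\<close>)
    then have "(LINT x|lborel. h x) = 0"
      using box' by (simp only: set_lebesgue_integral_def LIMSEQ_const_iff)
    then show ?thesis by (simp add: set_lebesgue_integral_def)
  qed
  have "(LINT x:A|lborel. h x) = 0" if "A \<in> sets borel" for A
  proof -
    let ?E = "range (\<lambda>(a, b). box a b::'a set)"
    have "Int_stable ?E" by (auto simp: Int_stable_def box_Int_box)
    moreover have "?E \<subseteq> Pow UNIV" by simp
    moreover have "A \<in> sigma_sets UNIV ?E"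
      using that unfolding borel_eq_box by (simp add: sets_measure_of)
    ultimately show ?thesis
    proof (induction rule: sigma_sets_induct_disjoint)
      case (basic A)
      then show ?case using box' by auto
    next
      case empty
      show ?case by (simp add: set_lebesgue_integral_def)
    next
      case (compl A)
      then have A: "A \<in> sets borel"
        unfolding borel_eq_box by (simp add: sets_measure_of)
      have "(LINT x:A \<union> (UNIV - A)|lborel. h x) = (LINT x:A|lborel. h x) + (LINT x:UNIV - A|lborel. h x)"
        by (rule set_integral_Un) (use A si in auto)
      then show ?case using compl univ by simp
    next
      case (union A)
      then have A: "A i \<in> sets borel" for i
        unfolding borel_eq_box by (auto simp: sets_measure_of)
      show ?case
        by (subst lebesgue_integral_countable_add)
          (use A union si in \<open>auto simp: disjoint_family_on_def\<close>)
    qed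
  qed
  then have "AE x in lborel. h x = 0"
    by (intro sigma_finite_measure.density_zero[OF sigma_finite_lborel ih]) auto
  then have "AE x in lebesgue. h x = 0"
    by (rule AE_completion)
  with gh' show ?thesis by eventually_elim auto
qed

lemma test_function_bounded:
  assumes "\<phi> \<in> test_functions S"
  obtains B where "\<And>x. \<bar>\<phi> x\<bar> \<le> B"
proof -
  obtain K where K: "compact K" "\<And>x. x \<notin> K \<Longrightarrow> \<phi> x = 0" "smooth \<phi>"
    using assms by (auto simp: test_functions_def)
  have "bounded (\<phi> ` K)"
    using K by (intro compact_imp_bounded compact_continuous_image smooth_imp_continuous_on)
  then obtain B where B: "B > 0" "\<And>x. x \<in> K \<Longrightarrow> \<bar>\<phi> x\<bar> \<le> B"
    by (auto simp: bounded_pos)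
  have "\<bar>\<phi> x\<bar> \<le> B" for x
    using B K(2)[of x] by (cases "x \<in> K") auto
  then show ?thesis by (rule that)
qed

text \<open>The bumps of a box converge to its indicator, so by dominated convergence
  \<open>g\<close> integrates to zero over all small boxes in \<open>S\<close>. This gives
  \<open>g = 0\<close> almost everywhere on each box whose closure lies in \<open>S\<close>, and
  countably many of these cover \<open>S\<close>.\<close>

lemma fundamental_lemma:
  fixes g :: "'a::euclidean_space \<Rightarrow> real"
  assumes S: "open S" and g: "g \<in> L2 (lebesgue_on S)"
    and orth: "\<And>\<phi>. \<phi> \<in> test_functions S \<Longrightarrow> (LINT x|lebesgue_on S. \<phi> x * g x) = 0"
  shows "AE x in lebesgue_on S. g x = 0"
proof -
  have Sm: "S \<inter> space lebesgue \<in> sets lebesgue" using S by auto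
  let ?g = "\<lambda>x. indicator S x * g x"
  have cbm: "(indicator (cbox a b) :: 'a \<Rightarrow> real) \<in> borel_measurable lebesgue" for a b
    by (intro borel_measurable_indicator) auto
  have bm: "(indicator (box a b) :: 'a \<Rightarrow> real) \<in> borel_measurable lebesgue" for a b
    by (intro borel_measurable_indicator) auto
  have gm: "?g \<in> borel_measurable lebesgue"
    using L2_measurable[OF g] S by (subst (asm) borel_measurable_restrict_space_iff) (auto simp: mult.commute)
  have g2: "integrable lebesgue (\<lambda>x. indicator S x * (g x)\<^sup>2)"
    using L2_integrable[OF g] Sm by (simp add: integrable_restrict_space)
  have local: "AE x in lebesgue. x \<in> box c d \<longrightarrow> g x = 0" if cd: "cbox c d \<subseteq> S" for c d
  proof -
    have sub: "box c d \<subseteq> S" using cd box_subset_cbox by blast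
    \<comment> \<open>The bound |t| <= 1 + t^2 turns square integrability into integrability on the
      bounded box.\<close>
    have int: "integrable lebesgue (\<lambda>x. indicator (cbox c d) x * ?g x)"
    proof (rule Bochner_Integration.integrable_bound)
      show "integrable lebesgue (\<lambda>x. indicator (cbox c d) x + indicator S x * (g x)\<^sup>2)"
        by (intro Bochner_Integration.integrable_add g2)
          (use emeasure_lborel_cbox_finite[of c d] in \<open>simp add: integrable_completion integrable_indicator_iff\<close>)
      have t: "\<bar>t\<bar> \<le> 1 + t\<^sup>2" for t :: real
      proof -
        have "2 * \<bar>t\<bar> \<le> 1 + t\<^sup>2"
          using sum_squares_bound[of "1::real" "\<bar>t\<bar>"] by simp
        then show ?thesis using abs_ge_zero[of t] by linarith
      qed
      then show "AE x in lebesgue. norm (indicator (cbox c d) x * ?g x) \<le>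
          norm (indicator (cbox c d) x + indicator S x * (g x)\<^sup>2)"
        by (intro AE_I2) (use t in \<open>simp add: indicator_def\<close>)
    qed (intro borel_measurable_times cbm gm)
    have zero: "(LINT x|lebesgue. indicator (box a b) x * g x) = 0" if ab: "cbox a b \<subseteq> cbox c d" for a b
    proof -
      have "(\<lambda>k. LINT x|lebesgue. box_bump a b k x * ?g x) \<longlonglongrightarrow> (LINT x|lebesgue. indicator (box a b) x * ?g x)"
      proof (rule integral_dominated_convergence[where w = "\<lambda>x. norm (indicator (cbox c d) x * ?g x)"])
        show "AE x in lebesgue. (\<lambda>k. box_bump a b k x * ?g x) \<longlonglongrightarrow> indicator (box a b) x * ?g x"
          by (intro AE_I2 tendsto_mult box_bump_tendsto tendsto_const)
        fix k
        have "x \<in> cbox c d" if "box_bump a b k x \<noteq> 0" for x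
          using box_bump_eq_0[of x a b k] ab box_subset_cbox that by blast
        then have "\<bar>box_bump a b k x\<bar> \<le> indicator (cbox c d) x" for x
          using box_bump_bounds[of a b k x] by (cases "x \<in> cbox c d") auto
        then show "AE x in lebesgue. norm (box_bump a b k x * ?g x) \<le> norm (indicator (cbox c d) x * ?g x)"
          by (intro AE_I2) (simp add: abs_mult mult_right_mono del: abs_mult_pos)
        have "box_bump a b k \<in> borel_measurable borel"
          by (intro borel_measurable_continuous_onI smooth_imp_continuous_on smooth_box_bump)
        then have "box_bump a b k \<in> borel_measurable lebesgue"
          by (intro measurable_completion) simp
        then show "(\<lambda>x. box_bump a b k x * ?g x) \<in> borel_measurable lebesgue"
          by (intro borel_measurable_times gm)
        show "(\<lambda>x. indicator (box a b) x * ?g x) \<in> borel_measurable lebesgue"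
          by (intro borel_measurable_times bm gm)
        show "integrable lebesgue (\<lambda>x. norm (indicator (cbox c d) x * ?g x))"
          using int by (rule integrable_norm)
      qed
      moreover have "(LINT x|lebesgue. box_bump a b k x * ?g x) = 0" for k
      proof -
        have "box_bump a b k \<in> test_functions S"
          using ab cd by (intro box_bump_test_function) auto
        then have "(LINT x|lebesgue_on S. box_bump a b k x * g x) = 0" by (rule orth)
        then show ?thesis using Sm by (simp add: integral_restrict_space ac_simps)
      qed
      ultimately have "(LINT x|lebesgue. indicator (box a b) x * ?g x) = 0"
        by (simp add: LIMSEQ_const_iff)
      moreover have "indicator (box a b) x * ?g x = indicator (box a b) x * g x" for x
        using ab cd box_subset_cbox[of a b] by (auto simp: indicator_def)
      ultimately show ?thesis by simp
    qed
    have "AE x in lebesgue. indicator (box c d) x * g x = 0"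
    proof (rule AE_zero_if_integral_box_zero)
      have "integrable lebesgue (\<lambda>x. indicator (box c d) x *\<^sub>R (indicator (cbox c d) x * ?g x))"
        by (rule integrable_mult_indicator[OF _ int]) auto
      moreover have "indicator (box c d) x *\<^sub>R (indicator (cbox c d) x * ?g x) = indicator (box c d) x * g x" for x
        using sub box_subset_cbox[of c d] by (auto simp: indicator_def)
      ultimately show "integrable lebesgue (\<lambda>x. indicator (box c d) x * g x)" by (simp only:)
    next
      fix a b :: 'a
      \<comment> \<open>Corners of the intersection: an arbitrary box is cut down to one inside
        \<open>cbox c d\<close>.\<close>
      let ?a = "\<Sum>i\<in>Basis. max (a \<bullet> i) (c \<bullet> i) *\<^sub>R i" and ?b = "\<Sum>i\<in>Basis. min (b \<bullet> i) (d \<bullet> i) *\<^sub>R i"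
      have eq: "box ?a ?b = box a b \<inter> box c d" "cbox ?a ?b = cbox a b \<inter> cbox c d"
        by (simp_all only: box_Int_box Int_interval)
      have "indicator (box a b) x * (indicator (box c d) x * g x) = indicator (box ?a ?b) x * g x" for x
        unfolding eq by (simp add: indicator_inter_arith mult.assoc)
      moreover have "cbox ?a ?b \<subseteq> cbox c d"
        unfolding eq by simp
      ultimately show "(LINT x|lebesgue. indicator (box a b) x * (indicator (box c d) x * g x)) = 0"
        using zero by (simp only:)
    qed
    then show ?thesis by eventually_elim (auto simp: indicator_def)
  qed
  let ?F = "{box c d | c d. cbox c d \<subseteq> S}"
  \<comment> \<open>An almost-everywhere statement survives only countable unions, hence the
    countable subcover.\<close>
  obtain F' where F': "F' \<subseteq> ?F" "countable F'" "\<Union>F' = \<Union>?F"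
    by (rule Lindelof[of ?F]) auto
  have cover: "S \<subseteq> \<Union>?F"
  proof
    fix x assume "x \<in> S"
    then obtain a b where "cbox a b \<subseteq> S" "x \<in> box a b"
      by (rule open_contains_cbox[OF S])
    then show "x \<in> \<Union>?F" by (intro UnionI[of "box a b"]) auto
  qed
  have "AE x in lebesgue. \<forall>X\<in>F'. x \<in> X \<longrightarrow> g x = 0"
    unfolding AE_ball_countable[OF F'(2)]
  proof
    fix X assume "X \<in> F'"
    then obtain c d where "X = box c d" "cbox c d \<subseteq> S" using F'(1) by auto
    then show "AE x in lebesgue. x \<in> X \<longrightarrow> g x = 0" using local by simp
  qed
  then have "AE x in lebesgue. x \<in> \<Union>?F \<longrightarrow> g x = 0"
    unfolding F'(3)[symmetric] by (rule eventually_mono) blast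
  then have "AE x in lebesgue. x \<in> S \<longrightarrow> g x = 0"
    by (rule eventually_mono) (use cover in blast)
  then show ?thesis by (subst AE_restrict_space_iff[OF Sm])
qed

subsection \<open>Weak gradients\<close>

lemma sets_lebesgue_open: "open S \<Longrightarrow> S \<in> sets lebesgue"
  by auto

lemma finite_measure_open_bounded:
  fixes S :: "'a::euclidean_space set"
  assumes "open S" "bounded S"
  shows "finite_measure (lebesgue_on S)"
  using assms by (intro finite_measure_lebesgue_on bounded_set_imp_lmeasurable) auto

lemma L2_continuous:
  fixes g :: "'a::euclidean_space \<Rightarrow> 'b::euclidean_space"
  assumes "open S" "bounded S" "continuous_on UNIV g"
  shows "g \<in> L2 (lebesgue_on S)"
proof -
  have "bounded (g ` closure S)"
    using assms by (intro compact_imp_bounded compact_continuous_image)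
      (auto intro: continuous_on_subset)
  then obtain B where B: "\<And>x. x \<in> closure S \<Longrightarrow> norm (g x) \<le> B"
    by (auto simp: bounded_iff)
  show ?thesis
  proof (rule finite_measure.L2_bounded[OF finite_measure_open_bounded[OF assms(1,2)]])
    show "g \<in> borel_measurable (lebesgue_on S)"
      using assms by (intro continuous_imp_measurable_on_sets_lebesgue continuous_on_subset[OF assms(3)]) auto
    show "norm (g x) \<le> B" if "x \<in> space (lebesgue_on S)" for x
      using that closure_subset[of S] by (intro B) auto
  qed
qed

lemma L2_smooth: "open S \<Longrightarrow> bounded S \<Longrightarrow> smooth \<phi> \<Longrightarrow> \<phi> \<in> L2 (lebesgue_on S)"
  by (intro L2_continuous smooth_imp_continuous_on)

lemma L2_grad: "open S \<Longrightarrow> bounded S \<Longrightarrow> smooth \<phi> \<Longrightarrow> grad \<phi> \<in> L2 (lebesgue_on S)"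
  by (intro L2_continuous continuous_on_grad)

lemma test_functions_smooth: "\<phi> \<in> test_functions S \<Longrightarrow> smooth \<phi>"
  by (simp add: test_functions_def)

lemma test_functions_mono: "S \<subseteq> T \<Longrightarrow> test_functions S \<subseteq> test_functions T"
  unfolding test_functions_def by blast

lemma test_functions_lincomb:
  assumes "\<phi> \<in> test_functions S" "\<psi> \<in> test_functions S"
  shows "(\<lambda>x. \<phi> x + c * \<psi> x) \<in> test_functions S"
proof -
  obtain K L where "compact K" "K \<subseteq> S" "\<forall>x. x \<notin> K \<longrightarrow> \<phi> x = 0" "compact L" "L \<subseteq> S" "\<forall>x. x \<notin> L \<longrightarrow> \<psi> x = 0"
    using assms by (auto simp: test_functions_def)
  then show ?thesis
    using assms by (auto simp: test_functions_def intro!: smooth_lincomb exI[of _ "K \<union> L"])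
qed

lemma test_function_mult:
  assumes "smooth g" "\<phi> \<in> test_functions S"
  shows "(\<lambda>x. g x * \<phi> x) \<in> test_functions S"
  using assms by (force simp: test_functions_def intro!: smooth_mult)

lemma test_function_eq_0: "\<phi> \<in> test_functions S \<Longrightarrow> x \<notin> S \<Longrightarrow> \<phi> x = 0"
  by (auto simp: test_functions_def)

lemma test_function_grad_eq_0:
  assumes "\<phi> \<in> test_functions S" "x \<notin> S"
  shows "grad \<phi> x = 0"
proof -
  obtain K where "compact K" "K \<subseteq> S" "\<forall>x. x \<notin> K \<longrightarrow> \<phi> x = 0"
    using assms by (auto simp: test_functions_def)
  with assms(2) show ?thesis by (intro grad_eq_0_outside[of K]) auto
qed

lemma test_function_grad_component:
  assumes "\<phi> \<in> test_functions S"
  shows "(\<lambda>x. grad \<phi> x \<bullet> i) \<in> test_functions S"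
proof -
  obtain K where K: "compact K" "K \<subseteq> S" "\<forall>x. x \<notin> K \<longrightarrow> \<phi> x = 0"
    using assms by (auto simp: test_functions_def)
  then have "grad \<phi> x = 0" if "x \<notin> K" for x
    using that by (intro grad_eq_0_outside[of K]) auto
  then show ?thesis
    using K smooth_grad_component[OF test_functions_smooth[OF assms]]
    unfolding test_functions_def by auto
qed

lemma smooth_has_real_derivative_line:
  assumes "smooth h"
  shows "((\<lambda>t. h (x + t *\<^sub>R v)) has_real_derivative (grad h (x + t *\<^sub>R v) \<bullet> v)) (at t)"
proof -
  have "((\<lambda>t. x + t *\<^sub>R v) has_derivative (\<lambda>s. s *\<^sub>R v)) (at t)"
    by (auto intro!: derivative_eq_intros)
  from has_derivative_compose[OF this smooth_has_derivative_grad[OF assms]]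
  show ?thesis
    by (simp add: has_field_derivative_def mult.commute[of _ "grad h _ \<bullet> v"])
qed

lemma bounded_measurable_integrable:
  fixes g :: "'a::euclidean_space \<Rightarrow> real"
  assumes "g \<in> borel_measurable borel" "compact K" "\<And>x. \<bar>g x\<bar> \<le> B * indicator K x"
  shows "integrable lborel g"
proof (rule Bochner_Integration.integrable_bound)
  show "integrable lborel (\<lambda>x. B * indicator K x)"
    using assms(2) emeasure_compact_finite[of K] borel_compact[of K]
    by (intro integrable_mult_right) (simp add: integrable_indicator_iff)
  show "AE x in lborel. norm (g x) \<le> norm (B * indicator K x)"
    using assms(3) by (intro AE_I2) (metis abs_ge_self order_trans real_norm_def)
qed (use assms in auto)

text \<open>By translation invariance the difference quotients have integral zero.\<close>

lemma integral_grad_test_function: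
  fixes h :: "'a::euclidean_space \<Rightarrow> real"
  assumes h: "h \<in> test_functions UNIV"
  shows "(LINT x|lborel. grad h x \<bullet> i) = 0"
proof -
  obtain K where K: "compact K" "\<And>x. x \<notin> K \<Longrightarrow> h x = 0"
    using h by (auto simp: test_functions_def)
  have sm: "smooth h" using h by (rule test_functions_smooth)
  have [measurable]: "h \<in> borel_measurable borel"
    using sm by (intro borel_measurable_continuous_onI smooth_imp_continuous_on)
  obtain B where B: "\<And>x. \<bar>grad h x \<bullet> i\<bar> \<le> B"
    using test_function_bounded[OF test_function_grad_component[OF h]] by metis
  obtain C where C: "\<And>x. \<bar>h x\<bar> \<le> C"
    using test_function_bounded[OF h] by metis
  \<comment> \<open>The support swept backwards along \<open>i\<close> by lengths up to 1. All the
    difference quotients vanish off this set, since their steps \<open>1 / Suc n\<close> are at most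
    1.\<close>
  define K' where "K' = (\<lambda>(x, t). x - t *\<^sub>R i) ` (K \<times> {0..1::real})"
  have K': "compact K'"
    unfolding K'_def using K(1)
    by (intro compact_continuous_image compact_Times) (auto simp: case_prod_beta intro!: continuous_intros)
  define s where "s n x = (h (x + (1 / real (Suc n)) *\<^sub>R i) - h x) * real (Suc n)" for n x
  have "(\<lambda>n. LINT x|lborel. s n x) \<longlonglongrightarrow> (LINT x|lborel. grad h x \<bullet> i)"
  proof (rule integral_dominated_convergence[where w = "\<lambda>x. B * indicator K' x"])
    show "(\<lambda>x. grad h x \<bullet> i) \<in> borel_measurable lborel"
      using smooth_imp_continuous_on[OF smooth_grad_component[OF sm]] borel_measurable_continuous_onI by auto
    show "s n \<in> borel_measurable lborel" for n
      unfolding s_def by measurable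
    show "integrable lborel (\<lambda>x. B * indicator K' x)"
      using K' emeasure_compact_finite[of K'] borel_compact[of K']
      by (intro integrable_mult_right) (simp add: integrable_indicator_iff)
    show "AE x in lborel. (\<lambda>n. s n x) \<longlonglongrightarrow> grad h x \<bullet> i"
    proof (intro AE_I2)
      fix x
      have "((\<lambda>t. (h (x + t *\<^sub>R i) - h x) / t) \<longlongrightarrow> grad h x \<bullet> i) (at 0)"
        using smooth_has_real_derivative_line[OF sm, of x i 0] by (simp add: has_field_derivative_iff)
      moreover have "filterlim (\<lambda>n. 1 / real (Suc n)) (at 0) sequentially"
        unfolding filterlim_at using LIMSEQ_inverse_real_of_nat by (auto simp: inverse_eq_divide)
      ultimately have "(\<lambda>n. (h (x + (1 / real (Suc n)) *\<^sub>R i) - h x) / (1 / real (Suc n))) \<longlonglongrightarrow> grad h x \<bullet> i"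
        by (rule filterlim_compose)
      then show "(\<lambda>n. s n x) \<longlonglongrightarrow> grad h x \<bullet> i"
        by (simp add: s_def)
    qed
    show "AE x in lborel. norm (s n x) \<le> B * indicator K' x" for n
    proof (intro AE_I2)
      fix x
      let ?t = "1 / real (Suc n)"
      show "norm (s n x) \<le> B * indicator K' x"
      proof (cases "x \<in> K'")
        case True
        \<comment> \<open>The mean value theorem bounds the quotients by \<open>B\<close> uniformly
          in \<open>n\<close>, which supplies the dominating function.\<close>
        have "\<exists>z. 0 < z \<and> z < ?t \<and> h (x + ?t *\<^sub>R i) - h (x + 0 *\<^sub>R i) = (?t - 0) * (grad h (x + z *\<^sub>R i) \<bullet> i)"
          by (rule MVT2) (auto intro: smooth_has_real_derivative_line[OF sm])
        then obtain z where "h (x + ?t *\<^sub>R i) - h x = ?t * (grad h (x + z *\<^sub>R i) \<bullet> i)"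
          by auto
        then have "s n x = grad h (x + z *\<^sub>R i) \<bullet> i"
          unfolding s_def by simp
        then show ?thesis using B[of "x + z *\<^sub>R i"] True by simp
      next
        case False
        have "x - 0 *\<^sub>R i \<in> K'" if "x \<in> K"
          unfolding K'_def by (rule image_eqI[of _ _ "(x, 0)"]) (use that in auto)
        moreover have "(x + ?t *\<^sub>R i) - ?t *\<^sub>R i \<in> K'" if "x + ?t *\<^sub>R i \<in> K"
          unfolding K'_def by (rule image_eqI[of _ _ "(x + ?t *\<^sub>R i, ?t)"]) (use that in auto)
        ultimately have "x \<notin> K" "x + ?t *\<^sub>R i \<notin> K" using False by auto
        then show ?thesis using False K(2) by (simp add: s_def)
      qed
    qed
  qed
  moreover have "(LINT x|lborel. s n x) = 0" for n
  proof -
    let ?c = "(1 / real (Suc n)) *\<^sub>R i"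
    have ih: "integrable lborel h"
    proof (rule bounded_measurable_integrable[OF _ K(1)])
      show "\<bar>h x\<bar> \<le> C * indicator K x" for x
        using C[of x] K(2)[of x] by (cases "x \<in> K") auto
    qed auto
    have d: "distr lborel borel ((+) ?c) = lborel"
      by (rule lborel_distr_plus)
    have m: "(+) ?c \<in> lborel \<rightarrow>\<^sub>M borel" by simp
    have "integrable (distr lborel borel ((+) ?c)) h"
      using ih by (simp only: d)
    then have it: "integrable lborel (\<lambda>x. h (?c + x))"
      by (subst (asm) integrable_distr_eq[OF m]) auto
    have "(LINT x|lborel. h x) = (LINT x|distr lborel borel ((+) ?c). h x)"
      by (simp only: d)
    also have "\<dots> = (LINT x|lborel. h (?c + x))"
      by (rule integral_distr[OF m]) auto
    finally have "(LINT x|lborel. h (?c + x) - h x) = 0"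
      using ih it by simp
    then show ?thesis
      unfolding s_def by (simp add: add.commute)
  qed
  ultimately show ?thesis
    by (simp add: LIMSEQ_const_iff)
qed

lemma lebesgue_on_integral_eq_lborel:
  fixes g :: "'a::euclidean_space \<Rightarrow> real"
  assumes "S \<in> sets lebesgue" "g \<in> borel_measurable borel" "\<And>x. x \<notin> S \<Longrightarrow> g x = 0"
  shows "(LINT x|lebesgue_on S. g x) = (LINT x|lborel. g x)"
proof -
  have "(LINT x|lebesgue_on S. g x) = (LINT x|lebesgue. indicator S x *\<^sub>R g x)"
    using assms(1) by (intro integral_restrict_space) auto
  also have "(\<lambda>x. indicator S x *\<^sub>R g x) = g"
  proof
    show "indicator S x *\<^sub>R g x = g x" for x
      using assms(3)[of x] by (cases "x \<in> S") auto
  qed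
  also have "(LINT x|lebesgue. g x) = (LINT x|lborel. g x)"
    using assms(2) by (intro integral_completion) simp
  finally show ?thesis .
qed

text \<open>Integration by parts: the product of a smooth function and a test function is a test
  function, and its gradient integrates to zero.\<close>

lemma has_weak_grad_smooth:
  fixes g :: "'a::euclidean_space \<Rightarrow> real"
  assumes S: "open S" "bounded S" and g: "smooth g"
  shows "has_weak_grad S g (grad g)"
  unfolding has_weak_grad_def
proof
  fix \<phi> assume \<phi>: "\<phi> \<in> test_functions S"
  then have sm: "smooth \<phi>" by (rule test_functions_smooth)
  let ?h = "\<lambda>x. g x * \<phi> x"
  have h: "?h \<in> test_functions S" using g \<phi> by (rule test_function_mult)
  have i1: "integrable (lebesgue_on S) (\<lambda>x. g x *\<^sub>R grad \<phi> x)"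
    and i2: "integrable (lebesgue_on S) (\<lambda>x. \<phi> x *\<^sub>R grad g x)"
    by (intro L2_scaleR_integrable L2_smooth L2_grad S g sm)+
  have "((LINT x|lebesgue_on S. g x *\<^sub>R grad \<phi> x) + (LINT x|lebesgue_on S. \<phi> x *\<^sub>R grad g x)) \<bullet> i = 0" for i
  proof -
    have "((LINT x|lebesgue_on S. g x *\<^sub>R grad \<phi> x) + (LINT x|lebesgue_on S. \<phi> x *\<^sub>R grad g x)) \<bullet> i =
        (LINT x|lebesgue_on S. g x *\<^sub>R grad \<phi> x + \<phi> x *\<^sub>R grad g x) \<bullet> i"
      using i1 i2 by simp
    also have "\<dots> = (LINT x|lebesgue_on S. (g x *\<^sub>R grad \<phi> x + \<phi> x *\<^sub>R grad g x) \<bullet> i)"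
      using i1 i2 by (intro integral_inner_left[symmetric]) auto
    also have "\<dots> = (LINT x|lebesgue_on S. grad ?h x \<bullet> i)"
      by (simp add: grad_mult g sm)
    also have "\<dots> = (LINT x|lborel. grad ?h x \<bullet> i)"
    proof (rule lebesgue_on_integral_eq_lborel)
      show "(\<lambda>x. grad ?h x \<bullet> i) \<in> borel_measurable borel"
        by (intro borel_measurable_continuous_onI smooth_imp_continuous_on smooth_grad_component smooth_mult g sm)
      show "grad ?h x \<bullet> i = 0" if "x \<notin> S" for x
        using test_function_grad_eq_0[OF h that] by simp
    qed (use S in auto)
    also have "\<dots> = 0"
      using h test_functions_mono[of S UNIV] by (intro integral_grad_test_function) auto
    finally show ?thesis .
  qed
  then have "(LINT x|lebesgue_on S. g x *\<^sub>R grad \<phi> x) + (LINT x|lebesgue_on S. \<phi> x *\<^sub>R grad g x) = 0"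
    using inner_eq_zero_iff by blast
  then show "(LINT x|lebesgue_on S. g x *\<^sub>R grad \<phi> x) = - (LINT x|lebesgue_on S. \<phi> x *\<^sub>R grad g x)"
    by (simp add: eq_neg_iff_add_eq_0)
qed

text \<open>Each component of the difference of two weak gradients is orthogonal to all test
  functions, so the fundamental lemma applies.\<close>

lemma has_weak_grad_unique:
  fixes G H :: "'a::euclidean_space \<Rightarrow> 'a"
  assumes S: "open S" "bounded S" and G: "G \<in> L2 (lebesgue_on S)" "has_weak_grad S u G"
    and H: "H \<in> L2 (lebesgue_on S)" "has_weak_grad S u H"
  shows "AE x in lebesgue_on S. G x = H x"
proof -
  have "AE x in lebesgue_on S. (G x - H x) \<bullet> i = 0" for i
  proof (rule fundamental_lemma[OF S(1)])
    show "(\<lambda>x. (G x - H x) \<bullet> i) \<in> L2 (lebesgue_on S)"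
      by (intro L2_inner_const L2_diff G H)
    fix \<phi> assume \<phi>: "\<phi> \<in> test_functions S"
    then have \<phi>2: "\<phi> \<in> L2 (lebesgue_on S)"
      by (intro L2_smooth S test_functions_smooth)
    have i: "integrable (lebesgue_on S) (\<lambda>x. \<phi> x *\<^sub>R G x)" "integrable (lebesgue_on S) (\<lambda>x. \<phi> x *\<^sub>R H x)"
      by (intro L2_scaleR_integrable \<phi>2 G H)+
    have "(LINT x|lebesgue_on S. \<phi> x *\<^sub>R G x) = (LINT x|lebesgue_on S. \<phi> x *\<^sub>R H x)"
      using G(2) H(2) \<phi> unfolding has_weak_grad_def by (metis minus_equation_iff)
    then have "0 = (LINT x|lebesgue_on S. \<phi> x *\<^sub>R G x - \<phi> x *\<^sub>R H x) \<bullet> i"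
      using i by simp
    also have "\<dots> = (LINT x|lebesgue_on S. (\<phi> x *\<^sub>R G x - \<phi> x *\<^sub>R H x) \<bullet> i)"
      using i by (intro integral_inner_left[symmetric]) auto
    also have "\<dots> = (LINT x|lebesgue_on S. \<phi> x * ((G x - H x) \<bullet> i))"
      by (simp add: inner_diff_left algebra_simps)
    finally show "(LINT x|lebesgue_on S. \<phi> x * ((G x - H x) \<bullet> i)) = 0" ..
  qed
  then have "AE x in lebesgue_on S. \<forall>i\<in>Basis. (G x - H x) \<bullet> i = 0"
    by (intro AE_finite_allI) auto
  then show ?thesis
  proof (rule eventually_mono)
    fix x assume "\<forall>i\<in>Basis. (G x - H x) \<bullet> i = 0"
    then have "G x - H x = 0" by (simp only: euclidean_all_zero_iff)
    then show "G x = H x" by simp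
  qed
qed

lemma has_weak_grad_lincomb:
  assumes S: "open S" "bounded S" and u: "u \<in> L2 (lebesgue_on S)" "G \<in> L2 (lebesgue_on S)" "has_weak_grad S u G"
    and v: "v \<in> L2 (lebesgue_on S)" "H \<in> L2 (lebesgue_on S)" "has_weak_grad S v H"
  shows "has_weak_grad S (\<lambda>x. u x + c * v x) (\<lambda>x. G x + c *\<^sub>R H x)"
  unfolding has_weak_grad_def
proof
  fix \<phi> assume \<phi>: "\<phi> \<in> test_functions S"
  then have sm: "smooth \<phi>" by (rule test_functions_smooth)
  note i = L2_scaleR_integrable[OF u(1) L2_grad[OF S sm]] L2_scaleR_integrable[OF v(1) L2_grad[OF S sm]]
    L2_scaleR_integrable[OF L2_smooth[OF S sm] u(2)] L2_scaleR_integrable[OF L2_smooth[OF S sm] v(2)]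
  have "(LINT x|lebesgue_on S. (u x + c * v x) *\<^sub>R grad \<phi> x) =
      (LINT x|lebesgue_on S. u x *\<^sub>R grad \<phi> x + c *\<^sub>R (v x *\<^sub>R grad \<phi> x))"
    by (simp add: scaleR_add_left)
  also have "\<dots> = (LINT x|lebesgue_on S. u x *\<^sub>R grad \<phi> x) + c *\<^sub>R (LINT x|lebesgue_on S. v x *\<^sub>R grad \<phi> x)"
    using i by (simp del: scaleR_scaleR)
  also have "\<dots> = - ((LINT x|lebesgue_on S. \<phi> x *\<^sub>R G x) + c *\<^sub>R (LINT x|lebesgue_on S. \<phi> x *\<^sub>R H x))"
    using u(3) v(3) \<phi> by (simp add: has_weak_grad_def)
  also have "\<dots> = - (LINT x|lebesgue_on S. \<phi> x *\<^sub>R G x + c *\<^sub>R (\<phi> x *\<^sub>R H x))"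
    using i by (simp del: scaleR_scaleR)
  also have "\<dots> = - (LINT x|lebesgue_on S. \<phi> x *\<^sub>R (G x + c *\<^sub>R H x))"
    by (simp add: algebra_simps)
  finally show "(LINT x|lebesgue_on S. (u x + c * v x) *\<^sub>R grad \<phi> x) = \<dots>" .
qed

lemma lebesgue_on_integral_subset:
  fixes g :: "'a::euclidean_space \<Rightarrow> 'b::euclidean_space"
  assumes "S \<in> sets lebesgue" "T \<in> sets lebesgue" "T \<subseteq> S" "\<And>x. x \<notin> T \<Longrightarrow> g x = 0"
  shows "(LINT x|lebesgue_on S. g x) = (LINT x|lebesgue_on T. g x)"
proof -
  have "indicator S x *\<^sub>R g x = indicator T x *\<^sub>R g x" for x
    using assms(3,4) by (cases "x \<in> T") (auto simp: indicator_def)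
  then have eq: "(\<lambda>x. indicator S x *\<^sub>R g x) = (\<lambda>x. indicator T x *\<^sub>R g x)" ..
  have "(LINT x|lebesgue_on S. g x) = (LINT x|lebesgue. indicator S x *\<^sub>R g x)"
    by (rule integral_restrict_space) (use assms(1) in auto)
  also have "\<dots> = (LINT x|lebesgue. indicator T x *\<^sub>R g x)"
    by (simp only: eq)
  also have "\<dots> = (LINT x|lebesgue_on T. g x)"
    by (rule integral_restrict_space[symmetric]) (use assms(2) in auto)
  finally show ?thesis .
qed

text \<open>A test function on the smaller set is also one on the larger set, and the integrals
  agree because it vanishes in between.\<close>

lemma has_weak_grad_subset:
  assumes "open S" "open T" "T \<subseteq> S" "has_weak_grad S u G"
  shows "has_weak_grad T u G"
  unfolding has_weak_grad_def
proof
  fix \<phi> assume \<phi>: "\<phi> \<in> test_functions T"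
  have "(LINT x|lebesgue_on S. u x *\<^sub>R grad \<phi> x) = (LINT x|lebesgue_on T. u x *\<^sub>R grad \<phi> x)"
    using test_function_grad_eq_0[OF \<phi>] assms by (intro lebesgue_on_integral_subset) auto
  moreover have "(LINT x|lebesgue_on S. \<phi> x *\<^sub>R G x) = (LINT x|lebesgue_on T. \<phi> x *\<^sub>R G x)"
    using test_function_eq_0[OF \<phi>] assms by (intro lebesgue_on_integral_subset) auto
  ultimately show "(LINT x|lebesgue_on T. u x *\<^sub>R grad \<phi> x) = - (LINT x|lebesgue_on T. \<phi> x *\<^sub>R G x)"
    using assms(3,4) \<phi> test_functions_mono[OF assms(3)] unfolding has_weak_grad_def by (metis subsetD)
qed

lemma has_weak_grad_cong_AE:
  assumes S: "open S" "bounded S" and u: "u \<in> L2 (lebesgue_on S)" and v: "v \<in> L2 (lebesgue_on S)"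
    and ae: "AE x in lebesgue_on S. u x = v x" and w: "has_weak_grad S u G"
  shows "has_weak_grad S v G"
  unfolding has_weak_grad_def
proof
  fix \<phi> assume \<phi>: "\<phi> \<in> test_functions S"
  have gm: "grad \<phi> \<in> borel_measurable (lebesgue_on S)"
    using L2_grad[OF S test_functions_smooth[OF \<phi>]] by (rule L2_measurable)
  have "(LINT x|lebesgue_on S. v x *\<^sub>R grad \<phi> x) = (LINT x|lebesgue_on S. u x *\<^sub>R grad \<phi> x)"
    by (rule integral_cong_AE[OF borel_measurable_scaleR[OF L2_measurable[OF v] gm]
        borel_measurable_scaleR[OF L2_measurable[OF u] gm]])
      (use ae in \<open>auto elim: eventually_mono\<close>)
  then show "(LINT x|lebesgue_on S. v x *\<^sub>R grad \<phi> x) = - (LINT x|lebesgue_on S. \<phi> x *\<^sub>R G x)"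
    using w \<phi> by (simp add: has_weak_grad_def)
qed

lemma L2_subset:
  fixes g :: "'a::euclidean_space \<Rightarrow> 'b::euclidean_space"
  assumes "S \<in> sets lebesgue" "T \<in> sets lebesgue" "T \<subseteq> S" "g \<in> L2 (lebesgue_on S)"
  shows "g \<in> L2 (lebesgue_on T)"
    and "(LINT x|lebesgue_on T. (norm (g x))\<^sup>2) \<le> (LINT x|lebesgue_on S. (norm (g x))\<^sup>2)"
proof -
  have m: "g \<in> borel_measurable (lebesgue_on T)"
    using L2_measurable[OF assms(4)] assms(1-3) measurable_restrict_mono by blast
  have iS: "integrable lebesgue (\<lambda>x. indicator S x *\<^sub>R (norm (g x))\<^sup>2)"
    using L2_integrable[OF assms(4)] assms(1) by (subst (asm) integrable_restrict_space) auto
  have "integrable lebesgue (\<lambda>x. indicator T x *\<^sub>R (indicator S x *\<^sub>R (norm (g x))\<^sup>2))"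
    using iS assms(2) by (rule integrable_mult_indicator[rotated])
  moreover have "indicator T x *\<^sub>R (indicator S x *\<^sub>R (norm (g x))\<^sup>2) = indicator T x *\<^sub>R (norm (g x))\<^sup>2" for x
    using assms(3) by (auto simp: indicator_def)
  ultimately have iT: "integrable lebesgue (\<lambda>x. indicator T x *\<^sub>R (norm (g x))\<^sup>2)"
    by (simp only:)
  then have "integrable (lebesgue_on T) (\<lambda>x. (norm (g x))\<^sup>2)"
    using assms(2) by (subst integrable_restrict_space) auto
  then show "g \<in> L2 (lebesgue_on T)"
    using m by (simp add: L2_def)
  have "(LINT x|lebesgue. indicator T x *\<^sub>R (norm (g x))\<^sup>2) \<le> (LINT x|lebesgue. indicator S x *\<^sub>R (norm (g x))\<^sup>2)"
    by (rule integral_mono[OF iT iS]) (use assms(3) in \<open>auto simp: indicator_def\<close>)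
  then show "(LINT x|lebesgue_on T. (norm (g x))\<^sup>2) \<le> (LINT x|lebesgue_on S. (norm (g x))\<^sup>2)"
    using assms(1,2) by (simp add: integral_restrict_space)
qed

lemma AE_lebesgue_on_subset:
  assumes "S \<in> sets lebesgue" "T \<in> sets lebesgue" "T \<subseteq> S" "AE x in lebesgue_on S. P x"
  shows "AE x in lebesgue_on T. P x"
proof -
  have "AE x in lebesgue. x \<in> S \<longrightarrow> P x"
    using assms by (subst (asm) AE_restrict_space_iff) auto
  then have "AE x in lebesgue. x \<in> T \<longrightarrow> P x"
    by (rule eventually_mono) (use assms(3) in auto)
  then show ?thesis using assms(2) by (subst AE_restrict_space_iff) auto
qed

subsection \<open>The spaces \<open>H\<^sup>1\<close> and \<open>H\<^sup>1\<^sub>0\<close>\<close>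

lemma H1I: "u \<in> L2 (lebesgue_on S) \<Longrightarrow> G \<in> L2 (lebesgue_on S) \<Longrightarrow> has_weak_grad S u G \<Longrightarrow> u \<in> H1 S"
  by (auto simp: H1_def)

lemma H1_L2: "u \<in> H1 S \<Longrightarrow> u \<in> L2 (lebesgue_on S)"
  by (simp add: H1_def)

lemma wgrad_properties:
  assumes "u \<in> H1 S"
  shows wgrad_L2: "wgrad S u \<in> L2 (lebesgue_on S)" and has_weak_grad_wgrad: "has_weak_grad S u (wgrad S u)"
proof -
  have "\<exists>G. G \<in> L2 (lebesgue_on S) \<and> has_weak_grad S u G"
    using assms by (auto simp: H1_def)
  from someI_ex[OF this] show "wgrad S u \<in> L2 (lebesgue_on S)" "has_weak_grad S u (wgrad S u)"
    by (simp_all add: wgrad_def)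
qed

text \<open>Boundedness makes every globally smooth function and its gradient square integrable on
  \<open>S\<close>. The locale is used for the domain and for each element.\<close>

locale open_bounded =
  fixes S :: "'a::euclidean_space set"
  assumes open_dom: "open S" and bounded_dom: "bounded S"
begin

lemma sets_dom: "S \<in> sets lebesgue"
  using open_dom by auto

text \<open>Since \<open>wgrad\<close> is an arbitrary choice, it is computed by exhibiting one weak
  gradient and comparing.\<close>

lemma wgrad_unique:
  assumes "u \<in> L2 (lebesgue_on S)" "G \<in> L2 (lebesgue_on S)" "has_weak_grad S u G"
  shows "AE x in lebesgue_on S. wgrad S u x = G x"
proof -
  have "u \<in> H1 S" using assms by (rule H1I)
  from wgrad_properties[OF this] show ?thesis
    by (rule has_weak_grad_unique[OF open_dom bounded_dom _ _ assms(2,3)])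
qed

lemma H1_norm_squared:
  assumes "u \<in> L2 (lebesgue_on S)" "G \<in> L2 (lebesgue_on S)" "has_weak_grad S u G"
  shows "(H1_norm S u)\<^sup>2 = (LINT x|lebesgue_on S. (norm (u x))\<^sup>2) + (LINT x|lebesgue_on S. (norm (G x))\<^sup>2)"
proof -
  have "wgrad S u \<in> L2 (lebesgue_on S)"
    using H1I[OF assms] by (rule wgrad_L2)
  then have "(LINT x|lebesgue_on S. (norm (wgrad S u x))\<^sup>2) = (LINT x|lebesgue_on S. (norm (G x))\<^sup>2)"
    using wgrad_unique[OF assms] assms(2)
    by (intro integral_cong_AE) (auto simp: L2_def elim: eventually_mono)
  then show ?thesis
    by (simp add: H1_norm_def L2_norm_squared L2_norm_nonneg)
qed

lemma H1_norm_squared': "u \<in> H1 S \<Longrightarrow>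
    (H1_norm S u)\<^sup>2 = (LINT x|lebesgue_on S. (norm (u x))\<^sup>2) + (LINT x|lebesgue_on S. (norm (wgrad S u x))\<^sup>2)"
  by (intro H1_norm_squared H1_L2 wgrad_properties)

text \<open>The third part has the factor 2 of \<open>norm_add_squared_le\<close>; that is good
  enough for showing that norms tend to 0.\<close>

lemma H1_lincomb:
  assumes u: "u \<in> H1 S" and v: "v \<in> H1 S"
  shows "(\<lambda>x. u x + c * v x) \<in> H1 S" (is ?A)
    and "AE x in lebesgue_on S. wgrad S (\<lambda>x. u x + c * v x) x = wgrad S u x + c *\<^sub>R wgrad S v x" (is ?B)
    and "(H1_norm S (\<lambda>x. u x + c * v x))\<^sup>2 \<le> 2 * (H1_norm S u)\<^sup>2 + 2 * c\<^sup>2 * (H1_norm S v)\<^sup>2" (is ?C)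
proof -
  note L = H1_L2[OF u] H1_L2[OF v] wgrad_L2[OF u] wgrad_L2[OF v]
  have 1: "(\<lambda>x. u x + c * v x) \<in> L2 (lebesgue_on S)"
    by (intro L2_add L2_cmult L)
  have 2: "(\<lambda>x. wgrad S u x + c *\<^sub>R wgrad S v x) \<in> L2 (lebesgue_on S)"
    by (intro L2_add L2_scaleR L)
  have 3: "has_weak_grad S (\<lambda>x. u x + c * v x) (\<lambda>x. wgrad S u x + c *\<^sub>R wgrad S v x)"
    by (intro has_weak_grad_lincomb open_dom bounded_dom L has_weak_grad_wgrad u v)
  from 1 2 3 show ?A by (rule H1I)
  from 1 2 3 show ?B by (rule wgrad_unique)
  show ?C
    using integral_squared_add_le[OF L(1) L2_cmult[OF L(2), of c]]
      integral_squared_add_le[OF L(3) L2_scaleR[OF L(4), of c]]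
    unfolding H1_norm_squared[OF 1 2 3] H1_norm_squared'[OF u] H1_norm_squared'[OF v]
    by (simp add: power_mult_distrib algebra_simps)
qed

lemma H1_smooth:
  assumes "smooth \<phi>"
  shows "\<phi> \<in> H1 S" "AE x in lebesgue_on S. wgrad S \<phi> x = grad \<phi> x"
    "(H1_norm S \<phi>)\<^sup>2 = (LINT x|lebesgue_on S. (norm (\<phi> x))\<^sup>2) + (LINT x|lebesgue_on S. (norm (grad \<phi> x))\<^sup>2)"
proof -
  note * = L2_smooth[OF open_dom bounded_dom assms] L2_grad[OF open_dom bounded_dom assms]
    has_weak_grad_smooth[OF open_dom bounded_dom assms]
  show "\<phi> \<in> H1 S" using * by (rule H1I)
  show "AE x in lebesgue_on S. wgrad S \<phi> x = grad \<phi> x" using * by (rule wgrad_unique)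
  show "(H1_norm S \<phi>)\<^sup>2 = (LINT x|lebesgue_on S. (norm (\<phi> x))\<^sup>2) + (LINT x|lebesgue_on S. (norm (grad \<phi> x))\<^sup>2)"
    using * by (rule H1_norm_squared)
qed

lemma H1_cong_AE:
  assumes u: "u \<in> H1 S" and v: "v \<in> borel_measurable (lebesgue_on S)" and ae: "AE x in lebesgue_on S. u x = v x"
  shows "v \<in> H1 S" "AE x in lebesgue_on S. wgrad S v x = wgrad S u x"
proof -
  have vL: "v \<in> L2 (lebesgue_on S)"
    by (rule L2_dominated[OF v H1_L2[OF u], of 1]) (use ae in \<open>auto elim: eventually_mono\<close>)
  have w: "has_weak_grad S v (wgrad S u)"
    by (rule has_weak_grad_cong_AE[OF open_dom bounded_dom H1_L2[OF u] vL ae has_weak_grad_wgrad[OF u]])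
  show "v \<in> H1 S" by (rule H1I[OF vL wgrad_L2[OF u] w])
  show "AE x in lebesgue_on S. wgrad S v x = wgrad S u x"
    by (rule wgrad_unique[OF vL wgrad_L2[OF u] w])
qed

text \<open>Elements inherit weak gradients and approximation from the domain; broken gradients and
  traces of functions on the whole domain rest on this.\<close>

lemma H1_subset:
  assumes T: "open T" "T \<subseteq> S" and u: "u \<in> H1 S"
  shows "u \<in> H1 T" (is ?A) "AE x in lebesgue_on T. wgrad T u x = wgrad S u x" (is ?B)
    "(H1_norm T u)\<^sup>2 \<le> (H1_norm S u)\<^sup>2" (is ?C)
proof -
  interpret T: open_bounded T
    using T bounded_dom bounded_subset by unfold_locales auto
  note sub = L2_subset[OF sets_dom T.sets_dom T(2)]
  have 1: "u \<in> L2 (lebesgue_on T)" by (rule sub(1)[OF H1_L2[OF u]])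
  have 2: "wgrad S u \<in> L2 (lebesgue_on T)" by (rule sub(1)[OF wgrad_L2[OF u]])
  have 3: "has_weak_grad T u (wgrad S u)"
    by (rule has_weak_grad_subset[OF open_dom T has_weak_grad_wgrad[OF u]])
  from 1 2 3 show ?A by (rule H1I)
  from 1 2 3 show ?B by (rule T.wgrad_unique)
  show ?C
    unfolding H1_norm_squared'[OF u] T.H1_norm_squared[OF 1 2 3]
    by (intro add_mono sub(2) H1_L2 wgrad_L2 u)
qed

end

lemma tendsto_0_squared_iff:
  fixes a :: "nat \<Rightarrow> real"
  shows "a \<longlonglongrightarrow> 0 \<longleftrightarrow> (\<lambda>n. (a n)\<^sup>2) \<longlonglongrightarrow> 0"
proof
  assume "(\<lambda>n. (a n)\<^sup>2) \<longlonglongrightarrow> 0"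
  from tendsto_real_sqrt[OF this] show "a \<longlonglongrightarrow> 0"
    by (simp add: tendsto_rabs_zero_iff)
qed (use tendsto_power[of a 0 sequentially 2] in simp)

text \<open>Norms are compared through their squares, so that bounds of the type
  \<open>2 a^2 + 2 b^2\<close> can be fed in directly.\<close>

lemma tendsto_0_squared_le:
  fixes a b c :: "nat \<Rightarrow> real"
  assumes "b \<longlonglongrightarrow> 0" "c \<longlonglongrightarrow> 0" "\<And>n. (a n)\<^sup>2 \<le> B * (b n)\<^sup>2 + C * (c n)\<^sup>2"
  shows "a \<longlonglongrightarrow> 0"
  unfolding tendsto_0_squared_iff[of a]
proof (rule tendsto_sandwich[OF _ _ tendsto_const])
  show "(\<lambda>n. B * (b n)\<^sup>2 + C * (c n)\<^sup>2) \<longlonglongrightarrow> 0"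
    by (rule tendsto_eq_intros refl assms | simp)+
qed (use assms(3) in auto)

lemma tendsto_0_squared_le1:
  fixes a b :: "nat \<Rightarrow> real"
  assumes "b \<longlonglongrightarrow> 0" "\<And>n. (a n)\<^sup>2 \<le> B * (b n)\<^sup>2"
  shows "a \<longlonglongrightarrow> 0"
  using tendsto_0_squared_le[of b b a B 0] assms by simp

context open_bounded
begin

lemma H10_H1: "u \<in> H10 S \<Longrightarrow> u \<in> H1 S"
  by (simp add: H10_def)

lemma H1_diff: "u \<in> H1 S \<Longrightarrow> v \<in> H1 S \<Longrightarrow> (\<lambda>x. u x - v x) \<in> H1 S"
  using H1_lincomb(1)[of u v "-1"] by simp

lemma H10_lincomb:
  assumes u: "u \<in> H10 S" and v: "v \<in> H10 S"
  shows "(\<lambda>x. u x + c * v x) \<in> H10 S"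
proof -
  obtain \<phi> where \<phi>: "\<And>n::nat. \<phi> n \<in> test_functions S" "(\<lambda>n. H1_norm S (\<lambda>x. \<phi> n x - u x)) \<longlonglongrightarrow> 0"
    using u by (auto simp: H10_def)
  obtain \<psi> where \<psi>: "\<And>n::nat. \<psi> n \<in> test_functions S" "(\<lambda>n. H1_norm S (\<lambda>x. \<psi> n x - v x)) \<longlonglongrightarrow> 0"
    using v by (auto simp: H10_def)
  note H = H10_H1[OF u] H10_H1[OF v]
    H1_smooth(1)[OF test_functions_smooth[OF \<phi>(1)]] H1_smooth(1)[OF test_functions_smooth[OF \<psi>(1)]]
  have "(\<lambda>n. H1_norm S (\<lambda>x. \<phi> n x + c * \<psi> n x - (u x + c * v x))) \<longlonglongrightarrow> 0"
  proof (rule tendsto_0_squared_le[OF \<phi>(2) \<psi>(2)])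
    show "(H1_norm S (\<lambda>x. \<phi> n x + c * \<psi> n x - (u x + c * v x)))\<^sup>2 \<le>
        2 * (H1_norm S (\<lambda>x. \<phi> n x - u x))\<^sup>2 + 2 * c\<^sup>2 * (H1_norm S (\<lambda>x. \<psi> n x - v x))\<^sup>2" for n
      using H1_lincomb(3)[OF H1_diff[OF H(3)[of n] H(1)] H1_diff[OF H(4)[of n] H(2)], of c]
      by (simp add: algebra_simps)
  qed
  then show ?thesis
    unfolding H10_def using H1_lincomb(1)[OF H(1,2)] \<phi>(1) \<psi>(1)
    by (auto intro!: exI[of _ "\<lambda>n x. \<phi> n x + c * \<psi> n x"] test_functions_lincomb)
qed

end

subsection \<open>Completeness of \<open>L\<^sup>2\<close> on finite measure spaces\<close>

text \<open>On a finite measure space an L2 Cauchy sequence is Cauchy in L1 and has a subsequence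
  that converges almost everywhere; Fatou's lemma along it recovers convergence in L2.\<close>

lemma (in finite_measure) L2_complete:
  fixes s :: "nat \<Rightarrow> 'a \<Rightarrow> real"
  assumes s: "\<And>n. s n \<in> L2 M"
    and cauchy: "\<And>e. e > 0 \<Longrightarrow> \<exists>N. \<forall>m\<ge>N. \<forall>n\<ge>N. L2_norm M (\<lambda>x. s m x - s n x) < e"
  obtains g where "g \<in> L2 M" "(\<lambda>n. L2_norm M (\<lambda>x. s n x - g x)) \<longlonglongrightarrow> 0"
proof -
  note [measurable] = s[THEN L2_measurable]
  have one: "(\<lambda>x. 1::real) \<in> L2 M"
    by (rule L2_bounded[where B = 1]) auto
  have int: "integrable M (s n)" for n
    using s by (rule L2_imp_integrable)
  have L1: "(LINT x|M. norm (s m x - s n x)) \<le> L2_norm M (\<lambda>x. 1::real) * L2_norm M (\<lambda>x. s m x - s n x)" for m n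
  proof -
    have d: "(\<lambda>x. \<bar>s m x - s n x\<bar>) \<in> L2 M"
      using L2_diff[OF s s, of m n] by (simp add: L2_def)
    show ?thesis
      using L2_Cauchy_Schwarz[OF one d] by (simp add: L2_norm_def)
  qed
  have "\<exists>N. \<forall>m\<ge>N. \<forall>n\<ge>N. (LINT x|M. norm (s m x - s n x)) < e" if e: "e > 0" for e
  proof -
    \<comment> \<open>The added 1 keeps the divisor positive even for a null measure.\<close>
    let ?c = "L2_norm M (\<lambda>x. 1::real) + 1"
    have c: "?c > 0" using L2_norm_nonneg[of M "\<lambda>x. 1::real"] by linarith
    obtain N where N: "\<And>m n. m \<ge> N \<Longrightarrow> n \<ge> N \<Longrightarrow> L2_norm M (\<lambda>x. s m x - s n x) < e / ?c"
      using cauchy[of "e / ?c"] e c by (metis divide_pos_pos)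
    have "(LINT x|M. norm (s m x - s n x)) < e" if "m \<ge> N" "n \<ge> N" for m n
    proof -
      have "(LINT x|M. norm (s m x - s n x)) \<le> ?c * L2_norm M (\<lambda>x. s m x - s n x)"
        using L1[of m n] L2_norm_nonneg[of M "\<lambda>x. s m x - s n x"] by (simp add: algebra_simps)
      also have "\<dots> < ?c * (e / ?c)"
        using c N[OF that] by (rule mult_strict_left_mono[rotated])
      finally show ?thesis using c by simp
    qed
    then show ?thesis by blast
  qed
  then obtain r where r: "strict_mono r" "AE x in M. Cauchy (\<lambda>i. s (r i) x)"
    using cauchy_L1_AE_cauchy_subseq[of M s] int by blast
  define g where "g x = lim (\<lambda>i. s (r i) x)" for x
  have gm[measurable]: "g \<in> borel_measurable M"
    unfolding g_def by measurable
  have lim: "AE x in M. (\<lambda>i. s (r i) x) \<longlonglongrightarrow> g x"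
    using r(2) by eventually_elim (simp add: g_def Cauchy_convergent convergent_LIMSEQ_iff[symmetric])
  have close: "integrable M (\<lambda>x. (s n x - g x)\<^sup>2) \<and> (LINT x|M. (s n x - g x)\<^sup>2) \<le> e\<^sup>2"
    if e: "e > 0" and N: "\<And>m n. m \<ge> N \<Longrightarrow> n \<ge> N \<Longrightarrow> L2_norm M (\<lambda>x. s m x - s n x) < e" and n: "n \<ge> N" for e N n
  proof -
    have fin: "(\<integral>\<^sup>+x. ennreal ((s n x - s m x)\<^sup>2) \<partial>M) \<le> ennreal (e\<^sup>2)" if "m \<ge> N" for m
    proof -
      have "(\<integral>\<^sup>+x. ennreal ((s n x - s m x)\<^sup>2) \<partial>M) = ennreal (LINT x|M. (s n x - s m x)\<^sup>2)"
        using L2_integrable[OF L2_diff[OF s s, of n m]] by (intro nn_integral_eq_integral) auto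
      also have "\<dots> = ennreal ((L2_norm M (\<lambda>x. s n x - s m x))\<^sup>2)"
        by (simp add: L2_norm_squared)
      also have "\<dots> \<le> ennreal (e\<^sup>2)"
        using N[OF n that] L2_norm_nonneg by (intro ennreal_leI power_mono) auto
      finally show ?thesis .
    qed
    \<comment> \<open>Fatou's lemma: almost everywhere the integrand is the limit along the
      subsequence \<open>r\<close>.\<close>
    have "(\<integral>\<^sup>+x. ennreal ((s n x - g x)\<^sup>2) \<partial>M) = (\<integral>\<^sup>+x. liminf (\<lambda>i. ennreal ((s n x - s (r i) x)\<^sup>2)) \<partial>M)"
    proof (rule nn_integral_cong_AE, use lim in eventually_elim)
      case (elim x)
      then have "(\<lambda>i. ennreal ((s n x - s (r i) x)\<^sup>2)) \<longlonglongrightarrow> ennreal ((s n x - g x)\<^sup>2)"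
        by (intro tendsto_intros)
      then show ?case
        by (intro lim_imp_Liminf[symmetric]) auto
    qed
    also have "\<dots> \<le> liminf (\<lambda>i. \<integral>\<^sup>+x. ennreal ((s n x - s (r i) x)\<^sup>2) \<partial>M)"
      by (rule nn_integral_liminf) measurable
    also have "\<dots> \<le> ennreal (e\<^sup>2)"
    proof (rule Liminf_le)
      have "r i \<ge> N" if "i \<ge> N" for i
        using strict_mono_imp_increasing[OF r(1), of i] that by linarith
      then show "\<forall>\<^sub>F i in sequentially. (\<integral>\<^sup>+x. ennreal ((s n x - s (r i) x)\<^sup>2) \<partial>M) \<le> ennreal (e\<^sup>2)"
        using fin by (auto simp: eventually_sequentially)
    qed auto
    finally have le: "(\<integral>\<^sup>+x. ennreal ((s n x - g x)\<^sup>2) \<partial>M) \<le> ennreal (e\<^sup>2)" .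
    then have i: "integrable M (\<lambda>x. (s n x - g x)\<^sup>2)"
      by (intro integrableI_nonneg) (auto simp: le_less_trans)
    then have "ennreal (LINT x|M. (s n x - g x)\<^sup>2) \<le> ennreal (e\<^sup>2)"
      using le by (subst (asm) nn_integral_eq_integral) auto
    then show ?thesis using i by simp
  qed
  \<comment> \<open>One index suffices to see that \<open>g\<close> differs from an L2 function by
    an L2 function.\<close>
  obtain N where "\<And>m n. m \<ge> N \<Longrightarrow> n \<ge> N \<Longrightarrow> L2_norm M (\<lambda>x. s m x - s n x) < 1"
    using cauchy[of 1] by auto
  then have "integrable M (\<lambda>x. (s N x - g x)\<^sup>2)"
    using close[of 1 N N] by auto
  then have "(\<lambda>x. s N x - g x) \<in> L2 M" by (simp add: L2_def)
  then have gL: "g \<in> L2 M"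
    using L2_diff[OF s[of N], of "\<lambda>x. s N x - g x"] by simp
  have "(\<lambda>n. L2_norm M (\<lambda>x. s n x - g x)) \<longlonglongrightarrow> 0"
  proof (rule LIMSEQ_I)
    fix e :: real assume "e > 0"
    then have e2: "e / 2 > 0" by simp
    obtain N where N: "\<And>m n. m \<ge> N \<Longrightarrow> n \<ge> N \<Longrightarrow> L2_norm M (\<lambda>x. s m x - s n x) < e / 2"
      using cauchy[OF e2] by auto
    have "L2_norm M (\<lambda>x. s n x - g x) < e" if "n \<ge> N" for n
    proof -
      have "L2_norm M (\<lambda>x. s n x - g x) \<le> sqrt ((e / 2)\<^sup>2)"
        unfolding L2_norm_def using close[OF e2 N that] by (intro real_sqrt_le_mono) simp
      then show ?thesis using \<open>e > 0\<close> by simp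
    qed
    then show "\<exists>N. \<forall>n\<ge>N. norm (L2_norm M (\<lambda>x. s n x - g x) - 0) < e"
      by (auto simp: abs_of_nonneg L2_norm_nonneg)
  qed
  with gL show ?thesis by (rule that)
qed

subsection \<open>Arc length\<close>

lemma scale_measure_eq_density: "scale_measure r M = density M (\<lambda>_. r)"
  by (rule measure_eqI) (simp_all add: emeasure_density_const)

text \<open>\<open>arc_length\<close> chooses its own end points, possibly in the other order;
  computations have to use the chosen pair.\<close>

lemma arc_length_open_segment:
  assumes "e = open_segment a b" "a \<noteq> b"
  obtains c d where "e = open_segment c d" "c \<noteq> d"
    "arc_length e = density (distr (restrict_space lborel {0..1::real}) borel (linepath c d)) (\<lambda>_. ennreal (dist c d))"
proof -
  define q where "q = (SOME (c, d). e = open_segment c d)"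
  have "case q of (c, d) \<Rightarrow> e = open_segment c d"
    unfolding q_def by (rule someI[of _ "(a, b)"]) (simp add: assms)
  then have q: "e = open_segment (fst q) (snd q)" by (simp add: case_prod_beta)
  moreover have "e \<noteq> {}" using assms by (simp add: open_segment_eq_empty)
  ultimately have "fst q \<noteq> snd q" by auto
  moreover have "arc_length e = density (distr (restrict_space lborel {0..1::real}) borel (linepath (fst q) (snd q)))
      (\<lambda>_. ennreal (dist (fst q) (snd q)))"
    by (simp add: arc_length_def q_def[symmetric] case_prod_beta scale_measure_eq_density)
  ultimately show ?thesis using q that by blast
qed

locale segment_measure =
  fixes e :: "'a::euclidean_space set" and a b :: 'a
  assumes seg: "e = open_segment a b" and ends: "a \<noteq> b"
    and arc_length_eq: "arc_length e =
      density (distr (restrict_space lborel {0..1::real}) borel (linepath a b)) (\<lambda>_. ennreal (dist a b))"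
begin

lemma sets_arc_length [simp, measurable_cong]: "sets (arc_length e) = sets borel"
  by (simp add: arc_length_eq)

lemma space_arc_length [simp]: "space (arc_length e) = UNIV"
  by (simp add: arc_length_eq)

lemma linepath_measurable [measurable]: "linepath a b \<in> restrict_space lborel {0..1::real} \<rightarrow>\<^sub>M borel"
proof -
  have "linepath a b \<in> borel_measurable borel"
    by (rule borel_measurable_continuous_onI) (rule continuous_on_linepath)
  then show ?thesis by (intro measurable_restrict_space1) simp
qed

lemma integrable_arc_length_iff:
  fixes g :: "'a \<Rightarrow> real"
  assumes [measurable]: "g \<in> borel_measurable borel"
  shows "integrable (arc_length e) g \<longleftrightarrow> set_integrable lborel {0..1} (\<lambda>t. dist a b * g (linepath a b t))"
proof -
  have "integrable (arc_length e) g \<longleftrightarrow> integrable (distr (restrict_space lborel {0..1::real}) borel (linepath a b)) (\<lambda>x. dist a b * g x)"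
    unfolding arc_length_eq by (subst integrable_density) auto
  also have "\<dots> \<longleftrightarrow> integrable (restrict_space lborel {0..1::real}) (\<lambda>t. dist a b * g (linepath a b t))"
    by (rule integrable_distr_eq) measurable
  also have "\<dots> \<longleftrightarrow> set_integrable lborel {0..1} (\<lambda>t. dist a b * g (linepath a b t))"
    unfolding set_integrable_def by (rule integrable_restrict_space) simp
  finally show ?thesis .
qed

lemma integral_arc_length:
  fixes g :: "'a \<Rightarrow> real"
  assumes [measurable]: "g \<in> borel_measurable borel"
  shows "(LINT x|arc_length e. g x) = dist a b * (LINT t:{0..1}|lborel. g (linepath a b t))"
proof -
  have "(LINT x|arc_length e. g x) = (LINT x|distr (restrict_space lborel {0..1::real}) borel (linepath a b). dist a b * g x)"
    unfolding arc_length_eq by (subst integral_density) auto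
  also have "\<dots> = (LINT t|restrict_space lborel {0..1::real}. dist a b * g (linepath a b t))"
    by (rule integral_distr) measurable
  also have "\<dots> = (LINT t|lborel. indicator {0..1} t *\<^sub>R (dist a b * g (linepath a b t)))"
    by (rule integral_restrict_space) simp
  also have "\<dots> = dist a b * (LINT t:{0..1}|lborel. g (linepath a b t))"
    by (simp add: set_lebesgue_integral_def mult.left_commute)
  finally show ?thesis .
qed

lemma finite_measure_arc_length: "finite_measure (arc_length e)"
proof
  have "emeasure (arc_length e) (space (arc_length e)) = ennreal (dist a b) * emeasure (restrict_space lborel {0..1::real}) {0..1}"
    unfolding arc_length_eq
    by (simp add: emeasure_density_const emeasure_distr space_restrict_space)
  also have "\<dots> = ennreal (dist a b)"
    by (simp add: emeasure_restrict_space)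
  finally show "emeasure (arc_length e) (space (arc_length e)) \<noteq> \<infinity>" by simp
qed

text \<open>Only the parameters 0 and 1 leave the open segment.\<close>

lemma AE_arc_length: "AE x in arc_length e. x \<in> e"
proof -
  have "AE t in lborel. t \<noteq> (0::real) \<and> t \<noteq> 1"
    using AE_lborel_singleton[of 0] AE_lborel_singleton[of 1] by eventually_elim auto
  then have "AE t in lborel. t \<in> {0..1} \<longrightarrow> linepath a b t \<in> e"
    by (rule eventually_mono) (auto simp: seg in_segment linepath_def ends less_le)
  then have "AE t in restrict_space lborel {0..1::real}. linepath a b t \<in> e"
    by (subst AE_restrict_space_iff) auto
  moreover have "{x \<in> space borel. x \<in> e} \<in> sets borel"
    by (simp add: seg open_segment_def borel_closed sets.Diff)
  ultimately have "AE x in distr (restrict_space lborel {0..1::real}) borel (linepath a b). x \<in> e"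
    by (subst AE_distr_iff) auto
  then show ?thesis
    unfolding arc_length_eq by (subst AE_density) (auto elim: eventually_mono)
qed

lemma L2_arc_length_continuous:
  fixes g :: "'a \<Rightarrow> real"
  assumes "continuous_on UNIV g"
  shows "g \<in> L2 (arc_length e)"
    "(LINT x|arc_length e. (norm (g x))\<^sup>2) = dist a b * integral {0..1} (\<lambda>t. (g (linepath a b t))\<^sup>2)"
proof -
  have [measurable]: "g \<in> borel_measurable borel"
    using assms by (rule borel_measurable_continuous_onI)
  have c: "continuous_on {0..1} (\<lambda>t. (g (linepath a b t))\<^sup>2)"
    by (intro continuous_intros continuous_on_compose2[OF assms]) auto
  have i: "set_integrable lborel {0..1} (\<lambda>t. (g (linepath a b t))\<^sup>2)"
    using borel_integrable_compact[OF _ c] by (simp add: set_integrable_def indicator_def if_distrib cong: if_cong)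
  have "integrable (arc_length e) (\<lambda>x. (norm (g x))\<^sup>2)"
    using i by (subst integrable_arc_length_iff) auto
  then show "g \<in> L2 (arc_length e)"
    by (simp add: L2_def arc_length_eq)
  show "(LINT x|arc_length e. (norm (g x))\<^sup>2) = dist a b * integral {0..1} (\<lambda>t. (g (linepath a b t))\<^sup>2)"
    using i by (subst integral_arc_length) (auto simp: set_borel_integral_eq_integral)
qed

end

subsection \<open>The trace inequality on an edge of a convex element\<close>

text \<open>Identifies Lebesgue measure on vectors with that on pairs, where iterated integration is
  available.\<close>

lemma lborel_real2: "lborel = distr (lborel :: (real \<times> real) measure) borel (\<lambda>p. vector [fst p, snd p] :: real^2)"
proof (rule lborel_eqI)
  fix l u :: "real^2"
  assume le: "\<And>b. b \<in> Basis \<Longrightarrow> l \<bullet> b \<le> u \<bullet> b"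
  have le': "l $ 1 \<le> u $ 1" "l $ 2 \<le> u $ 2"
    using le[of "axis 1 1"] le[of "axis 2 1"] by (auto simp: inner_axis)
  let ?P = "\<lambda>p. vector [fst p, snd p] :: real^2"
  have m: "?P \<in> (lborel :: (real \<times> real) measure) \<rightarrow>\<^sub>M borel"
  proof -
    have "?P = (\<lambda>p. \<chi> i. if i = 1 then fst p else snd p)"
      by (auto simp: vec_eq_iff forall_2)
    moreover have "continuous_on UNIV (\<lambda>p::real\<times>real. (\<chi> i. if i = 1 then fst p else snd p) :: real^2)"
    proof (intro continuous_on_vec_lambda)
      show "continuous_on UNIV (\<lambda>p::real\<times>real. if i = 1 then fst p else snd p)" for i :: 2
        by (cases "i = 1") (auto intro!: continuous_intros)
    qed
    ultimately show ?thesis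
      using borel_measurable_continuous_onI by auto
  qed
  have "?P -` box l u = {l $ 1<..<u $ 1} \<times> {l $ 2<..<u $ 2}"
    by (auto simp: mem_box_cart forall_2)
  then have "emeasure (distr lborel borel ?P) (box l u) = emeasure (lborel \<Otimes>\<^sub>M lborel) ({l $ 1<..<u $ 1} \<times> {l $ 2<..<u $ 2})"
    using m by (subst emeasure_distr) (auto simp: lborel_prod)
  also have "\<dots> = ennreal (u $ 1 - l $ 1) * ennreal (u $ 2 - l $ 2)"
    using le' by (subst lborel.emeasure_pair_measure_Times) auto
  also have "\<dots> = (\<Prod>b\<in>Basis. (u - l) \<bullet> b)"
    using le' by (simp add: Basis_vec_def axis_eq_axis prod.UNION_disjoint prod.reindex inner_axis UNIV_2
        flip: ennreal_mult)
  finally show "emeasure (distr lborel borel ?P) (box l u) = (\<Prod>b\<in>Basis. (u - l) \<bullet> b)" .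
qed simp

lemma continuous_on_vector2 [continuous_intros]:
  assumes "continuous_on A f" "continuous_on A g"
  shows "continuous_on A (\<lambda>x. vector [f x, g x] :: real^2)"
proof -
  have "(\<lambda>x. vector [f x, g x] :: real^2) = (\<lambda>x. \<chi> i. if i = 1 then f x else g x)"
    by (auto simp: vec_eq_iff forall_2)
  moreover have "continuous_on A (\<lambda>x. (\<chi> i. if i = 1 then f x else g x) :: real^2)"
  proof (intro continuous_on_vec_lambda)
    show "continuous_on A (\<lambda>x. if i = 1 then f x else g x)" for i :: 2
      using assms by (cases "i = 1") auto
  qed
  ultimately show ?thesis by (simp only:)
qed

lemma integral_real2_iterated:
  fixes h :: "real^2 \<Rightarrow> real"
  assumes h: "continuous_on UNIV h"
  shows "integral (cbox (vector [a, c]) (vector [b, d])) h =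
    integral {a..b} (\<lambda>s. integral {c..d} (\<lambda>t. h (vector [s, t])))"
proof -
  let ?P = "\<lambda>p. vector [fst p, snd p] :: real^2"
  let ?B = "cbox (vector [a, c]) (vector [b, d]) :: (real^2) set"
  have P: "continuous_on UNIV ?P"
    by (intro continuous_intros)
  then have [measurable]: "?P \<in> borel_measurable borel"
    by (rule borel_measurable_continuous_onI)
  have [measurable]: "h \<in> borel_measurable borel"
    using h by (rule borel_measurable_continuous_onI)
  have hP: "continuous_on UNIV (\<lambda>p. h (?P p))"
    by (intro continuous_on_compose2[OF h] P) auto
  have i1: "set_integrable lborel ?B h"
    unfolding set_integrable_def
    by (intro borel_integrable_compact continuous_on_subset[OF h]) auto
  have i2: "set_integrable lborel (cbox (a, c) (b, d)) (\<lambda>p. h (?P p))"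
    unfolding set_integrable_def
    by (intro borel_integrable_compact continuous_on_subset[OF hP]) auto
  have "integral ?B h = (LINT x|lborel. indicator ?B x *\<^sub>R h x)"
    using set_borel_integral_eq_integral(2)[OF i1] by (simp add: set_lebesgue_integral_def)
  also have "\<dots> = (LINT x|distr lborel borel ?P. indicator ?B x *\<^sub>R h x)"
    using lborel_real2 by simp
  also have "\<dots> = (LINT p|lborel. indicator ?B (?P p) *\<^sub>R h (?P p))"
    by (rule integral_distr) measurable
  also have "(\<lambda>p. indicator ?B (?P p) *\<^sub>R h (?P p)) = (\<lambda>p. indicator (cbox (a, c) (b, d)) p *\<^sub>R h (?P p))"
    by (auto simp: indicator_def mem_box_cart forall_2 fun_eq_iff)
  also have "(LINT p|lborel. indicator (cbox (a, c) (b, d)) p *\<^sub>R h (?P p)) = integral (cbox (a, c) (b, d)) (\<lambda>p. h (?P p))"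
    using set_borel_integral_eq_integral(2)[OF i2] by (simp add: set_lebesgue_integral_def)
  also have "\<dots> = integral {a..b} (\<lambda>s. integral {c..d} (\<lambda>t. h (vector [s, t])))"
    using integral_prod_continuous[OF continuous_on_subset[OF hP], of a c b d] by simp
  finally show ?thesis .
qed

text \<open>Affine change of variables onto the parallelogram at \<open>a\<close> spanned by
  \<open>v / 2\<close> and \<open>w / 2\<close>. The constant is the reciprocal of the absolute
  determinant, hence the same for all integrands.\<close>

lemma integral_parallelogram_le:
  fixes a v w :: "real^2"
  assumes indep: "\<And>s t. s *\<^sub>R v + t *\<^sub>R w = 0 \<Longrightarrow> s = 0 \<and> t = 0"
    and K: "open K" "bounded K"
    and sub: "\<And>s t. s \<in> {0<..<1/2} \<Longrightarrow> t \<in> {0<..<1/2} \<Longrightarrow> a + s *\<^sub>R v + t *\<^sub>R w \<in> K"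
  obtains D where "D \<ge> 0" "\<And>\<psi> :: real^2 \<Rightarrow> real. continuous_on UNIV \<psi> \<Longrightarrow> (\<And>x. 0 \<le> \<psi> x) \<Longrightarrow>
    integral {0..1/2} (\<lambda>s. integral {0..1/2} (\<lambda>t. \<psi> (a + s *\<^sub>R v + t *\<^sub>R w))) \<le> D * (LINT x|lebesgue_on K. \<psi> x)"
proof -
  define G where "G x = x $ 1 *\<^sub>R v + x $ 2 *\<^sub>R w" for x :: "real^2"
  let ?F = "\<lambda>x. a + G x"
  have lin: "linear G"
    by (rule linearI) (auto simp: G_def algebra_simps)
  have der: "(?F has_derivative G) (at x within X)" for x X
    using linear_imp_has_derivative[OF lin] by (auto intro!: derivative_eq_intros)
  have inj: "inj G"
    unfolding linear_injective_0[OF lin]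
  proof (intro allI impI)
    fix x assume "G x = 0"
    from indep[OF this[unfolded G_def]] show "x = 0"
      by (simp add: vec_eq_iff forall_2)
  qed
  have injF: "inj_on ?F X" for X
    using inj by (auto simp: inj_on_def)
  define d where "d = \<bar>det (matrix G)\<bar>"
  have d: "d > 0"
    using inj det_nz_iff_inj[OF lin] by (simp add: d_def)
  let ?B = "box (vector [0, 0]) (vector [1/2, 1/2]) :: (real^2) set"
  let ?C = "cbox (vector [0, 0]) (vector [1/2, 1/2]) :: (real^2) set"
  have FB: "?F ` ?B \<subseteq> K"
    using sub by (auto simp: G_def mem_box_cart forall_2 add.assoc[symmetric])
  show ?thesis
  proof (rule that[of "1 / d"])
    fix \<psi> :: "real^2 \<Rightarrow> real" assume c: "continuous_on UNIV \<psi>" and nn: "\<And>x. 0 \<le> \<psi> x"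
    have cF: "continuous_on UNIV ?F"
      unfolding G_def by (intro continuous_intros)
    have cc: "continuous_on UNIV (\<lambda>x. \<psi> (?F x))"
      by (intro continuous_on_compose2[OF c] cF) auto
    have "integral {0..1/2} (\<lambda>s. integral {0..1/2} (\<lambda>t. \<psi> (a + s *\<^sub>R v + t *\<^sub>R w))) = integral ?C (\<lambda>x. \<psi> (?F x))"
      unfolding integral_real2_iterated[OF cc] by (simp add: G_def add.assoc)
    also have "\<dots> = integral ?B (\<lambda>x. \<psi> (?F x))"
      by (simp add: integral_open_interval)
    finally have 1: "integral {0..1/2} (\<lambda>s. integral {0..1/2} (\<lambda>t. \<psi> (a + s *\<^sub>R v + t *\<^sub>R w))) = integral ?B (\<lambda>x. \<psi> (?F x))" .
    have abs_K: "\<psi> absolutely_integrable_on K"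
    proof -
      have "integrable (lebesgue_on K) \<psi>"
        by (rule finite_measure.L2_imp_integrable[OF finite_measure_open_bounded[OF K] L2_continuous[OF K c]])
      then show ?thesis
        unfolding set_integrable_def using K by (subst (asm) integrable_restrict_space) auto
    qed
    \<comment> \<open>The change of variables theorem speaks of vector-valued integrands, so the
      scalar is wrapped as a vector with one entry.\<close>
    let ?f = "\<lambda>x. vec (\<psi> x) :: real^1"
    have abs_FB: "\<psi> absolutely_integrable_on ?F ` ?B"
    proof -
      have "?F ` ?B \<in> sets lebesgue"
      proof -
        have "open (G ` ?B)"
          by (intro open_surjective_linear_image lin linear_injective_imp_surjective inj) auto
        then have "open ((+) a ` G ` ?B)"
          by (rule open_translation)
        then show ?thesis by (intro sets_lebesgue_open) (simp add: image_image)
      qed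
      then show ?thesis by (rule set_integrable_subset[OF abs_K _ FB])
    qed
    then have "?f absolutely_integrable_on ?F ` ?B"
      by (simp add: absolutely_integrable_on_1_iff)
    then have "integral ?B (\<lambda>x. d *\<^sub>R ?f (?F x)) = integral (?F ` ?B) ?f"
      using has_absolute_integral_change_of_variables[of ?B ?F "\<lambda>x. G" ?f "integral (?F ` ?B) ?f", OF _ der injF]
      by (simp add: d_def)
    then have "d * integral ?B (\<lambda>x. \<psi> (?F x)) = integral (?F ` ?B) \<psi>"
      by (simp add: integral_on_1_eq vec_eq_iff)
    also have "\<dots> \<le> integral K \<psi>"
    proof (rule integral_subset_le[OF FB])
      show "\<psi> integrable_on K" by (rule set_lebesgue_integral_eq_integral(1)[OF abs_K])
      show "\<psi> integrable_on ?F ` ?B"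
        by (rule set_lebesgue_integral_eq_integral(1)[OF abs_FB])
    qed (use nn in auto)
    also have "integral K \<psi> = (LINT x|lebesgue_on K. \<psi> x)"
      using abs_K K by (intro lebesgue_integral_eq_integral[symmetric]) (auto simp: integrable_restrict_space set_integrable_def)
    finally show "integral {0..1/2} (\<lambda>s. integral {0..1/2} (\<lambda>t. \<psi> (a + s *\<^sub>R v + t *\<^sub>R w))) \<le> 1 / d * (LINT x|lebesgue_on K. \<psi> x)"
      unfolding 1 using d by (simp add: field_simps)
  qed (use d in simp)
qed

text \<open>Integrate the derivative of \<open>(1/2 - t) h(t)\<^sup>2\<close>.\<close>

lemma boundary_value_le_integral:
  fixes h h' :: "real \<Rightarrow> real"
  assumes der: "\<And>t. (h has_real_derivative h' t) (at t)" and cont: "continuous_on UNIV h'"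
  shows "(h 0)\<^sup>2 \<le> integral {0..1/2} (\<lambda>t. 4 * (h t)\<^sup>2 + 2 * (h' t)\<^sup>2)"
proof -
  have ch: "continuous_on A h" for A
    using der DERIV_isCont continuous_at_imp_continuous_on by blast
  have ch': "continuous_on A h'" for A
    using cont continuous_on_subset by blast
  let ?k = "\<lambda>t. (1/2 - t) * (h t)\<^sup>2"
  let ?k' = "\<lambda>t. (1/2 - t) * (2 * h t * h' t) - (h t)\<^sup>2"
  have "(?k has_real_derivative ?k' t) (at t)" for t
    by (auto intro!: derivative_eq_intros der simp: algebra_simps)
  then have "(?k' has_integral (?k (1/2) - ?k 0)) {0..1/2}"
    by (intro fundamental_theorem_of_calculus)
      (auto simp flip: has_real_derivative_iff_has_vector_derivative intro: has_field_derivative_at_within)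
  \<comment> \<open>The weight \<open>1/2 - t\<close> vanishes at the far end, so the only boundary
    term is half the square of \<open>h 0\<close>; the factor \<open>- 2\<close> normalises it, sign
    included.\<close>
  then have "((\<lambda>t. - 2 * ?k' t) has_integral (- 2 * (?k (1/2) - ?k 0))) {0..1/2}"
    by (rule has_integral_mult_right)
  then have 1: "((\<lambda>t. - 2 * ?k' t) has_integral (h 0)\<^sup>2) {0..1/2}"
    by simp
  have "(\<lambda>t. 4 * (h t)\<^sup>2 + 2 * (h' t)\<^sup>2) integrable_on {0..1/2}"
    by (intro integrable_continuous_interval continuous_intros ch ch')
  then have 2: "((\<lambda>t. 4 * (h t)\<^sup>2 + 2 * (h' t)\<^sup>2) has_integral integral {0..1/2} (\<lambda>t. 4 * (h t)\<^sup>2 + 2 * (h' t)\<^sup>2)) {0..1/2}"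
    by (rule integrable_integral)
  show ?thesis
  proof (rule has_integral_le[OF 1 2])
    fix t :: real assume t: "t \<in> {0..1/2}"
    have "- (1 - 2 * t) * (2 * h t * h' t) \<le> \<bar>1 - 2 * t\<bar> * \<bar>2 * h t * h' t\<bar>"
      by (metis abs_ge_self abs_mult abs_minus_cancel minus_mult_left)
    also have "\<dots> \<le> 1 * \<bar>2 * h t * h' t\<bar>"
      using t by (intro mult_right_mono) auto
    also have "\<dots> \<le> (h t)\<^sup>2 + (h' t)\<^sup>2"
      using sum_squares_bound[of "\<bar>h t\<bar>" "\<bar>h' t\<bar>"] by (simp add: abs_mult)
    also have "\<dots> \<le> 2 * (h t)\<^sup>2 + 2 * (h' t)\<^sup>2" by simp
    finally show "- 2 * ?k' t \<le> 4 * (h t)\<^sup>2 + 2 * (h' t)\<^sup>2"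
      by (simp add: algebra_simps)
  qed
qed

lemma L2_norm_add_squared_le:
  "g \<in> L2 M \<Longrightarrow> h \<in> L2 M \<Longrightarrow> (L2_norm M (\<lambda>x. g x + h x))\<^sup>2 \<le> 2 * (L2_norm M g)\<^sup>2 + 2 * (L2_norm M h)\<^sup>2"
  unfolding L2_norm_squared by (rule integral_squared_add_le)

lemma L2_norm_minus_commute: "L2_norm M (\<lambda>x. g x - h x) = L2_norm M (\<lambda>x. h x - g x)"
  by (simp add: L2_norm_def norm_minus_commute)

lemma L2_norm_cmult_squared:
  fixes g :: "'a \<Rightarrow> real"
  shows "(L2_norm M (\<lambda>x. c * g x))\<^sup>2 = c\<^sup>2 * (L2_norm M g)\<^sup>2"
  by (simp add: L2_norm_squared power_mult_distrib)

lemma (in open_bounded) H1_norm_diff_squared_le: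
  assumes "u \<in> H1 S" "v \<in> H1 S"
  shows "(H1_norm S (\<lambda>x. u x - v x))\<^sup>2 \<le> 2 * (H1_norm S u)\<^sup>2 + 2 * (H1_norm S v)\<^sup>2"
  using H1_lincomb(3)[OF assms, of "-1"] by simp

lemma smooth_diff: "smooth \<phi> \<Longrightarrow> smooth \<psi> \<Longrightarrow> smooth (\<lambda>x. \<phi> x - \<psi> x)"
  using smooth_lincomb[of \<phi> \<psi> "-1"] by simp

locale convex_edge = open_bounded K + segment_measure e a b for K e :: "(real^2) set" and a b +
  assumes convex_dom: "convex K" and edge_frontier: "e \<subseteq> frontier K"
begin

lemma shrink_mem:
  assumes "y \<in> closure K" "z \<in> K" "0 < t" "t \<le> 1"
  shows "y + t *\<^sub>R (z - y) \<in> K"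
proof -
  have "y - t *\<^sub>R (y - z) \<in> interior K"
    using assms convex_dom open_dom by (intro mem_interior_closure_convex_shrink) (auto simp: interior_open)
  then show ?thesis
    using open_dom by (simp add: interior_open algebra_simps)
qed

lemma edge_closure: "x \<in> e \<Longrightarrow> x \<in> closure K"
  using edge_frontier by (auto simp: frontier_def)

lemma edge_disjoint: "x \<in> e \<Longrightarrow> x \<notin> K"
  using edge_frontier open_dom by (auto simp: frontier_def interior_open)

lemma dom_nonempty: "K \<noteq> {}"
proof
  assume "K = {}"
  then have "e = {}" using edge_frontier by simp
  then show False using seg ends by (simp add: open_segment_eq_empty)
qed

text \<open>For \<open>z\<close> in \<open>K\<close> the triangle over the edge with apex
  \<open>z\<close> is, up to its boundary, inside \<open>K\<close>, and the parameters
  \<open>s, t < 1/2\<close> stay within that triangle. Integrating the one-dimensional bound along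
  \<open>z - c\<close> therefore controls the half of the edge next to \<open>c\<close>; the other
  half has to be reached from \<open>d\<close>.\<close>

lemma half_edge_trace:
  assumes cd: "e = open_segment c d" "c \<noteq> d"
  obtains C where "C \<ge> 0" "\<And>\<phi>. smooth \<phi> \<Longrightarrow>
    integral {0..1/2} (\<lambda>s. (\<phi> (c + s *\<^sub>R (d - c)))\<^sup>2) \<le> C * (H1_norm K \<phi>)\<^sup>2"
proof -
  obtain z where z: "z \<in> K" using dom_nonempty by blast
  let ?v = "d - c" and ?w = "z - c"
  have mem: "c + s *\<^sub>R ?v \<in> e" if "0 < s" "s < 1" for s
    unfolding cd in_segment using that cd(2) by (auto intro!: exI[of _ s] simp: algebra_simps)
  \<comment> \<open>If \<open>z\<close> were on the line of the edge, moving a suitable edge point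
    towards \<open>z\<close> would reach another edge point, and that point would lie in
    \<open>K\<close>.\<close>
  have "z \<noteq> c + r *\<^sub>R ?v" for r
  proof
    assume zr: "z = c + r *\<^sub>R ?v"
    have bad: False if "0 < s" "s < 1" "0 < q" "q < 1" "0 < t" "t \<le> 1" "q = s + t * (r - s)" for s q t
    proof -
      have "(c + s *\<^sub>R ?v) + t *\<^sub>R (z - (c + s *\<^sub>R ?v)) \<in> K"
        using that by (intro shrink_mem edge_closure mem z)
      also have "(c + s *\<^sub>R ?v) + t *\<^sub>R (z - (c + s *\<^sub>R ?v)) = c + q *\<^sub>R ?v"
        unfolding that(7) zr by (simp add: algebra_simps)
      finally show False using edge_disjoint mem that by blast
    qed
    show False
    proof (cases "r \<ge> 1/2")
      case True
      \<comment> \<open>From parameter 1/8 a move by 1/8 towards \<open>r\<close> ends at 1/4; the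
        fraction of the way is at most 1 because \<open>r\<close> is at least 1/2. The other case
        mirrors this.\<close>
      then show ?thesis
        by (intro bad[of "1/8" "1/4" "(1/8) / (r - 1/8)"]) (auto simp: field_simps)
    next
      case False
      then show ?thesis
        by (intro bad[of "7/8" "3/4" "(1/8) / (7/8 - r)"]) (auto simp: field_simps)
    qed
  qed
  then have indep: "s = 0 \<and> t = 0" if "s *\<^sub>R ?v + t *\<^sub>R ?w = 0" for s t
  proof (cases "t = 0")
    case True
    then show ?thesis using that cd(2) by simp
  next
    case False
    have "t *\<^sub>R ?w = - s *\<^sub>R ?v" using that by (simp add: eq_neg_iff_add_eq_0 add.commute)
    then have "(1 / t) *\<^sub>R (t *\<^sub>R ?w) = (1 / t) *\<^sub>R (- s *\<^sub>R ?v)" by simp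
    then have "z = c + (- s / t) *\<^sub>R ?v" using False by (simp add: algebra_simps)
    then show ?thesis using \<open>\<And>r. z \<noteq> c + r *\<^sub>R ?v\<close> by blast
  qed
  have sub: "c + s *\<^sub>R ?v + t *\<^sub>R ?w \<in> K" if "s \<in> {0<..<1/2}" "t \<in> {0<..<1/2}" for s t
  proof -
    \<comment> \<open>The point lies at fraction \<open>t\<close> on the segment from the edge point
      with parameter \<open>s / (1 - t)\<close> to \<open>z\<close>; that parameter is below 1
      because \<open>s + t < 1\<close>.\<close>
    have "s / (1 - t) < 1" "0 < s / (1 - t)" using that by (auto simp: field_simps)
    then have "(c + (s / (1 - t)) *\<^sub>R ?v) + t *\<^sub>R (z - (c + (s / (1 - t)) *\<^sub>R ?v)) \<in> K"
      using that by (intro shrink_mem edge_closure mem z) auto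
    also have "(c + (s / (1 - t)) *\<^sub>R ?v) + t *\<^sub>R (z - (c + (s / (1 - t)) *\<^sub>R ?v)) =
        c + ((1 - t) * (s / (1 - t))) *\<^sub>R ?v + t *\<^sub>R ?w"
      by (simp add: algebra_simps del: times_divide_eq_right times_divide_eq_left)
    also have "(1 - t) * (s / (1 - t)) = s" using that by simp
    finally show ?thesis .
  qed
  obtain D where D: "D \<ge> 0" "\<And>\<psi> :: real^2 \<Rightarrow> real. continuous_on UNIV \<psi> \<Longrightarrow> (\<And>x. 0 \<le> \<psi> x) \<Longrightarrow>
    integral {0..1/2} (\<lambda>s. integral {0..1/2} (\<lambda>t. \<psi> (c + s *\<^sub>R ?v + t *\<^sub>R ?w))) \<le> D * (LINT x|lebesgue_on K. \<psi> x)"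
    using integral_parallelogram_le[OF indep open_dom bounded_dom sub] by metis
  \<comment> \<open>The numbers come from \<open>boundary_value_le_integral\<close>; the norm of
    \<open>?w\<close> replaces the derivative along \<open>?w\<close> by the full gradient.\<close>
  let ?m = "4 + 2 * (norm ?w)\<^sup>2"
  show ?thesis
  proof (rule that[of "D * ?m"])
    fix \<phi> :: "real^2 \<Rightarrow> real" assume sm: "smooth \<phi>"
    let ?\<psi> = "\<lambda>x. 4 * (\<phi> x)\<^sup>2 + 2 * (grad \<phi> x \<bullet> ?w)\<^sup>2"
    have c\<psi>: "continuous_on X ?\<psi>" for X
      by (intro continuous_intros smooth_imp_continuous_on smooth_grad_component sm)
    have pt: "(\<phi> (c + s *\<^sub>R ?v))\<^sup>2 \<le> integral {0..1/2} (\<lambda>t. ?\<psi> (c + s *\<^sub>R ?v + t *\<^sub>R ?w))" for s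
    proof -
      have "continuous_on UNIV (\<lambda>t. grad \<phi> (c + s *\<^sub>R ?v + t *\<^sub>R ?w) \<bullet> ?w)"
        by (intro continuous_on_compose2[OF smooth_imp_continuous_on[OF smooth_grad_component[OF sm], of UNIV]])
          (auto intro!: continuous_intros)
      from boundary_value_le_integral[OF smooth_has_real_derivative_line[OF sm] this]
      show ?thesis by simp
    qed
    have i1: "(\<lambda>s. (\<phi> (c + s *\<^sub>R ?v))\<^sup>2) integrable_on {0..1/2}"
      by (intro integrable_continuous_interval continuous_intros
          continuous_on_compose2[OF smooth_imp_continuous_on[OF sm, of UNIV]]) auto
    have cc: "continuous_on (cbox (0, 0) (1/2, 1/2)) (\<lambda>(s, t). ?\<psi> (c + s *\<^sub>R ?v + t *\<^sub>R ?w))"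
      unfolding case_prod_beta
      by (rule continuous_on_compose2[OF c\<psi>[of UNIV]]) (auto intro!: continuous_intros)
    have i2: "(\<lambda>s. integral {0..1/2} (\<lambda>t. ?\<psi> (c + s *\<^sub>R ?v + t *\<^sub>R ?w))) integrable_on {0..1/2}"
      using integral_integrable_2dim[OF cc] by simp
    have "integral {0..1/2} (\<lambda>s. (\<phi> (c + s *\<^sub>R ?v))\<^sup>2) \<le>
        integral {0..1/2} (\<lambda>s. integral {0..1/2} (\<lambda>t. ?\<psi> (c + s *\<^sub>R ?v + t *\<^sub>R ?w)))"
      by (rule integral_le[OF i1 i2 pt])
    also have "\<dots> \<le> D * (LINT x|lebesgue_on K. ?\<psi> x)"
      by (rule D(2)[OF c\<psi>]) simp
    also have "\<dots> \<le> D * (?m * (H1_norm K \<phi>)\<^sup>2)"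
    proof (rule mult_left_mono[OF _ D(1)])
      note L = L2_smooth[OF open_dom bounded_dom sm] L2_grad[OF open_dom bounded_dom sm]
      note I = L2_integrable[OF L(1)] L2_integrable[OF L(2)]
      have "(LINT x|lebesgue_on K. ?\<psi> x) \<le> (LINT x|lebesgue_on K. ?m * ((norm (\<phi> x))\<^sup>2 + (norm (grad \<phi> x))\<^sup>2))"
      proof (rule integral_mono)
        show "integrable (lebesgue_on K) ?\<psi>"
          using I(1) L2_integrable[OF L2_inner_const[OF L(2)]] by simp
        fix x
        have "\<bar>grad \<phi> x \<bullet> ?w\<bar>\<^sup>2 \<le> (norm (grad \<phi> x) * norm ?w)\<^sup>2"
          by (intro power_mono Cauchy_Schwarz_ineq2) auto
        then have "2 * (grad \<phi> x \<bullet> ?w)\<^sup>2 \<le> 2 * (norm ?w)\<^sup>2 * (norm (grad \<phi> x))\<^sup>2"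
          by (simp add: power_mult_distrib mult.commute)
        then show "?\<psi> x \<le> ?m * ((norm (\<phi> x))\<^sup>2 + (norm (grad \<phi> x))\<^sup>2)"
          by (simp add: algebra_simps add_increasing)
      qed (use I in simp)
      also have "\<dots> = ?m * (H1_norm K \<phi>)\<^sup>2"
        using I by (simp add: H1_smooth(3)[OF sm])
      finally show "(LINT x|lebesgue_on K. ?\<psi> x) \<le> ?m * (H1_norm K \<phi>)\<^sup>2" .
    qed
    finally show "integral {0..1/2} (\<lambda>s. (\<phi> (c + s *\<^sub>R ?v))\<^sup>2) \<le> D * ?m * (H1_norm K \<phi>)\<^sup>2"
      by (simp add: mult.assoc)
  qed (use D(1) in simp)
qed

text \<open>Each half of the edge is treated from its own end point; the reflection of the parameter
  at 1/2 matches the second half with the estimate starting at \<open>b\<close>.\<close>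

lemma trace_inequality:
  obtains C where "C \<ge> 0" "\<And>\<phi>. smooth \<phi> \<Longrightarrow> (L2_norm (arc_length e) \<phi>)\<^sup>2 \<le> C * (H1_norm K \<phi>)\<^sup>2"
proof -
  obtain C where C: "C \<ge> 0" "\<And>\<phi>. smooth \<phi> \<Longrightarrow>
    integral {0..1/2} (\<lambda>s. (\<phi> (a + s *\<^sub>R (b - a)))\<^sup>2) \<le> C * (H1_norm K \<phi>)\<^sup>2"
    using half_edge_trace[OF seg ends] by metis
  obtain D where D: "D \<ge> 0" "\<And>\<phi>. smooth \<phi> \<Longrightarrow>
    integral {0..1/2} (\<lambda>s. (\<phi> (b + s *\<^sub>R (a - b)))\<^sup>2) \<le> D * (H1_norm K \<phi>)\<^sup>2"
    using half_edge_trace[of b a] seg ends by (metis open_segment_commute)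
  show ?thesis
  proof (rule that[of "dist a b * (C + D)"])
    fix \<phi> :: "real^2 \<Rightarrow> real" assume sm: "smooth \<phi>"
    let ?k = "\<lambda>t. (\<phi> (linepath a b t))\<^sup>2" and ?l = "\<lambda>s. (\<phi> (b + s *\<^sub>R (a - b)))\<^sup>2"
    have i: "?k integrable_on {x..y}" "?l integrable_on {x..y}" for x y
      by (intro integrable_continuous_interval continuous_intros
          continuous_on_compose2[OF smooth_imp_continuous_on[OF sm, of UNIV]]; auto)+
    have "((\<lambda>x. ?l (- 1 *\<^sub>R x + 1)) has_integral (1 / \<bar>- 1\<bar> ^ DIM(real)) *\<^sub>R integral {0..1/2} ?l)
        ((\<lambda>x. (1 / - 1) *\<^sub>R x + - ((1 / - 1) *\<^sub>R 1)) ` cbox 0 (1/2))"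
      by (rule has_integral_affinity) (use integrable_integral[OF i(2)] in auto)
    moreover have "?l (- 1 *\<^sub>R x + 1) = ?k x" for x
      by (simp add: linepath_def algebra_simps)
    moreover have "(\<lambda>x. (1 / - 1) *\<^sub>R x + - ((1 / - 1) *\<^sub>R 1)) ` cbox 0 (1/2) = {1/2..1::real}"
    proof -
      have "(\<lambda>x. 1 - x) ` {0..1/2} = {1/2..1::real}"
        by (simp add: image_diff_atLeastAtMost)
      moreover have "(\<lambda>x. (1 / - 1) *\<^sub>R x + - ((1 / - 1) *\<^sub>R 1)) = (\<lambda>x::real. 1 - x)"
        by auto
      ultimately show ?thesis by simp
    qed
    ultimately have "integral {1/2..1} ?k = integral {0..1/2} ?l"
      by (simp only: integral_unique) (simp add: integral_unique)
    moreover have "integral {0..1/2} ?k = integral {0..1/2} (\<lambda>s. (\<phi> (a + s *\<^sub>R (b - a)))\<^sup>2)"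
      by (simp add: linepath_def algebra_simps)
    moreover have "integral {0..1} ?k = integral {0..1/2} ?k + integral {1/2..1} ?k"
      by (rule Henstock_Kurzweil_Integration.integral_combine[symmetric]) (use i in auto)
    ultimately have "integral {0..1} ?k \<le> (C + D) * (H1_norm K \<phi>)\<^sup>2"
      using C(2)[OF sm] D(2)[OF sm] by (simp add: algebra_simps)
    then have "dist a b * integral {0..1} ?k \<le> dist a b * ((C + D) * (H1_norm K \<phi>)\<^sup>2)"
      by (intro mult_left_mono) auto
    then show "(L2_norm (arc_length e) \<phi>)\<^sup>2 \<le> dist a b * (C + D) * (H1_norm K \<phi>)\<^sup>2"
      unfolding L2_norm_squared L2_arc_length_continuous(2)[OF smooth_imp_continuous_on[OF sm]]
      by (simp add: mult.assoc)
  qed (use C(1) D(1) in simp)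
qed

lemma L2_arc_smooth: "smooth \<phi> \<Longrightarrow> \<phi> \<in> L2 (arc_length e)"
  by (intro L2_arc_length_continuous(1) smooth_imp_continuous_on)

subsection \<open>Traces\<close>

text \<open>The difference of two approximating sequences is smooth and tends to 0 in H^1, so by the
  trace inequality its restriction to the edge tends to 0 as well.\<close>

lemma is_trace_unique:
  assumes v: "v \<in> H1 K" and g: "is_trace K e v g" and h: "is_trace K e v h"
  shows "AE x in arc_length e. g x = h x"
proof -
  obtain \<phi> where \<phi>: "\<And>n::nat. smooth (\<phi> n)" "(\<lambda>n. H1_norm K (\<lambda>x. \<phi> n x - v x)) \<longlonglongrightarrow> 0"
    "(\<lambda>n. L2_norm (arc_length e) (\<lambda>x. \<phi> n x - g x)) \<longlonglongrightarrow> 0"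
    using g by (auto simp: is_trace_def)
  obtain \<psi> where \<psi>: "\<And>n::nat. smooth (\<psi> n)" "(\<lambda>n. H1_norm K (\<lambda>x. \<psi> n x - v x)) \<longlonglongrightarrow> 0"
    "(\<lambda>n. L2_norm (arc_length e) (\<lambda>x. \<psi> n x - h x)) \<longlonglongrightarrow> 0"
    using h by (auto simp: is_trace_def)
  have gL: "g \<in> L2 (arc_length e)" and hL: "h \<in> L2 (arc_length e)"
    using g h by (auto simp: is_trace_def)
  obtain C where C: "C \<ge> 0" "\<And>\<phi>. smooth \<phi> \<Longrightarrow> (L2_norm (arc_length e) \<phi>)\<^sup>2 \<le> C * (H1_norm K \<phi>)\<^sup>2"
    using trace_inequality by metis
  let ?N = "L2_norm (arc_length e)"
  have 1: "(\<lambda>n. H1_norm K (\<lambda>x. \<phi> n x - \<psi> n x)) \<longlonglongrightarrow> 0"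
  proof (rule tendsto_0_squared_le[OF \<phi>(2) \<psi>(2)])
    show "(H1_norm K (\<lambda>x. \<phi> n x - \<psi> n x))\<^sup>2 \<le> 2 * (H1_norm K (\<lambda>x. \<phi> n x - v x))\<^sup>2 + 2 * (H1_norm K (\<lambda>x. \<psi> n x - v x))\<^sup>2" for n
      using H1_norm_diff_squared_le[OF H1_diff[OF H1_smooth(1)[OF \<phi>(1)[of n]] v] H1_diff[OF H1_smooth(1)[OF \<psi>(1)[of n]] v]]
      by simp
  qed
  have 2: "(\<lambda>n. ?N (\<lambda>x. \<phi> n x - \<psi> n x)) \<longlonglongrightarrow> 0"
    by (rule tendsto_0_squared_le1[OF 1]) (use C(2)[OF smooth_diff[OF \<phi>(1) \<psi>(1)]] in auto)
  have 3: "(\<lambda>n. ?N (\<lambda>x. \<phi> n x - h x)) \<longlonglongrightarrow> 0"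
  proof (rule tendsto_0_squared_le[OF 2 \<psi>(3)])
    show "(?N (\<lambda>x. \<phi> n x - h x))\<^sup>2 \<le> 2 * (?N (\<lambda>x. \<phi> n x - \<psi> n x))\<^sup>2 + 2 * (?N (\<lambda>x. \<psi> n x - h x))\<^sup>2" for n
      using L2_norm_add_squared_le[OF L2_diff[OF L2_arc_smooth[OF \<phi>(1)[of n]] L2_arc_smooth[OF \<psi>(1)[of n]]]
          L2_diff[OF L2_arc_smooth[OF \<psi>(1)[of n]] hL]] by simp
  qed
  have "(\<lambda>n::nat. ?N (\<lambda>x. g x - h x)) \<longlonglongrightarrow> 0"
  proof (rule tendsto_0_squared_le[OF \<phi>(3) 3])
    show "(?N (\<lambda>x. g x - h x))\<^sup>2 \<le> 2 * (?N (\<lambda>x. \<phi> n x - g x))\<^sup>2 + 2 * (?N (\<lambda>x. \<phi> n x - h x))\<^sup>2" for n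
      using L2_norm_add_squared_le[OF L2_diff[OF gL L2_arc_smooth[OF \<phi>(1)[of n]]]
          L2_diff[OF L2_arc_smooth[OF \<phi>(1)[of n]] hL]]
      by (simp add: L2_norm_minus_commute[of _ g])
  qed
  then have "?N (\<lambda>x. g x - h x) = 0"
    by (simp add: LIMSEQ_const_iff)
  then have "(LINT x|arc_length e. (norm (g x - h x))\<^sup>2) = 0"
    using L2_norm_squared[of "arc_length e" "\<lambda>x. g x - h x"] by simp
  then show ?thesis
    using integral_squared_eq_0_iff[OF L2_diff[OF gL hL]] by simp
qed

lemma is_trace_lincomb:
  assumes u: "u \<in> H1 K" and v: "v \<in> H1 K" and g: "is_trace K e u g" and h: "is_trace K e v h"
  shows "is_trace K e (\<lambda>x. u x + c * v x) (\<lambda>x. g x + c * h x)"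
proof -
  obtain \<phi> where \<phi>: "\<And>n::nat. smooth (\<phi> n)" "(\<lambda>n. H1_norm K (\<lambda>x. \<phi> n x - u x)) \<longlonglongrightarrow> 0"
    "(\<lambda>n. L2_norm (arc_length e) (\<lambda>x. \<phi> n x - g x)) \<longlonglongrightarrow> 0"
    using g by (auto simp: is_trace_def)
  obtain \<psi> where \<psi>: "\<And>n::nat. smooth (\<psi> n)" "(\<lambda>n. H1_norm K (\<lambda>x. \<psi> n x - v x)) \<longlonglongrightarrow> 0"
    "(\<lambda>n. L2_norm (arc_length e) (\<lambda>x. \<psi> n x - h x)) \<longlonglongrightarrow> 0"
    using h by (auto simp: is_trace_def)
  have gL: "g \<in> L2 (arc_length e)" and hL: "h \<in> L2 (arc_length e)"
    using g h by (auto simp: is_trace_def)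
  let ?N = "L2_norm (arc_length e)"
  have "(\<lambda>n. H1_norm K (\<lambda>x. (\<phi> n x + c * \<psi> n x) - (u x + c * v x))) \<longlonglongrightarrow> 0"
  proof (rule tendsto_0_squared_le[OF \<phi>(2) \<psi>(2)])
    show "(H1_norm K (\<lambda>x. (\<phi> n x + c * \<psi> n x) - (u x + c * v x)))\<^sup>2 \<le>
        2 * (H1_norm K (\<lambda>x. \<phi> n x - u x))\<^sup>2 + 2 * c\<^sup>2 * (H1_norm K (\<lambda>x. \<psi> n x - v x))\<^sup>2" for n
      using H1_lincomb(3)[OF H1_diff[OF H1_smooth(1)[OF \<phi>(1)[of n]] u] H1_diff[OF H1_smooth(1)[OF \<psi>(1)[of n]] v], of c]
      by (simp add: algebra_simps)
  qed
  moreover have "(\<lambda>n. ?N (\<lambda>x. (\<phi> n x + c * \<psi> n x) - (g x + c * h x))) \<longlonglongrightarrow> 0"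
  proof (rule tendsto_0_squared_le[OF \<phi>(3) \<psi>(3)])
    show "(?N (\<lambda>x. (\<phi> n x + c * \<psi> n x) - (g x + c * h x)))\<^sup>2 \<le>
        2 * (?N (\<lambda>x. \<phi> n x - g x))\<^sup>2 + 2 * c\<^sup>2 * (?N (\<lambda>x. \<psi> n x - h x))\<^sup>2" for n
      using L2_norm_add_squared_le[OF L2_diff[OF L2_arc_smooth[OF \<phi>(1)[of n]] gL]
          L2_cmult[OF L2_diff[OF L2_arc_smooth[OF \<psi>(1)[of n]] hL], of c]]
      unfolding L2_norm_cmult_squared by (simp add: algebra_simps)
  qed
  ultimately show ?thesis
    unfolding is_trace_def
    by (auto intro!: L2_add L2_cmult gL hL exI[of _ "\<lambda>n x. \<phi> n x + c * \<psi> n x"] smooth_lincomb \<phi>(1) \<psi>(1))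
qed

text \<open>The constant sequence approximates, because the H^1 norm does not see changes on null
  sets.\<close>

lemma is_trace_smooth:
  assumes v: "v \<in> H1 K" and sm: "smooth \<psi>" and ae: "AE x in lebesgue_on K. v x = \<psi> x"
  shows "is_trace K e v \<psi>"
proof -
  have z: "(\<lambda>x. 0) \<in> H1 K" by (rule H1_smooth(1)[OF smooth_const])
  have "(\<lambda>x. \<psi> x - v x) \<in> L2 (lebesgue_on K)"
    by (intro L2_diff H1_L2 v H1_smooth(1) sm)
  then have m: "(\<lambda>x. \<psi> x - v x) \<in> borel_measurable (lebesgue_on K)"
    by (rule L2_measurable)
  have ae0: "AE x in lebesgue_on K. (\<lambda>x. 0) x = \<psi> x - v x"
    using ae by eventually_elim simp
  have "has_weak_grad K (\<lambda>x. 0) (\<lambda>x. 0)"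
    by (simp add: has_weak_grad_def)
  then have "has_weak_grad K (\<lambda>x. \<psi> x - v x) (\<lambda>x. 0)"
    by (rule has_weak_grad_cong_AE[OF open_dom bounded_dom L2_zero \<open>(\<lambda>x. \<psi> x - v x) \<in> L2 (lebesgue_on K)\<close> ae0])
  from H1_norm_squared[OF \<open>(\<lambda>x. \<psi> x - v x) \<in> L2 (lebesgue_on K)\<close> L2_zero this]
  have "(H1_norm K (\<lambda>x. \<psi> x - v x))\<^sup>2 = (LINT x|lebesgue_on K. (norm (\<psi> x - v x))\<^sup>2)"
    by simp
  also have "\<dots> = 0"
    unfolding integral_squared_eq_0_iff[OF \<open>(\<lambda>x. \<psi> x - v x) \<in> L2 (lebesgue_on K)\<close>]
    using ae0 by eventually_elim simp
  finally have "H1_norm K (\<lambda>x. \<psi> x - v x) = 0" by simp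
  then show ?thesis
    unfolding is_trace_def using L2_arc_smooth[OF sm] sm
    by (auto intro!: exI[of _ "\<lambda>n. \<psi>"] simp: L2_norm_def)
qed

text \<open>Approximation on a larger set restricts to the element, which lets one sequence serve
  all elements at an edge.\<close>

lemma is_trace_approx:
  assumes S: "open S" "bounded S" "K \<subseteq> S" and u: "u \<in> H1 S"
    and \<phi>: "\<And>n::nat. smooth (\<phi> n)" "(\<lambda>n. H1_norm S (\<lambda>x. \<phi> n x - u x)) \<longlonglongrightarrow> 0"
    and g: "g \<in> L2 (arc_length e)" "(\<lambda>n. L2_norm (arc_length e) (\<lambda>x. \<phi> n x - g x)) \<longlonglongrightarrow> 0"
  shows "is_trace K e u g"
proof -
  interpret S: open_bounded S using S by unfold_locales
  have "(\<lambda>n. H1_norm K (\<lambda>x. \<phi> n x - u x)) \<longlonglongrightarrow> 0"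
    by (rule tendsto_0_squared_le1[OF \<phi>(2), of _ 1])
      (use S.H1_subset(3)[OF open_dom S(3) S.H1_diff[OF S.H1_smooth(1)[OF \<phi>(1)] u]] in simp)
  then show ?thesis
    unfolding is_trace_def using \<phi> g by blast
qed

text \<open>The trace inequality makes the restrictions to the edge a Cauchy sequence in a complete
  space. The limit is determined by the sequence and the edge, whichever element supplied the
  inequality.\<close>

lemma trace_limit_exists:
  assumes S: "open S" "bounded S" "K \<subseteq> S" and u: "u \<in> H1 S"
    and \<phi>: "\<And>n::nat. smooth (\<phi> n)" "(\<lambda>n. H1_norm S (\<lambda>x. \<phi> n x - u x)) \<longlonglongrightarrow> 0"
  obtains g where "g \<in> L2 (arc_length e)" "(\<lambda>n. L2_norm (arc_length e) (\<lambda>x. \<phi> n x - g x)) \<longlonglongrightarrow> 0"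
proof -
  interpret S: open_bounded S using S by unfold_locales
  interpret finite_measure "arc_length e" by (rule finite_measure_arc_length)
  obtain C where C: "C \<ge> 0" "\<And>\<phi>. smooth \<phi> \<Longrightarrow> (L2_norm (arc_length e) \<phi>)\<^sup>2 \<le> C * (H1_norm K \<phi>)\<^sup>2"
    using trace_inequality by metis
  let ?h = "\<lambda>n. H1_norm S (\<lambda>x. \<phi> n x - u x)"
  have le: "(L2_norm (arc_length e) (\<lambda>x. \<phi> m x - \<phi> n x))\<^sup>2 \<le> 2 * C * ((?h m)\<^sup>2 + (?h n)\<^sup>2)" for m n
  proof -
    have sm: "smooth (\<lambda>x. \<phi> m x - \<phi> n x)" by (intro smooth_diff \<phi>(1))
    have "(L2_norm (arc_length e) (\<lambda>x. \<phi> m x - \<phi> n x))\<^sup>2 \<le> C * (H1_norm K (\<lambda>x. \<phi> m x - \<phi> n x))\<^sup>2"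
      by (rule C(2)[OF sm])
    also have "\<dots> \<le> C * (H1_norm S (\<lambda>x. \<phi> m x - \<phi> n x))\<^sup>2"
      by (intro mult_left_mono C(1) S.H1_subset(3) open_dom S(3) S.H1_smooth(1) sm)
    also have "\<dots> \<le> C * (2 * (?h m)\<^sup>2 + 2 * (?h n)\<^sup>2)"
      using S.H1_norm_diff_squared_le[OF S.H1_diff[OF S.H1_smooth(1)[OF \<phi>(1)[of m]] u] S.H1_diff[OF S.H1_smooth(1)[OF \<phi>(1)[of n]] u]]
      by (intro mult_left_mono C(1)) simp
    finally show ?thesis by (simp add: algebra_simps)
  qed
  have "\<exists>N. \<forall>m\<ge>N. \<forall>n\<ge>N. L2_norm (arc_length e) (\<lambda>x. \<phi> m x - \<phi> n x) < \<epsilon>" if \<epsilon>: "\<epsilon> > 0" for \<epsilon>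
  proof -
    have "(\<lambda>n. 4 * C * (?h n)\<^sup>2) \<longlonglongrightarrow> 0"
      by (rule tendsto_eq_intros refl \<phi>(2) | simp)+
    then have "\<forall>\<^sub>F n in sequentially. 4 * C * (?h n)\<^sup>2 < \<epsilon>\<^sup>2"
      using \<epsilon> by (intro order_tendstoD(2)) auto
    then obtain N where N: "\<And>n. n \<ge> N \<Longrightarrow> 4 * C * (?h n)\<^sup>2 < \<epsilon>\<^sup>2"
      by (auto simp: eventually_sequentially)
    have "L2_norm (arc_length e) (\<lambda>x. \<phi> m x - \<phi> n x) < \<epsilon>" if "m \<ge> N" "n \<ge> N" for m n
    proof (rule power_less_imp_less_base[where n = 2])
      show "(L2_norm (arc_length e) (\<lambda>x. \<phi> m x - \<phi> n x))\<^sup>2 < \<epsilon>\<^sup>2"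
        using le[of m n] N[OF that(1)] N[OF that(2)] by (simp add: algebra_simps)
    qed (use \<epsilon> in simp)
    then show ?thesis by blast
  qed
  from L2_complete[OF L2_arc_smooth[OF \<phi>(1)] this that] show ?thesis .
qed

text \<open>Any trace exhibited by hand computes the one chosen by \<open>SOME\<close>.\<close>

lemma edge_traceI:
  assumes "v \<in> H1 K" "is_trace K e v g"
  shows "is_trace K e v (edge_trace K e v)" "AE x in arc_length e. edge_trace K e v x = g x"
proof -
  show "is_trace K e v (edge_trace K e v)"
    unfolding edge_trace_def using someI[of "is_trace K e v", OF assms(2)] .
  then show "AE x in arc_length e. edge_trace K e v x = g x"
    using assms by (intro is_trace_unique)
qed

end

subsection \<open>Outward normals\<close>

text \<open>The two orthogonality relations force the determinant of \<open>v\<close> and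
  \<open>w\<close> to vanish; dividing by a nonzero component of \<open>v\<close> gives the
  factor.\<close>

lemma real2_parallel:
  fixes n v w :: "real^2"
  assumes "n \<noteq> 0" "v \<noteq> 0" "n \<bullet> v = 0" "n \<bullet> w = 0"
  obtains c where "w = c *\<^sub>R v"
proof -
  have 1: "n $ 1 * v $ 1 + n $ 2 * v $ 2 = 0" "n $ 1 * w $ 1 + n $ 2 * w $ 2 = 0"
    using assms(3,4) by (simp_all add: inner_vec_def sum_2)
  have "n $ 1 * (v $ 1 * w $ 2 - v $ 2 * w $ 1) = 0" "n $ 2 * (v $ 1 * w $ 2 - v $ 2 * w $ 1) = 0"
    using 1 by algebra+
  moreover have "n $ 1 \<noteq> 0 \<or> n $ 2 \<noteq> 0"
    using assms(1) by (auto simp: vec_eq_iff forall_2)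
  ultimately have d: "v $ 1 * w $ 2 = v $ 2 * w $ 1" by auto
  show ?thesis
  proof (cases "v $ 1 = 0")
    case True
    then have "v $ 2 \<noteq> 0" using assms(2) by (auto simp: vec_eq_iff forall_2)
    then have "w = (w $ 2 / v $ 2) *\<^sub>R v"
      using True d by (auto simp: vec_eq_iff forall_2)
    then show ?thesis by (rule that)
  next
    case False
    then have "w = (w $ 1 / v $ 1) *\<^sub>R v"
      using d by (auto simp: vec_eq_iff forall_2 field_simps)
    then show ?thesis by (rule that)
  qed
qed

lemma real2_unit_normals:
  fixes m n v :: "real^2"
  assumes "v \<noteq> 0" "norm m = 1" "norm n = 1" "m \<bullet> v = 0" "n \<bullet> v = 0"
  shows "m = n \<or> m = - n"
proof -
  have "v \<bullet> m = 0" "v \<bullet> n = 0" using assms by (simp_all add: inner_commute)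
  moreover have "m \<noteq> 0" using assms by auto
  ultimately obtain c where c: "n = c *\<^sub>R m"
    using real2_parallel[OF assms(1)] by metis
  then have "\<bar>c\<bar> = 1" using assms by simp
  then have "c = 1 \<or> c = - 1" by linarith
  then show ?thesis using c by auto
qed

context convex_edge
begin

abbreviation mid :: "real^2" where "mid \<equiv> a + (1/2) *\<^sub>R (b - a)"

lemma edge_mem: "0 < s \<Longrightarrow> s < 1 \<Longrightarrow> a + s *\<^sub>R (b - a) \<in> e"
  unfolding seg in_segment using ends by (auto intro!: exI[of _ s] simp: algebra_simps)

text \<open>A supporting hyperplane at the midpoint provides existence. Every candidate is
  orthogonal to the edge, which leaves two opposite vectors, and the strict inequality at a point of
  \<open>K\<close> rules one of them out.\<close>

lemma normal_properties:
  defines "n \<equiv> outward_normal K e"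
  shows "norm n = 1" "n \<bullet> (b - a) = 0" "\<And>y. y \<in> K \<Longrightarrow> n \<bullet> (y - mid) < 0"
proof -
  let ?P = "\<lambda>n. norm n = 1 \<and> (\<forall>x\<in>e. \<forall>y\<in>K. n \<bullet> (y - x) \<le> 0)"
  have mid: "mid \<in> e" by (rule edge_mem) auto
  have perp: "n \<bullet> (b - a) = 0" if P: "?P n" for n
  proof -
    have closed: "n \<bullet> y \<le> n \<bullet> mid" if "y \<in> closure K" for y
    proof -
      have "closed {y. n \<bullet> y \<le> n \<bullet> mid}" by (rule closed_halfspace_le)
      moreover have "K \<subseteq> {y. n \<bullet> y \<le> n \<bullet> mid}"
      proof (intro subsetI CollectI)
        fix y assume "y \<in> K"
        then have "n \<bullet> (y - mid) \<le> 0" using P mid by blast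
        then show "n \<bullet> y \<le> n \<bullet> mid" by (simp only: inner_diff_right)
      qed
      ultimately have "closure K \<subseteq> {y. n \<bullet> y \<le> n \<bullet> mid}" by (rule closure_minimal[rotated])
      then show ?thesis using that by (rule subsetD[THEN CollectD])
    qed
    \<comment> \<open>Edge points on either side of the midpoint: a linear function with its maximum
      in between is constant along the edge.\<close>
    have "n \<bullet> (a + (3/4) *\<^sub>R (b - a)) \<le> n \<bullet> mid" "n \<bullet> (a + (1/4) *\<^sub>R (b - a)) \<le> n \<bullet> mid"
      by (intro closed edge_closure edge_mem; simp)+
    then have "n \<bullet> a + 3/4 * (n \<bullet> (b - a)) \<le> n \<bullet> a + 1/2 * (n \<bullet> (b - a))"
      "n \<bullet> a + 1/4 * (n \<bullet> (b - a)) \<le> n \<bullet> a + 1/2 * (n \<bullet> (b - a))"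
      by (simp_all only: inner_add_right inner_scaleR_right)
    then show ?thesis by linarith
  qed
  \<comment> \<open>Openness makes the inequality strict: with equality, moving \<open>y\<close> a
    little along \<open>n\<close> would stay in \<open>K\<close> but leave the half-plane.\<close>
  have strict: "n \<bullet> (y - mid) < 0" if P: "?P n" and y: "y \<in> K" for n y
  proof -
    obtain r where r: "r > 0" "ball y r \<subseteq> K"
      by (rule openE[OF open_dom y])
    have "y + (r / 2) *\<^sub>R n \<in> ball y r" using P r by (simp add: dist_norm)
    then have "n \<bullet> (y + (r / 2) *\<^sub>R n - mid) \<le> 0" using P mid subsetD[OF r(2)] by blast
    moreover have "n \<bullet> n = 1" using P by (simp add: norm_eq_1)
    moreover have "y + (r / 2) *\<^sub>R n - mid = (y - mid) + (r / 2) *\<^sub>R n" by simp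
    ultimately have "n \<bullet> (y - mid) + r / 2 \<le> 0" by (simp add: inner_add_right[of n "y - mid"])
    then show ?thesis using r by linarith
  qed
  have ex: "\<exists>n. ?P n"
  proof -
    have "rel_interior (closure K) = K"
      using convex_rel_interior_closure[OF convex_dom] rel_interior_open[OF open_dom] by simp
    then have "mid \<notin> rel_interior (closure K)" using edge_disjoint[OF mid] by simp
    with supporting_hyperplane_rel_boundary[OF convex_closure[OF convex_dom] edge_closure[OF mid]]
    obtain q where q: "q \<noteq> 0" "\<And>y. y \<in> closure K \<Longrightarrow> q \<bullet> mid \<le> q \<bullet> y" by metis
    have "q \<bullet> mid \<le> q \<bullet> (a + (3/4) *\<^sub>R (b - a))" "q \<bullet> mid \<le> q \<bullet> (a + (1/4) *\<^sub>R (b - a))"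
      by (intro q(2) edge_closure edge_mem; simp)+
    then have "q \<bullet> a + 1/2 * (q \<bullet> (b - a)) \<le> q \<bullet> a + 3/4 * (q \<bullet> (b - a))"
      "q \<bullet> a + 1/2 * (q \<bullet> (b - a)) \<le> q \<bullet> a + 1/4 * (q \<bullet> (b - a))"
      by (simp_all only: inner_add_right inner_scaleR_right)
    then have perp: "q \<bullet> (b - a) = 0" by linarith
    have "q \<bullet> x = q \<bullet> mid" if "x \<in> e" for x
    proof -
      obtain s where "x = (1 - s) *\<^sub>R a + s *\<^sub>R b" using \<open>x \<in> e\<close> unfolding seg in_segment by blast
      then have "x = a + s *\<^sub>R (b - a)" by (simp add: algebra_simps)
      then show ?thesis using perp by (simp only: inner_add_right inner_scaleR_right)
    qed
    moreover have "q \<bullet> mid \<le> q \<bullet> y" if "y \<in> K" for y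
      using q(2) closure_subset that by blast
    ultimately have "0 \<le> q \<bullet> (y - x)" if "x \<in> e" "y \<in> K" for x y
      using that by (simp add: inner_diff_right)
    \<comment> \<open>The hyperplane vector \<open>q\<close> points into the element, hence the
      sign.\<close>
    then have "?P ((- 1 / norm q) *\<^sub>R q)"
      using q(1) by auto
    then show ?thesis by blast
  qed
  have uniq: "m = n" if "?P m" "?P n" for m n
  proof -
    have "m = n \<or> m = - n"
      using that perp ends by (intro real2_unit_normals[of "b - a"]) auto
    moreover obtain y where "y \<in> K" using dom_nonempty by blast
    ultimately show ?thesis
      using strict[OF that(1) \<open>y \<in> K\<close>] strict[OF that(2) \<open>y \<in> K\<close>] by auto
  qed
  have "\<exists>!n. ?P n" by (rule ex_ex1I[OF ex uniq])
  then have P: "?P n"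
    unfolding n_def outward_normal_def by (rule theI')
  then show "norm n = 1" ..
  show "n \<bullet> (b - a) = 0" by (rule perp[OF P])
  show "\<And>y. y \<in> K \<Longrightarrow> n \<bullet> (y - mid) < 0" by (rule strict[OF P])
qed

end

text \<open>Both sets lie on the same side of the edge. The points \<open>z\<close> and
  \<open>z'\<close> are pulled towards the edge to a common small depth \<open>\<tau>\<close>; what
  then separates them is parallel to the edge and is cancelled by shifting the base point of one
  segment along the edge.\<close>

lemma same_normal_imp_overlap:
  assumes "convex_edge K e a b" "convex_edge K' e a b" "outward_normal K e = outward_normal K' e"
  shows "K \<inter> K' \<noteq> {}"
proof -
  interpret K: convex_edge K e a b by fact
  interpret K': convex_edge K' e a b by fact
  define n where "n = outward_normal K e"
  note N = K.normal_properties[folded n_def] K'.normal_properties[folded assms(3), folded n_def]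
  let ?m = K.mid
  obtain z z' where z: "z \<in> K" "z' \<in> K'"
    using K.dom_nonempty K'.dom_nonempty by blast
  \<comment> \<open>The distances of \<open>z\<close> and \<open>z'\<close> from the line of the
    edge; dividing by them gives displacements of equal depth, whose difference is
    tangential.\<close>
  define \<alpha> where "\<alpha> = - (n \<bullet> (z - ?m))"
  define \<beta> where "\<beta> = - (n \<bullet> (z' - ?m))"
  have pos: "\<alpha> > 0" "\<beta> > 0" using N(3)[OF z(1)] N(6)[OF z(2)] by (auto simp: \<alpha>_def \<beta>_def)
  have "n \<bullet> ((1 / \<beta>) *\<^sub>R (z' - ?m) - (1 / \<alpha>) *\<^sub>R (z - ?m)) = 1 / \<beta> * (n \<bullet> (z' - ?m)) - 1 / \<alpha> * (n \<bullet> (z - ?m))"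
    by (simp only: inner_diff_right[of n "(1 / \<beta>) *\<^sub>R _"] inner_scaleR_right)
  also have "\<dots> = 1 / \<beta> * - \<beta> - 1 / \<alpha> * - \<alpha>"
    by (simp only: \<alpha>_def \<beta>_def minus_minus)
  also have "\<dots> = 0" using pos by simp
  finally have "n \<bullet> ((1 / \<beta>) *\<^sub>R (z' - ?m) - (1 / \<alpha>) *\<^sub>R (z - ?m)) = 0" .
  moreover have "n \<noteq> 0" using N(1) by auto
  ultimately obtain c where c: "(1 / \<beta>) *\<^sub>R (z' - ?m) - (1 / \<alpha>) *\<^sub>R (z - ?m) = c *\<^sub>R (b - a)"
    using real2_parallel[of n "b - a"] N(2) K.ends by (metis right_minus_eq)
  \<comment> \<open>The three bounds keep \<open>t\<close> at most 1/2, the fraction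
    \<open>\<tau> / \<beta>\<close> at most 1, and the tangential shift within the edge.\<close>
  define \<tau> where "\<tau> = min (min (\<alpha> / 2) \<beta>) (1 / (8 * (\<bar>c\<bar> + 1)))"
  have \<tau>: "\<tau> > 0" "\<tau> \<le> \<alpha> / 2" "\<tau> \<le> \<beta>" "\<tau> \<le> 1 / (8 * (\<bar>c\<bar> + 1))"
    using pos by (auto simp: \<tau>_def)
  define t where "t = \<tau> / \<alpha>"
  have t: "0 < t" "t \<le> 1/2" using \<tau> pos by (auto simp: t_def field_simps)
  \<comment> \<open>Moving by the fraction \<open>t\<close> towards \<open>z\<close> shrinks the
    base shift by \<open>1 - t\<close>; the denominator compensates for that.\<close>
  define r where "r = \<tau> * c / (1 - t)"
  have "\<tau> * \<bar>c\<bar> \<le> 1 / (8 * (\<bar>c\<bar> + 1)) * \<bar>c\<bar>" using \<tau>(4) by (intro mult_right_mono) auto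
  also have "\<dots> \<le> 1/8" by (simp add: field_simps)
  finally have "\<bar>\<tau> * c\<bar> \<le> 1/8" using \<tau>(1) by (simp add: abs_mult)
  then have "\<bar>r\<bar> \<le> (1/8) / (1/2)"
    unfolding r_def abs_divide using t by (intro frac_le) auto
  then have "\<bar>r\<bar> < 1/2" by simp
  then have r: "0 < 1/2 + r" "1/2 + r < 1" unfolding abs_less_iff by simp_all
  let ?x = "a + (1/2 + r) *\<^sub>R (b - a)"
  have "?x + t *\<^sub>R (z - ?x) \<in> K"
    using t r by (intro K.shrink_mem K.edge_closure K.edge_mem z) auto
  moreover have "?m + (\<tau> / \<beta>) *\<^sub>R (z' - ?m) \<in> K'"
    using \<tau> pos by (intro K'.shrink_mem K'.edge_closure K'.edge_mem z) auto
  moreover have "?x + t *\<^sub>R (z - ?x) = ?m + (\<tau> / \<beta>) *\<^sub>R (z' - ?m)"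
  proof -
    have "?x + t *\<^sub>R (z - ?x) = ?m + t *\<^sub>R (z - ?m) + ((1 - t) * r) *\<^sub>R (b - a)"
      by (simp add: algebra_simps)
    also have "(1 - t) * r = \<tau> * c" using t by (simp add: r_def)
    also have "?m + t *\<^sub>R (z - ?m) + (\<tau> * c) *\<^sub>R (b - a) = ?m + t *\<^sub>R (z - ?m) + \<tau> *\<^sub>R ((1 / \<beta>) *\<^sub>R (z' - ?m) - (1 / \<alpha>) *\<^sub>R (z - ?m))"
      unfolding c by simp
    also have "\<dots> = ?m + (\<tau> / \<beta>) *\<^sub>R (z' - ?m)"
      unfolding scaleR_diff_right[of \<tau>] scaleR_scaleR t_def by simp
    finally show ?thesis .
  qed
  ultimately show ?thesis by auto
qed

subsection \<open>Parallelogram meshes\<close>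

lemma ref_square_box: "ref_square = box 0 1"
  by (auto simp: ref_square_def mem_box_cart)

lemma affine_param_properties:
  assumes "affine_param F \<kappa>"
  obtains l b where "linear l" "inj l" "F = (\<lambda>x. l x + b)" "\<kappa> = F ` ref_square"
proof -
  obtain A b where A: "invertible (A::real^2^2)" "F = (\<lambda>x. A *v x + b)" "\<kappa> = F ` ref_square"
    using assms by (auto simp: affine_param_def)
  have "inj ((*v) A)"
    using A(1) by (metis inj_matrix_vector_mult)
  then show ?thesis using that[of "(*v) A" b] A by auto
qed

lemma affine_param_element:
  assumes "affine_param F \<kappa>"
  shows "open \<kappa>" "bounded \<kappa>" "convex \<kappa>" "\<kappa> \<noteq> {}"
proof -
  obtain l b where l: "linear l" "inj l" "F = (\<lambda>x. l x + b)" "\<kappa> = F ` ref_square"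
    using affine_param_properties[OF assms] by metis
  have k: "\<kappa> = (+) b ` l ` box 0 1"
    by (simp add: l(3,4) ref_square_box image_image add.commute)
  have "open (l ` box 0 1)"
    by (intro open_surjective_linear_image l linear_injective_imp_surjective) auto
  then show "open \<kappa>" unfolding k by (rule open_translation)
  have "bounded (l ` box 0 1)"
    by (intro bounded_linear_image linear_conv_bounded_linear[THEN iffD1] l) auto
  then show "bounded \<kappa>" unfolding k by (rule bounded_translation)
  show "convex \<kappa>"
    unfolding k by (intro convex_translation convex_linear_image l convex_box)
  have "(1/2) *\<^sub>R 1 \<in> ref_square" by (simp add: ref_square_def)
  then show "\<kappa> \<noteq> {}" unfolding l(4) by blast
qed

lemma smooth_component:
  fixes l :: "real^2 \<Rightarrow> real^2"
  assumes "linear l"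
  shows "smooth (\<lambda>y. l (y - b) $ i)"
proof -
  have "bounded_linear (\<lambda>y. l y $ i)"
    using assms by (intro bounded_linear_compose[OF bounded_linear_vec_nth]) (simp add: linear_conv_bounded_linear)
  then have "smooth (\<lambda>y. l y $ i + - (l b $ i))"
    by (intro smooth_add smooth_const smooth_bounded_linear)
  then show ?thesis
    using assms by (simp add: linear_diff)
qed

text \<open>Differentiable maps of the plane send null sets to null sets.\<close>

lemma affine_param_AE:
  assumes "affine_param F \<kappa>" "AE x in lebesgue_on ref_square. P (F x)"
  shows "AE y in lebesgue_on \<kappa>. P y"
proof -
  obtain l b where l: "linear l" "inj l" "F = (\<lambda>x. l x + b)" "\<kappa> = F ` ref_square"
    using affine_param_properties[OF assms(1)] by metis
  have "AE x in lebesgue. x \<in> ref_square \<longrightarrow> P (F x)"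
    using assms(2) by (subst (asm) AE_restrict_space_iff) (auto simp: ref_square_box)
  then obtain N where N: "N \<in> null_sets lebesgue" "{x. \<not> (x \<in> ref_square \<longrightarrow> P (F x))} \<subseteq> N"
    by (auto simp: eventually_ae_filter)
  have "F differentiable_on N"
    using l(1) unfolding l(3)
    by (intro differentiable_on_add linear_imp_differentiable_on differentiable_on_const)
  then have "negligible (F ` N)"
    using N(1) by (intro negligible_differentiable_image_negligible) (auto simp: negligible_iff_null_sets)
  moreover have "{y. \<not> (y \<in> \<kappa> \<longrightarrow> P y)} \<subseteq> F ` N"
    using N(2) unfolding l(4) by auto
  ultimately have "AE y in lebesgue. y \<in> \<kappa> \<longrightarrow> P y"
    by (auto simp: eventually_ae_filter negligible_iff_null_sets)
  then show ?thesis
    using affine_param_element(1)[OF assms(1)] by (subst AE_restrict_space_iff) auto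
qed

text \<open>Monomials are pulled back by the inverse of the affine map. The order of quantifiers
  matters: one finite spanning family per element serves all \<open>v\<close>, and this is the
  finite dimension behind the projection.\<close>

lemma V_DG_element_basis:
  assumes "\<kappa> \<in> \<T>" "affine_param (\<Psi> \<kappa>) \<kappa>"
  shows "\<exists>m. (\<forall>i j. smooth (m i j)) \<and> (\<forall>v\<in>V_DG \<Omega> \<T> \<Psi> p.
    \<exists>c. AE y in lebesgue_on \<kappa>. v y = (\<Sum>i\<le>p \<kappa>. \<Sum>j\<le>p \<kappa>. c i j * m i j y))"
proof -
  obtain l b where l: "linear l" "inj l" "\<Psi> \<kappa> = (\<lambda>x. l x + b)" "\<kappa> = \<Psi> \<kappa> ` ref_square"
    using affine_param_properties[OF assms(2)] by metis
  obtain g where g: "linear g" "\<And>x. g (l x) = x"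
    using linear_injective_left_inverse[OF l(1,2)] by (metis comp_apply id_apply)
  show ?thesis
  proof (intro exI[of _ "\<lambda>i j y. (g (y - b) $ 1) ^ i * (g (y - b) $ 2) ^ j"] conjI allI ballI)
    show "smooth (\<lambda>y. (g (y - b) $ 1) ^ i * (g (y - b) $ 2) ^ j)" for i j
      by (intro smooth_mult smooth_power smooth_component g(1))
    fix v assume "v \<in> V_DG \<Omega> \<T> \<Psi> p"
    with assms(1) obtain q where q: "q \<in> tensor_polys (p \<kappa>)" "AE x in lebesgue_on ref_square. v (\<Psi> \<kappa> x) = q x"
      by (auto simp: V_DG_def)
    have "AE x in lebesgue_on ref_square. v (\<Psi> \<kappa> x) = q (g (\<Psi> \<kappa> x - b))"
      using q(2) by eventually_elim (simp add: l(3) g(2))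
    then have ae: "AE y in lebesgue_on \<kappa>. v y = q (g (y - b))"
      by (rule affine_param_AE[OF assms(2)])
    obtain c where "q = (\<lambda>x. \<Sum>i\<le>p \<kappa>. \<Sum>j\<le>p \<kappa>. c i j * (x $ 1)^i * (x $ 2)^j)"
      using q(1) by (auto simp: tensor_polys_def)
    with ae show "\<exists>c. AE y in lebesgue_on \<kappa>. v y =
        (\<Sum>i\<le>p \<kappa>. \<Sum>j\<le>p \<kappa>. c i j * ((g (y - b) $ 1) ^ i * (g (y - b) $ 2) ^ j))"
      by (intro exI[of _ c]) (simp add: mult.assoc)
  qed
qed

subsection \<open>The broken space\<close>

locale parallelogram_mesh = open_bounded \<Omega> for \<Omega> :: "(real^2) set" +
  fixes \<T> :: "(real^2) set set" and \<Psi> :: "(real^2) set \<Rightarrow> real^2 \<Rightarrow> real^2"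
  assumes mesh: "subdivision \<Omega> \<T> \<Psi>"
begin

lemma finite_elements: "finite \<T>"
  and element_affine: "\<kappa> \<in> \<T> \<Longrightarrow> affine_param (\<Psi> \<kappa>) \<kappa>"
  and element_subset: "\<kappa> \<in> \<T> \<Longrightarrow> \<kappa> \<subseteq> \<Omega>"
  and closure_elements: "closure \<Omega> = (\<Union>\<kappa>\<in>\<T>. closure \<kappa>)"
  and elements_disjoint: "\<kappa> \<in> \<T> \<Longrightarrow> \<kappa>' \<in> \<T> \<Longrightarrow> \<kappa> \<noteq> \<kappa>' \<Longrightarrow> \<kappa> \<inter> \<kappa>' = {}"
  using mesh by (auto simp: subdivision_def disjoint_def)

lemma element_properties:
  assumes "\<kappa> \<in> \<T>"
  shows "open \<kappa>" "bounded \<kappa>" "convex \<kappa>" "\<kappa> \<noteq> {}"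
  using affine_param_element[OF element_affine[OF assms]] by auto

lemma element_open_bounded: "\<kappa> \<in> \<T> \<Longrightarrow> open_bounded \<kappa>"
  using element_properties by (simp add: open_bounded_def)

text \<open>Points missed by the elements lie on their frontiers, and frontiers of convex sets are
  null.\<close>

lemma AE_elements: "AE x in lebesgue_on \<Omega>. \<exists>\<kappa>\<in>\<T>. x \<in> \<kappa>"
proof -
  have "negligible (\<Union>\<kappa>\<in>\<T>. frontier \<kappa>)"
    using finite_elements element_properties(3)
    by (intro negligible_Union) (auto intro: negligible_convex_frontier)
  moreover have "x \<in> (\<Union>\<kappa>\<in>\<T>. frontier \<kappa>)" if "x \<in> \<Omega>" "\<not> (\<exists>\<kappa>\<in>\<T>. x \<in> \<kappa>)" for x
  proof -
    have "x \<in> (\<Union>\<kappa>\<in>\<T>. closure \<kappa>)" using closure_elements closure_subset[of \<Omega>] that(1) by blast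
    then obtain \<kappa> where "\<kappa> \<in> \<T>" "x \<in> closure \<kappa>" by blast
    then show ?thesis using that(2) element_properties(1) by (auto simp: frontier_def interior_open)
  qed
  ultimately have "AE x in lebesgue. x \<in> \<Omega> \<longrightarrow> (\<exists>\<kappa>\<in>\<T>. x \<in> \<kappa>)"
    by (auto simp: eventually_ae_filter negligible_iff_null_sets intro!: bexI[of _ "\<Union>(frontier ` \<T>)"])
  then show ?thesis using open_dom by (subst AE_restrict_space_iff) auto
qed

lemma AE_elementwise:
  assumes "\<And>\<kappa>. \<kappa> \<in> \<T> \<Longrightarrow> AE x in lebesgue_on \<kappa>. P x"
  shows "AE x in lebesgue_on \<Omega>. P x"
proof -
  have "AE x in lebesgue. \<forall>\<kappa>\<in>\<T>. x \<in> \<kappa> \<longrightarrow> P x"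
  proof (intro AE_finite_allI finite_elements)
    fix \<kappa> assume k: "\<kappa> \<in> \<T>"
    then have "\<kappa> \<inter> space lebesgue \<in> sets lebesgue"
      using element_properties(1) by auto
    from AE_restrict_space_iff[OF this] assms[OF k] show "AE x in lebesgue. x \<in> \<kappa> \<longrightarrow> P x"
      by simp
  qed
  moreover have "AE x in lebesgue. x \<in> \<Omega> \<longrightarrow> (\<exists>\<kappa>\<in>\<T>. x \<in> \<kappa>)"
    using AE_elements open_dom by (subst (asm) AE_restrict_space_iff) auto
  ultimately have "AE x in lebesgue. x \<in> \<Omega> \<longrightarrow> P x"
    by eventually_elim auto
  then show ?thesis using open_dom by (subst AE_restrict_space_iff) auto
qed

lemma broken_grad_element:
  assumes "\<kappa> \<in> \<T>" "x \<in> \<kappa>"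
  shows "broken_grad \<T> v x = wgrad \<kappa> v x"
proof -
  have "broken_grad \<T> v x = (\<Sum>\<kappa>'\<in>{\<kappa>}. indicator \<kappa>' x *\<^sub>R wgrad \<kappa>' v x)"
    unfolding broken_grad_def
    by (rule sum.mono_neutral_right) (use assms finite_elements elements_disjoint[OF assms(1)] in \<open>auto simp: indicator_def\<close>)
  then show ?thesis using assms(2) by simp
qed

text \<open>A common home for \<open>V_DG\<close>, \<open>H10\<close> and \<open>W_DG\<close>.
  Existence of traces is part of the definition, so that the choice in \<open>edge_trace\<close> is
  a genuine trace.\<close>

definition broken_space :: "(real^2 \<Rightarrow> real) set" where
  "broken_space = {v \<in> L2 (lebesgue_on \<Omega>). (\<forall>\<kappa>\<in>\<T>. v \<in> H1 \<kappa>) \<and>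
     (\<forall>e\<in>edges \<Omega> \<T>. \<forall>\<kappa>\<in>edge_elements \<T> e. \<exists>g. is_trace \<kappa> e v g)}"

lemma broken_space_L2: "v \<in> broken_space \<Longrightarrow> v \<in> L2 (lebesgue_on \<Omega>)"
  and broken_space_H1: "v \<in> broken_space \<Longrightarrow> \<kappa> \<in> \<T> \<Longrightarrow> v \<in> H1 \<kappa>"
  by (auto simp: broken_space_def)

lemma broken_grad_measurable:
  assumes "\<And>\<kappa>. \<kappa> \<in> \<T> \<Longrightarrow> v \<in> H1 \<kappa>"
  shows "broken_grad \<T> v \<in> L2 (lebesgue_on \<Omega>)"
proof -
  have L2_element: "(\<lambda>x. indicator \<kappa> x *\<^sub>R wgrad \<kappa> v x) \<in> L2 (lebesgue_on \<Omega>)" if "\<kappa> \<in> \<T>" for \<kappa>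
  proof -
    have L: "wgrad \<kappa> v \<in> L2 (lebesgue_on \<kappa>)" using assms[OF that] by (rule wgrad_L2)
    have k: "\<kappa> \<in> sets lebesgue" using element_properties(1)[OF that] by auto
    have m: "(\<lambda>x. indicator \<kappa> x *\<^sub>R wgrad \<kappa> v x) \<in> borel_measurable lebesgue"
      using L2_measurable[OF L] k by (subst (asm) borel_measurable_restrict_space_iff) auto
    have "integrable lebesgue (\<lambda>x. indicator \<kappa> x *\<^sub>R (norm (wgrad \<kappa> v x))\<^sup>2)"
      using L2_integrable[OF L] k by (subst (asm) integrable_restrict_space) auto
    moreover have "indicator \<kappa> x *\<^sub>R (norm (wgrad \<kappa> v x))\<^sup>2 = (norm (indicator \<kappa> x *\<^sub>R wgrad \<kappa> v x))\<^sup>2" for x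
      by (simp add: indicator_def)
    ultimately have "(\<lambda>x. indicator \<kappa> x *\<^sub>R wgrad \<kappa> v x) \<in> L2 (lebesgue_on UNIV)"
      using m by (simp add: L2_def lebesgue_on_UNIV_eq)
    then show ?thesis
      using open_dom by (intro L2_subset(1)[of UNIV \<Omega>]) auto
  qed
  have "(\<lambda>x. \<Sum>\<kappa>\<in>A. indicator \<kappa> x *\<^sub>R wgrad \<kappa> v x) \<in> L2 (lebesgue_on \<Omega>)"
    if "finite A" "A \<subseteq> \<T>" for A
    using that
  proof (induction rule: finite_induct)
    case (insert \<kappa> A)
    then have "(\<lambda>x. indicator \<kappa> x *\<^sub>R wgrad \<kappa> v x + (\<Sum>\<kappa>\<in>A. indicator \<kappa> x *\<^sub>R wgrad \<kappa> v x)) \<in> L2 (lebesgue_on \<Omega>)"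
      by (intro L2_add L2_element) auto
    then show ?case by (simp only: sum.insert[OF insert.hyps])
  qed (auto intro: L2_zero)
  then show ?thesis
    unfolding broken_grad_def[abs_def] using finite_elements by blast
qed

lemma broken_space_grad_L2: "v \<in> broken_space \<Longrightarrow> broken_grad \<T> v \<in> L2 (lebesgue_on \<Omega>)"
  by (intro broken_grad_measurable broken_space_H1)

lemma broken_grad_lincomb:
  assumes "u \<in> broken_space" "v \<in> broken_space"
  shows "AE x in lebesgue_on \<Omega>. broken_grad \<T> (\<lambda>x. u x + c * v x) x = broken_grad \<T> u x + c *\<^sub>R broken_grad \<T> v x"
proof (rule AE_elementwise)
  fix \<kappa> assume k: "\<kappa> \<in> \<T>"
  interpret \<kappa>: open_bounded \<kappa> by (rule element_open_bounded[OF k])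
  have "AE x in lebesgue_on \<kappa>. x \<in> \<kappa>" using AE_space[of "lebesgue_on \<kappa>"] by simp
  with \<kappa>.H1_lincomb(2)[OF broken_space_H1[OF assms(1) k] broken_space_H1[OF assms(2) k], of c]
  show "AE x in lebesgue_on \<kappa>. broken_grad \<T> (\<lambda>x. u x + c * v x) x = broken_grad \<T> u x + c *\<^sub>R broken_grad \<T> v x"
    by eventually_elim (simp add: broken_grad_element[OF k])
qed

text \<open>The weak gradient on the domain restricts to a weak gradient on each element, and these
  are unique.\<close>

lemma broken_grad_H1:
  assumes "u \<in> H1 \<Omega>"
  shows "AE x in lebesgue_on \<Omega>. broken_grad \<T> u x = wgrad \<Omega> u x"
proof (rule AE_elementwise)
  fix \<kappa> assume k: "\<kappa> \<in> \<T>"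
  have "AE x in lebesgue_on \<kappa>. x \<in> \<kappa>" using AE_space[of "lebesgue_on \<kappa>"] by simp
  with H1_subset(2)[OF element_properties(1)[OF k] element_subset[OF k] assms]
  show "AE x in lebesgue_on \<kappa>. broken_grad \<T> u x = wgrad \<Omega> u x"
    by eventually_elim (simp add: broken_grad_element[OF k])
qed

text \<open>One pair of end points serves all adjacent elements, so their normals can be compared at
  the same midpoint.\<close>

lemma edge_segment:
  assumes "e \<in> edges \<Omega> \<T>"
  obtains a b where "segment_measure e a b"
    "\<And>\<kappa>. \<kappa> \<in> edge_elements \<T> e \<Longrightarrow> convex_edge \<kappa> e a b"
proof -
  obtain a' b' where "e = open_segment a' b'" "a' \<noteq> b'"
    using assms by (auto simp: edges_def interior_edges_def boundary_edges_def)
  then obtain a b where ab: "e = open_segment a b" "a \<noteq> b"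
    "arc_length e = density (distr (restrict_space lborel {0..1::real}) borel (linepath a b)) (\<lambda>_. ennreal (dist a b))"
    by (rule arc_length_open_segment)
  then have s: "segment_measure e a b" by unfold_locales
  have "convex_edge \<kappa> e a b" if "\<kappa> \<in> edge_elements \<T> e" for \<kappa>
  proof -
    have k: "\<kappa> \<in> \<T>" "e \<subseteq> frontier \<kappa>" using that by (auto simp: edge_elements_def)
    show ?thesis
      using s element_open_bounded[OF k(1)] element_properties(3)[OF k(1)] k(2)
      by (simp add: convex_edge_def convex_edge_axioms_def)
  qed
  with s show ?thesis by (rule that)
qed

lemma edge_elements_finite: "finite (edge_elements \<T> e)"
  using finite_elements by (simp add: edge_elements_def)

lemma broken_space_trace:
  assumes "v \<in> broken_space" "e \<in> edges \<Omega> \<T>" "\<kappa> \<in> edge_elements \<T> e"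
  shows "is_trace \<kappa> e v (edge_trace \<kappa> e v)"
proof -
  obtain a b where "convex_edge \<kappa> e a b"
    using edge_segment[OF assms(2)] assms(3) by metis
  then interpret convex_edge \<kappa> e a b .
  have "\<kappa> \<in> \<T>" using assms(3) by (simp add: edge_elements_def)
  moreover obtain g where "is_trace \<kappa> e v g"
    using assms unfolding broken_space_def by blast
  ultimately show ?thesis
    by (intro edge_traceI(1)[OF broken_space_H1[OF assms(1)]])
qed

lemma broken_space_lincomb:
  assumes u: "u \<in> broken_space" and v: "v \<in> broken_space"
  shows "(\<lambda>x. u x + c * v x) \<in> broken_space"
  unfolding broken_space_def
proof (intro CollectI conjI ballI)
  show "(\<lambda>x. u x + c * v x) \<in> L2 (lebesgue_on \<Omega>)"
    by (intro L2_add L2_cmult broken_space_L2 u v)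
  show "(\<lambda>x. u x + c * v x) \<in> H1 \<kappa>" if "\<kappa> \<in> \<T>" for \<kappa>
    by (intro open_bounded.H1_lincomb(1) element_open_bounded broken_space_H1 u v that)
  fix e \<kappa> assume e: "e \<in> edges \<Omega> \<T>" "\<kappa> \<in> edge_elements \<T> e"
  then have k: "\<kappa> \<in> \<T>" by (simp add: edge_elements_def)
  obtain a b where "convex_edge \<kappa> e a b"
    using edge_segment[OF e(1)] e(2) by metis
  then interpret convex_edge \<kappa> e a b .
  show "\<exists>g. is_trace \<kappa> e (\<lambda>x. u x + c * v x) g"
    using is_trace_lincomb[OF broken_space_H1[OF u k] broken_space_H1[OF v k]
        broken_space_trace[OF u e] broken_space_trace[OF v e]] by blast
qed

text \<open>Traces are linear up to null sets, and finitely many elements touch an edge, so the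
  exceptional sets can be merged.\<close>

lemma jump_lincomb:
  assumes u: "u \<in> broken_space" and v: "v \<in> broken_space" and e: "e \<in> edges \<Omega> \<T>"
  shows "AE x in arc_length e. jump \<T> e (\<lambda>x. u x + c * v x) x = jump \<T> e u x + c *\<^sub>R jump \<T> e v x"
proof -
  obtain a b where ce: "\<And>\<kappa>. \<kappa> \<in> edge_elements \<T> e \<Longrightarrow> convex_edge \<kappa> e a b"
    using edge_segment[OF e] by metis
  have "AE x in arc_length e. \<forall>\<kappa>\<in>edge_elements \<T> e.
      edge_trace \<kappa> e (\<lambda>x. u x + c * v x) x = edge_trace \<kappa> e u x + c * edge_trace \<kappa> e v x"
  proof (intro AE_finite_allI edge_elements_finite)
    fix \<kappa> assume k: "\<kappa> \<in> edge_elements \<T> e"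
    then have k': "\<kappa> \<in> \<T>" by (simp add: edge_elements_def)
    interpret convex_edge \<kappa> e a b by (rule ce[OF k])
    show "AE x in arc_length e. edge_trace \<kappa> e (\<lambda>x. u x + c * v x) x = edge_trace \<kappa> e u x + c * edge_trace \<kappa> e v x"
      by (rule edge_traceI(2)[OF broken_space_H1[OF broken_space_lincomb[OF u v] k']
            is_trace_lincomb[OF broken_space_H1[OF u k'] broken_space_H1[OF v k']
              broken_space_trace[OF u e k] broken_space_trace[OF v e k]]])
  qed
  then show ?thesis
    by (rule eventually_mono) (simp add: jump_def scaleR_add_left sum.distrib scaleR_sum_right)
qed

lemma jump_L2:
  assumes "v \<in> broken_space" "e \<in> edges \<Omega> \<T>"
  shows "jump \<T> e v \<in> L2 (arc_length e)"
proof -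
  have "(\<lambda>x. \<Sum>\<kappa>\<in>A. edge_trace \<kappa> e v x *\<^sub>R outward_normal \<kappa> e) \<in> L2 (arc_length e)"
    if "finite A" "A \<subseteq> edge_elements \<T> e" for A
    using that
  proof (induction rule: finite_induct)
    case (insert \<kappa> A)
    have t: "edge_trace \<kappa> e v \<in> L2 (arc_length e)"
      using broken_space_trace[OF assms, of \<kappa>] insert.prems by (simp add: is_trace_def)
    have "(\<lambda>x. edge_trace \<kappa> e v x *\<^sub>R outward_normal \<kappa> e) \<in> L2 (arc_length e)"
      by (rule L2_dominated[OF _ t, of _ "norm (outward_normal \<kappa> e)"])
        (use L2_measurable[OF t] in \<open>auto simp: mult.commute\<close>)
    then show ?case using insert by (auto intro: L2_add)
  qed (auto intro: L2_zero)
  then show ?thesis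
    unfolding jump_def[abs_def] using edge_elements_finite by blast
qed

text \<open>On each element the function agrees almost everywhere with a smooth function on the
  plane, whose restriction is the trace.\<close>

lemma V_DG_broken_space: "V_DG \<Omega> \<T> \<Psi> p \<subseteq> broken_space"
proof
  fix v assume v: "v \<in> V_DG \<Omega> \<T> \<Psi> p"
  then have vL: "v \<in> L2 (lebesgue_on \<Omega>)" by (simp add: V_DG_def)
  have H: "v \<in> H1 \<kappa> \<and> (\<exists>\<psi>. smooth \<psi> \<and> (AE y in lebesgue_on \<kappa>. v y = \<psi> y))" if k: "\<kappa> \<in> \<T>" for \<kappa>
  proof -
    interpret \<kappa>: open_bounded \<kappa> by (rule element_open_bounded[OF k])
    obtain \<psi> where \<psi>: "smooth \<psi>" "AE y in lebesgue_on \<kappa>. v y = \<psi> y"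
    proof -
      obtain m where m: "\<And>i j. smooth (m i j)" "\<exists>c. AE y in lebesgue_on \<kappa>. v y = (\<Sum>i\<le>p \<kappa>. \<Sum>j\<le>p \<kappa>. c i j * m i j y)"
        using V_DG_element_basis[where \<Psi> = \<Psi>, OF k element_affine[OF k]] v by blast
      then obtain c where "AE y in lebesgue_on \<kappa>. v y = (\<Sum>i\<le>p \<kappa>. \<Sum>j\<le>p \<kappa>. c i j * m i j y)" by blast
      then show ?thesis
        by (rule that[rotated]) (intro smooth_sum smooth_mult smooth_const m(1))
    qed
    have "v \<in> L2 (lebesgue_on \<kappa>)"
      by (rule L2_subset(1)[OF sets_dom \<kappa>.sets_dom element_subset[OF k] vL])
    then have "v \<in> H1 \<kappa>"
      using \<psi>(2) by (intro \<kappa>.H1_cong_AE(1)[OF \<kappa>.H1_smooth(1)[OF \<psi>(1)]] L2_measurable) (auto elim: eventually_mono)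
    with \<psi> show ?thesis by blast
  qed
  show "v \<in> broken_space"
    unfolding broken_space_def
  proof (intro CollectI conjI ballI vL)
    show "v \<in> H1 \<kappa>" if "\<kappa> \<in> \<T>" for \<kappa> using H[OF that] by blast
    fix e \<kappa> assume e: "e \<in> edges \<Omega> \<T>" "\<kappa> \<in> edge_elements \<T> e"
    then have k: "\<kappa> \<in> \<T>" by (simp add: edge_elements_def)
    obtain a b where "convex_edge \<kappa> e a b"
      using edge_segment[OF e(1)] e(2) by metis
    then interpret convex_edge \<kappa> e a b .
    show "\<exists>g. is_trace \<kappa> e v g"
      using H[OF k] is_trace_smooth by blast
  qed
qed

text \<open>One sequence of test functions approximates \<open>u\<close> on all elements at once, so
  its limit on the edge is the trace from every side. On a boundary edge the test functions vanish,
  and the limit with them.\<close>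

lemma H10_trace:
  assumes u: "u \<in> H10 \<Omega>" and e: "e \<in> edges \<Omega> \<T>"
  obtains g where "\<And>\<kappa>. \<kappa> \<in> edge_elements \<T> e \<Longrightarrow> is_trace \<kappa> e u g"
    "e \<subseteq> frontier \<Omega> \<Longrightarrow> g = (\<lambda>x. 0)"
proof -
  obtain \<phi> where \<phi>: "\<And>n::nat. \<phi> n \<in> test_functions \<Omega>" "(\<lambda>n. H1_norm \<Omega> (\<lambda>x. \<phi> n x - u x)) \<longlonglongrightarrow> 0"
    using u by (auto simp: H10_def)
  note sm = test_functions_smooth[OF \<phi>(1)]
  have uH: "u \<in> H1 \<Omega>" using u by (rule H10_H1)
  obtain a b where seg: "segment_measure e a b"
    and ce: "\<And>\<kappa>. \<kappa> \<in> edge_elements \<T> e \<Longrightarrow> convex_edge \<kappa> e a b"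
    using edge_segment[OF e] by metis
  have sub: "\<kappa> \<subseteq> \<Omega>" if "\<kappa> \<in> edge_elements \<T> e" for \<kappa>
    using that element_subset by (simp add: edge_elements_def)
  have tr: "is_trace \<kappa> e u g" if "\<kappa> \<in> edge_elements \<T> e" "g \<in> L2 (arc_length e)"
    "(\<lambda>n. L2_norm (arc_length e) (\<lambda>x. \<phi> n x - g x)) \<longlonglongrightarrow> 0" for \<kappa> g
    by (rule convex_edge.is_trace_approx[OF ce[OF that(1)] open_dom bounded_dom sub[OF that(1)] uH sm \<phi>(2) that(2,3)])
  show ?thesis
  proof (cases "e \<subseteq> frontier \<Omega>")
    case True
    interpret segment_measure e a b by (rule seg)
    have "L2_norm (arc_length e) (\<lambda>x. \<phi> n x - 0) = 0" for n
    proof -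
      have "AE x in arc_length e. \<phi> n x = 0"
        using AE_arc_length
      proof eventually_elim
        case (elim x)
        then have "x \<notin> \<Omega>" using True open_dom by (auto simp: frontier_def interior_open)
        then show ?case by (rule test_function_eq_0[OF \<phi>(1)])
      qed
      then have "(LINT x|arc_length e. (norm (\<phi> n x))\<^sup>2) = 0"
        using integral_squared_eq_0_iff[OF L2_arc_length_continuous(1)[OF smooth_imp_continuous_on[OF sm]]] by blast
      then show ?thesis by (simp add: L2_norm_def)
    qed
    then show ?thesis
      by (intro that[of "\<lambda>x. 0"] tr) (auto intro: L2_zero)
  next
    case False
    show ?thesis
    proof (cases "edge_elements \<T> e = {}")
      case True
      show ?thesis by (rule that[of "\<lambda>x. 0"]) (use True in auto)
    next
      case False
      then obtain \<kappa> where k: "\<kappa> \<in> edge_elements \<T> e" by blast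
      obtain g where "g \<in> L2 (arc_length e)" "(\<lambda>n. L2_norm (arc_length e) (\<lambda>x. \<phi> n x - g x)) \<longlonglongrightarrow> 0"
        by (rule convex_edge.trace_limit_exists[OF ce[OF k] open_dom bounded_dom sub[OF k] uH sm \<phi>(2)])
      then show ?thesis
        using \<open>\<not> e \<subseteq> frontier \<Omega>\<close> by (intro that[of g] tr) auto
    qed
  qed
qed

lemma H10_broken_space: "H10 \<Omega> \<subseteq> broken_space"
proof
  fix u assume u: "u \<in> H10 \<Omega>"
  then have "u \<in> H1 \<Omega>" by (rule H10_H1)
  moreover have "\<exists>g. is_trace \<kappa> e u g" if "e \<in> edges \<Omega> \<T>" "\<kappa> \<in> edge_elements \<T> e" for e \<kappa>
    using H10_trace[OF u that(1)] that(2) by metis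
  ultimately show "u \<in> broken_space"
    unfolding broken_space_def using H1_L2[of u] H1_subset(1)[OF element_properties(1) element_subset]
    by auto
qed

lemma W_DG_broken_space: "W_DG \<Omega> \<T> \<Psi> p \<subseteq> broken_space"
proof
  fix w assume "w \<in> W_DG \<Omega> \<T> \<Psi> p"
  then obtain w\<^sub>0 v where "w = (\<lambda>x. w\<^sub>0 x + v x)" "w\<^sub>0 \<in> H10 \<Omega>" "v \<in> V_DG \<Omega> \<T> \<Psi> p"
    by (auto simp: W_DG_def)
  then show "w \<in> broken_space"
    using broken_space_lincomb[of w\<^sub>0 v 1] H10_broken_space V_DG_broken_space by auto
qed

text \<open>A segment in the plane has one opposite pair of unit normals, and disjoint elements
  cannot share the same one. A third element at the edge would have to share its normal with one of
  the two.\<close>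

lemma interior_edge_normals:
  assumes "e \<in> interior_edges \<Omega> \<T>"
  obtains \<kappa> \<kappa>' where "\<kappa> \<noteq> \<kappa>'" "edge_elements \<T> e = {\<kappa>, \<kappa>'}" "outward_normal \<kappa>' e = - outward_normal \<kappa> e"
proof -
  have e: "e \<in> edges \<Omega> \<T>" using assms by (simp add: edges_def)
  obtain a b where ce: "\<And>\<kappa>. \<kappa> \<in> edge_elements \<T> e \<Longrightarrow> convex_edge \<kappa> e a b"
    using edge_segment[OF e] by metis
  obtain \<kappa> \<kappa>' where k: "\<kappa> \<in> \<T>" "\<kappa>' \<in> \<T>" "\<kappa> \<noteq> \<kappa>'" "e = rel_interior (frontier \<kappa> \<inter> frontier \<kappa>')"
    using assms by (auto simp: interior_edges_def)
  then have el: "\<kappa> \<in> edge_elements \<T> e" "\<kappa>' \<in> edge_elements \<T> e"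
    using rel_interior_subset[of "frontier \<kappa> \<inter> frontier \<kappa>'"] by (auto simp: edge_elements_def)
  have opp: "outward_normal \<kappa>\<^sub>2 e = - outward_normal \<kappa>\<^sub>1 e"
    if "\<kappa>\<^sub>1 \<in> edge_elements \<T> e" "\<kappa>\<^sub>2 \<in> edge_elements \<T> e" "\<kappa>\<^sub>1 \<noteq> \<kappa>\<^sub>2" for \<kappa>\<^sub>1 \<kappa>\<^sub>2
  proof -
    interpret k1: convex_edge \<kappa>\<^sub>1 e a b by (rule ce[OF that(1)])
    interpret k2: convex_edge \<kappa>\<^sub>2 e a b by (rule ce[OF that(2)])
    have "\<kappa>\<^sub>1 \<inter> \<kappa>\<^sub>2 = {}" using that elements_disjoint by (auto simp: edge_elements_def)
    then have "outward_normal \<kappa>\<^sub>1 e \<noteq> outward_normal \<kappa>\<^sub>2 e"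
      using same_normal_imp_overlap[OF ce[OF that(1)] ce[OF that(2)]] by blast
    then show ?thesis
      using real2_unit_normals[of "b - a" "outward_normal \<kappa>\<^sub>2 e" "outward_normal \<kappa>\<^sub>1 e"]
        k1.normal_properties k2.normal_properties k1.ends by auto
  qed
  have "edge_elements \<T> e = {\<kappa>, \<kappa>'}"
  proof (rule ccontr)
    assume "edge_elements \<T> e \<noteq> {\<kappa>, \<kappa>'}"
    then obtain \<kappa>\<^sub>3 where k3: "\<kappa>\<^sub>3 \<in> edge_elements \<T> e" "\<kappa>\<^sub>3 \<noteq> \<kappa>" "\<kappa>\<^sub>3 \<noteq> \<kappa>'" using el by blast
    have "outward_normal \<kappa>' e = outward_normal \<kappa>\<^sub>3 e"
      using opp[OF el(1,2) k(3)] opp[OF el(1) k3(1)] k3(2) by simp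
    then have "\<kappa>' \<inter> \<kappa>\<^sub>3 \<noteq> {}"
      by (rule same_normal_imp_overlap[OF ce[OF el(2)] ce[OF k3(1)]])
    then show False using elements_disjoint[of \<kappa>' \<kappa>\<^sub>3] k(2) k3 by (auto simp: edge_elements_def)
  qed
  then show ?thesis using opp[OF el k(3)] k(3) by (intro that)
qed

text \<open>The common trace factors out of the jump. On an interior edge the normals cancel; on a
  boundary edge the trace is 0.\<close>

lemma jump_H10:
  assumes u: "u \<in> H10 \<Omega>" and e: "e \<in> edges \<Omega> \<T>"
  shows "AE x in arc_length e. jump \<T> e u x = 0"
proof -
  obtain a b where ce: "\<And>\<kappa>. \<kappa> \<in> edge_elements \<T> e \<Longrightarrow> convex_edge \<kappa> e a b"
    using edge_segment[OF e] by metis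
  obtain g where g: "\<And>\<kappa>. \<kappa> \<in> edge_elements \<T> e \<Longrightarrow> is_trace \<kappa> e u g" "e \<subseteq> frontier \<Omega> \<Longrightarrow> g = (\<lambda>x. 0)"
    using H10_trace[OF u e] by metis
  have "AE x in arc_length e. \<forall>\<kappa>\<in>edge_elements \<T> e. edge_trace \<kappa> e u x = g x"
  proof (intro AE_finite_allI edge_elements_finite)
    fix \<kappa> assume k: "\<kappa> \<in> edge_elements \<T> e"
    then have "u \<in> H1 \<kappa>" using u H10_broken_space by (auto intro: broken_space_H1 simp: edge_elements_def)
    then show "AE x in arc_length e. edge_trace \<kappa> e u x = g x"
      using convex_edge.edge_traceI(2)[OF ce[OF k]] g(1)[OF k] by blast
  qed
  then show ?thesis
  proof (rule eventually_mono)
    fix x assume "\<forall>\<kappa>\<in>edge_elements \<T> e. edge_trace \<kappa> e u x = g x"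
    then have j: "jump \<T> e u x = g x *\<^sub>R (\<Sum>\<kappa>\<in>edge_elements \<T> e. outward_normal \<kappa> e)"
      by (simp add: jump_def scaleR_sum_right)
    show "jump \<T> e u x = 0"
    proof (cases "e \<in> interior_edges \<Omega> \<T>")
      case True
      then obtain \<kappa> \<kappa>' where "\<kappa> \<noteq> \<kappa>'" "edge_elements \<T> e = {\<kappa>, \<kappa>'}" "outward_normal \<kappa>' e = - outward_normal \<kappa> e"
        by (rule interior_edge_normals)
      then show ?thesis unfolding j by simp
    next
      case False
      then obtain s where "e = rel_interior (s \<inter> frontier \<Omega>)"
        using e by (auto simp: edges_def boundary_edges_def)
      then have "e \<subseteq> frontier \<Omega>" using rel_interior_subset[of "s \<inter> frontier \<Omega>"] by blast
      then show ?thesis unfolding j using g(2) by simp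
    qed
  qed
qed

end

subsection \<open>Positive semidefinite forms and projections\<close>

text \<open>Definiteness cannot be asked for, because functions that vanish almost everywhere are
  null vectors. The volume form, the jump form and their sum are instances.\<close>

locale semi_inner_on =
  fixes X :: "('a \<Rightarrow> real) set" and B :: "('a \<Rightarrow> real) \<Rightarrow> ('a \<Rightarrow> real) \<Rightarrow> real"
  assumes lincomb: "u \<in> X \<Longrightarrow> v \<in> X \<Longrightarrow> (\<lambda>x. u x + c * v x) \<in> X"
    and form_left: "u \<in> X \<Longrightarrow> v \<in> X \<Longrightarrow> z \<in> X \<Longrightarrow> B (\<lambda>x. u x + c * v x) z = B u z + c * B v z"
    and form_commute: "B u v = B v u"
    and form_nonneg: "u \<in> X \<Longrightarrow> 0 \<le> B u u"
begin

lemma form_right: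
  assumes "u \<in> X" "v \<in> X" "z \<in> X"
  shows "B z (\<lambda>x. u x + c * v x) = B z u + c * B z v"
  unfolding form_commute[of z] by (rule form_left[OF assms])

lemma form_square:
  assumes "u \<in> X" "v \<in> X"
  shows "B (\<lambda>x. u x + c * v x) (\<lambda>x. u x + c * v x) = B u u + 2 * c * B u v + c\<^sup>2 * B v v"
proof -
  let ?w = "\<lambda>x. u x + c * v x"
  have "B ?w ?w = (B u u + c * B u v) + c * (B v u + c * B v v)"
    unfolding form_left[OF assms lincomb[OF assms]] form_right[OF assms assms(1)] form_right[OF assms assms(2)] ..
  then show ?thesis
    unfolding form_commute[of v u] by (simp add: algebra_simps power2_eq_square)
qed

lemma form_square_le:
  assumes "u \<in> X" "v \<in> X"
  shows "B (\<lambda>x. u x + c * v x) (\<lambda>x. u x + c * v x) \<le> 2 * B u u + 2 * c\<^sup>2 * B v v"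
proof -
  \<comment> \<open>Nonnegativity at \<open>- c\<close> is the parallelogram law with one term
    dropped.\<close>
  have "0 \<le> B u u + 2 * (- c) * B u v + (- c)\<^sup>2 * B v v"
    using form_nonneg[OF lincomb[OF assms, of "- c"]] form_square[OF assms, of "- c"] by (simp only:)
  then show ?thesis
    unfolding form_square[OF assms] by (simp add: algebra_simps)
qed

lemma form_Cauchy_Schwarz:
  assumes "u \<in> X" "v \<in> X"
  shows "\<bar>B u v\<bar> \<le> sqrt (B u u) * sqrt (B v v)"
proof (rule discriminant_le)
  show "0 \<le> B u u + 2 * t * B u v + t\<^sup>2 * B v v" for t
    using form_nonneg[OF lincomb[OF assms, of t]] form_square[OF assms, of t] by simp
qed

lemma form_null: "u \<in> X \<Longrightarrow> v \<in> X \<Longrightarrow> B v v = 0 \<Longrightarrow> B u v = 0"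
  using form_Cauchy_Schwarz[of u v] by simp

text \<open>Finite dimension of \<open>Z\<close> modulo null vectors is expressed by finitely many linear functionals
  that separate the non-null vectors.\<close>

lemma projection_exists:
  assumes "finite J" "Z \<subseteq> X" "Z \<noteq> {}" "\<And>u v c. u \<in> Z \<Longrightarrow> v \<in> Z \<Longrightarrow> (\<lambda>x. u x + c * v x) \<in> Z"
    and "\<And>j u v c. j \<in> J \<Longrightarrow> u \<in> Z \<Longrightarrow> v \<in> Z \<Longrightarrow> l j (\<lambda>x. u x + c * v x) = l j u + c * l j v"
    and "\<And>z. z \<in> Z \<Longrightarrow> (\<And>j. j \<in> J \<Longrightarrow> l j z = 0) \<Longrightarrow> B z z = 0"
    and "v \<in> X"
  shows "\<exists>z\<in>Z. \<forall>y\<in>Z. B (\<lambda>x. v x + (- 1) * z x) y = 0"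
  using assms
proof (induction J arbitrary: Z v rule: finite_induct)
  case empty
  \<comment> \<open>With no functional left, all vectors of \<open>Z\<close> are null, and any of
    them is a projection.\<close>
  obtain z where "z \<in> Z" using empty.prems(2) by blast
  moreover have "B (\<lambda>x. v x + (- 1) * z x) y = 0" if "y \<in> Z" for y
  proof -
    have X: "z \<in> X" "y \<in> X" using empty.prems(1) \<open>z \<in> Z\<close> that by blast+
    have "B y y = 0" by (rule empty.prems(5)[OF that]) simp
    then show ?thesis by (rule form_null[OF lincomb[OF empty.prems(6) X(1)] X(2)])
  qed
  ultimately show ?case by blast
next
  case (insert j J)
  note ZX = subsetD[OF insert.prems(1)] and Zc = insert.prems(3)
  have lj: "l j (\<lambda>x. u x + c * v x) = l j u + c * l j v" if "u \<in> Z" "v \<in> Z" for u v c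
    using insert.prems(4) that by blast
  \<comment> \<open>On the kernel of the new functional the remaining ones separate, so the
    induction hypothesis applies there.\<close>
  let ?Z = "{z \<in> Z. l j z = 0}"
  have IH: "\<exists>z\<in>?Z. \<forall>y\<in>?Z. B (\<lambda>x. v x + (- 1) * z x) y = 0" if "v \<in> X" for v
  proof (rule insert.IH)
    obtain z where "z \<in> Z" using insert.prems(2) by blast
    then have "(\<lambda>x. z x + (- 1) * z x) \<in> ?Z"
      using Zc[of z z "- 1"] lj[of z z "- 1"] by simp
    then show "?Z \<noteq> {}" by blast
    fix z assume z: "z \<in> ?Z" "\<And>i. i \<in> J \<Longrightarrow> l i z = 0"
    show "B z z = 0"
    proof (rule insert.prems(5))
      show "l i z = 0" if "i \<in> insert j J" for i using that z by auto
    qed (use z in blast)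
  qed (use insert.prems that lj in auto)
  show ?case
  proof (cases "\<exists>z0\<in>Z. l j z0 \<noteq> 0")
    case False
    then have "?Z = Z" by auto
    then show ?thesis using IH[OF insert.prems(6)] by simp
  next
    case True
    then obtain z0 where z0: "z0 \<in> Z" "l j z0 \<noteq> 0" by blast
    obtain z0' where z0': "z0' \<in> ?Z" "\<forall>y\<in>?Z. B (\<lambda>x. z0 x + (- 1) * z0' x) y = 0"
      using IH[OF ZX[OF z0(1)]] by blast
    obtain v' where v': "v' \<in> ?Z" "\<forall>y\<in>?Z. B (\<lambda>x. v x + (- 1) * v' x) y = 0"
      using IH[OF insert.prems(6)] by blast
    \<comment> \<open>Gram-Schmidt: \<open>z1\<close> is the part, orthogonal to the kernel, of a
      vector outside it, and \<open>r\<close> is the corresponding part of \<open>v\<close>.\<close>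
    define z1 where "z1 = (\<lambda>x. z0 x + (- 1) * z0' x)"
    define r where "r = (\<lambda>x. v x + (- 1) * v' x)"
    have z1: "z1 \<in> Z" "l j z1 \<noteq> 0" "\<And>y. y \<in> ?Z \<Longrightarrow> B z1 y = 0"
    proof -
      have "z0' \<in> Z" "l j z0' = 0" using z0'(1) by auto
      then show "z1 \<in> Z" "l j z1 \<noteq> 0"
        unfolding z1_def using Zc[OF z0(1), of z0' "- 1"] lj[OF z0(1), of z0' "- 1"] z0(2) by simp_all
      show "\<And>y. y \<in> ?Z \<Longrightarrow> B z1 y = 0" unfolding z1_def using z0'(2) by blast
    qed
    have v'Z: "v' \<in> Z" using v'(1) by blast
    have r: "r \<in> X"
      unfolding r_def by (rule lincomb[OF insert.prems(6) ZX[OF v'Z]])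
    have r0: "B r y = 0" if "y \<in> ?Z" for y
      unfolding r_def using v'(2) that by blast
    \<comment> \<open>A null \<open>z1\<close> pairs to 0 with everything, so the coefficient 0 is
      right in that case.\<close>
    define \<alpha> where "\<alpha> = (if B z1 z1 = 0 then 0 else B r z1 / B z1 z1)"
    define s where "s = (\<lambda>x. r x + (- \<alpha>) * z1 x)"
    have s: "s \<in> X" unfolding s_def by (intro lincomb r ZX z1)
    have s1: "B s z1 = 0"
    proof (cases "B z1 z1 = 0")
      case True
      then show ?thesis using form_null[OF s ZX[OF z1(1)]] by simp
    next
      case False
      then show ?thesis
        unfolding s_def form_left[OF r ZX[OF z1(1)] ZX[OF z1(1)]] by (simp add: \<alpha>_def)
    qed
    show ?thesis
    proof (intro bexI[of _ "\<lambda>x. v' x + \<alpha> * z1 x"] ballI)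
      show "(\<lambda>x. v' x + \<alpha> * z1 x) \<in> Z" by (rule Zc[OF v'Z z1(1)])
      fix y assume y: "y \<in> Z"
      \<comment> \<open>This multiple of \<open>z1\<close> moves \<open>y\<close> into the kernel,
        where orthogonality is known.\<close>
      let ?\<beta> = "l j y / l j z1"
      let ?y = "\<lambda>x. y x + (- ?\<beta>) * z1 x"
      have y': "?y \<in> ?Z" using Zc[OF y z1(1), of "- ?\<beta>"] lj[OF y z1(1), of "- ?\<beta>"] z1(2) by simp
      have "B s ?y = 0"
      proof -
        have "?y \<in> X" using y' ZX by blast
        then show ?thesis
          unfolding s_def form_left[OF r ZX[OF z1(1)] \<open>?y \<in> X\<close>] r0[OF y'] z1(3)[OF y'] by simp
      qed
      moreover have "B s y = B s ?y + ?\<beta> * B s z1"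
        using form_right[OF ZX[OF y] ZX[OF z1(1)] s, of "- ?\<beta>"] by simp
      ultimately have "B s y = 0" using s1 by simp
      moreover have "(\<lambda>x. v x + (- 1) * (v' x + \<alpha> * z1 x)) = s"
        unfolding s_def r_def by (simp add: algebra_simps)
      ultimately show "B (\<lambda>x. v x + (- 1) * (v' x + \<alpha> * z1 x)) y = 0" by simp
    qed
  qed
qed

end

subsection \<open>The discontinuous Galerkin forms\<close>

context parallelogram_mesh
begin

definition volume_form :: "real \<Rightarrow> (real^2 \<Rightarrow> real) \<Rightarrow> (real^2 \<Rightarrow> real) \<Rightarrow> real" where
  "volume_form \<epsilon> u v = (LINT x|lebesgue_on \<Omega>. \<epsilon> * (broken_grad \<T> u x \<bullet> broken_grad \<T> v x) + u x * v x)"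

definition jump_form :: "((real^2) set \<Rightarrow> real) \<Rightarrow> (real^2 \<Rightarrow> real) \<Rightarrow> (real^2 \<Rightarrow> real) \<Rightarrow> real" where
  "jump_form c u v = edge_integral \<Omega> \<T> (\<lambda>e x. c e * (jump \<T> e u x \<bullet> jump \<T> e v x))"

abbreviation dg_weight :: "((real^2) set \<Rightarrow> nat) \<Rightarrow> real \<Rightarrow> (real^2) set \<Rightarrow> real" where
  "dg_weight p \<epsilon> e \<equiv> \<epsilon> * edge_sigma \<T> p e + 1 / edge_sigma \<T> p e"

lemma DG_inner_eq: "DG_inner \<Omega> \<T> p \<epsilon> u v = volume_form \<epsilon> u v + jump_form (dg_weight p \<epsilon>) u v"
  by (simp add: DG_inner_def volume_form_def jump_form_def)

lemma jump_form_sum: "jump_form c u v = (\<Sum>e\<in>edges \<Omega> \<T>. c e * (LINT x|arc_length e. jump \<T> e u x \<bullet> jump \<T> e v x))"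
  by (simp add: jump_form_def edge_integral_def)

lemma jump_form_weight_add:
  "jump_form (\<lambda>e. a * c e + b * d e) u v = a * jump_form c u v + b * jump_form d u v"
  by (simp add: jump_form_sum sum_distrib_left sum.distrib algebra_simps)

lemma edge_sigma_nonneg:
  assumes "e \<in> edges \<Omega> \<T>"
  shows "0 \<le> edge_sigma \<T> p e"
proof -
  obtain a b where "e = open_segment a b"
    using assms by (auto simp: edges_def interior_edges_def boundary_edges_def)
  then have "bounded e" by (simp add: bounded_open_segment)
  then show ?thesis
    unfolding edge_sigma_def by (intro divide_nonneg_nonneg diameter_ge_0) auto
qed

lemma volume_form_integrable:
  assumes "u \<in> broken_space" "v \<in> broken_space"
  shows "integrable (lebesgue_on \<Omega>) (\<lambda>x. broken_grad \<T> u x \<bullet> broken_grad \<T> v x)"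
    "integrable (lebesgue_on \<Omega>) (\<lambda>x. u x * v x)"
  by (intro L2_inner_integrable L2_mult_integrable broken_space_grad_L2 broken_space_L2 assms)+

lemma volume_form_eq:
  assumes "u \<in> broken_space" "v \<in> broken_space"
  shows "volume_form \<epsilon> u v = \<epsilon> * (LINT x|lebesgue_on \<Omega>. broken_grad \<T> u x \<bullet> broken_grad \<T> v x) +
    (LINT x|lebesgue_on \<Omega>. u x * v x)"
  unfolding volume_form_def using volume_form_integrable[OF assms] by simp

text \<open>The broken gradient is linear only up to null sets; integration turns this into an exact
  identity.\<close>

lemma volume_form_semi_inner:
  assumes "0 \<le> \<epsilon>"
  shows "semi_inner_on broken_space (volume_form \<epsilon>)"
proof
  fix u v z c assume X: "u \<in> broken_space" "v \<in> broken_space" "z \<in> broken_space"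
  have "(LINT x|lebesgue_on \<Omega>. broken_grad \<T> (\<lambda>x. u x + c * v x) x \<bullet> broken_grad \<T> z x) =
      (LINT x|lebesgue_on \<Omega>. broken_grad \<T> u x \<bullet> broken_grad \<T> z x + c * (broken_grad \<T> v x \<bullet> broken_grad \<T> z x))"
  proof (rule integral_cong_AE)
    show "AE x in lebesgue_on \<Omega>. broken_grad \<T> (\<lambda>x. u x + c * v x) x \<bullet> broken_grad \<T> z x =
        broken_grad \<T> u x \<bullet> broken_grad \<T> z x + c * (broken_grad \<T> v x \<bullet> broken_grad \<T> z x)"
      using broken_grad_lincomb[OF X(1,2), of c] by eventually_elim (simp add: inner_add_left)
  qed (use volume_form_integrable[OF broken_space_lincomb[OF X(1,2), of c] X(3)]
      volume_form_integrable[OF X(1,3)] volume_form_integrable[OF X(2,3)] in auto)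
  then show "volume_form \<epsilon> (\<lambda>x. u x + c * v x) z = volume_form \<epsilon> u z + c * volume_form \<epsilon> v z"
    using volume_form_integrable[OF X(1,3)] volume_form_integrable[OF X(2,3)]
    by (simp add: volume_form_eq X broken_space_lincomb algebra_simps)
next
  show "(\<lambda>x. u x + c * v x) \<in> broken_space" if "u \<in> broken_space" "v \<in> broken_space" for u v c
    using that by (rule broken_space_lincomb)
  show "volume_form \<epsilon> u v = volume_form \<epsilon> v u" for u v
    by (simp add: volume_form_def inner_commute mult.commute)
  show "0 \<le> volume_form \<epsilon> u u" for u
    unfolding volume_form_def using assms by (intro integral_nonneg_AE AE_I2) auto
qed

lemma jump_form_semi_inner:
  assumes "\<And>e. e \<in> edges \<Omega> \<T> \<Longrightarrow> 0 \<le> c e"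
  shows "semi_inner_on broken_space (jump_form c)"
proof
  fix u v z d assume X: "u \<in> broken_space" "v \<in> broken_space" "z \<in> broken_space"
  have "(LINT x|arc_length e. jump \<T> e (\<lambda>x. u x + d * v x) x \<bullet> jump \<T> e z x) =
      (LINT x|arc_length e. jump \<T> e u x \<bullet> jump \<T> e z x) + d * (LINT x|arc_length e. jump \<T> e v x \<bullet> jump \<T> e z x)"
    if e: "e \<in> edges \<Omega> \<T>" for e
  proof -
    note i = L2_inner_integrable[OF jump_L2[OF X(1) e] jump_L2[OF X(3) e]]
      L2_inner_integrable[OF jump_L2[OF X(2) e] jump_L2[OF X(3) e]]
      L2_inner_integrable[OF jump_L2[OF broken_space_lincomb[OF X(1,2), of d] e] jump_L2[OF X(3) e]]
    have "(LINT x|arc_length e. jump \<T> e (\<lambda>x. u x + d * v x) x \<bullet> jump \<T> e z x) =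
        (LINT x|arc_length e. jump \<T> e u x \<bullet> jump \<T> e z x + d * (jump \<T> e v x \<bullet> jump \<T> e z x))"
    proof (rule integral_cong_AE)
      show "AE x in arc_length e. jump \<T> e (\<lambda>x. u x + d * v x) x \<bullet> jump \<T> e z x =
          jump \<T> e u x \<bullet> jump \<T> e z x + d * (jump \<T> e v x \<bullet> jump \<T> e z x)"
        using jump_lincomb[OF X(1,2) e, of d] by eventually_elim (simp add: inner_add_left)
    qed (use i in auto)
    then show ?thesis using i by simp
  qed
  then show "jump_form c (\<lambda>x. u x + d * v x) z = jump_form c u z + d * jump_form c v z"
    unfolding jump_form_sum by (simp add: sum_distrib_left sum.distrib[symmetric] algebra_simps)
next
  show "(\<lambda>x. u x + c * v x) \<in> broken_space" if "u \<in> broken_space" "v \<in> broken_space" for u v c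
    using that by (rule broken_space_lincomb)
  show "jump_form c u v = jump_form c v u" for u v
    by (simp add: jump_form_def inner_commute)
  show "0 \<le> jump_form c u u" for u
    unfolding jump_form_sum using assms by (intro sum_nonneg mult_nonneg_nonneg integral_nonneg_AE AE_I2) auto
qed

lemma dg_jump_semi_inner:
  assumes "0 \<le> \<epsilon>"
  shows "semi_inner_on broken_space (jump_form (dg_weight p \<epsilon>))"
  by (rule jump_form_semi_inner) (use edge_sigma_nonneg assms in auto)

lemma DG_inner_semi_inner:
  assumes "0 \<le> \<epsilon>"
  shows "semi_inner_on broken_space (DG_inner \<Omega> \<T> p \<epsilon>)"
proof -
  interpret V: semi_inner_on broken_space "volume_form \<epsilon>" by (rule volume_form_semi_inner[OF assms])
  interpret J: semi_inner_on broken_space "jump_form (dg_weight p \<epsilon>)" by (rule dg_jump_semi_inner[OF assms])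
  show ?thesis
  proof
    show "DG_inner \<Omega> \<T> p \<epsilon> (\<lambda>x. u x + c * v x) z = DG_inner \<Omega> \<T> p \<epsilon> u z + c * DG_inner \<Omega> \<T> p \<epsilon> v z"
      if "u \<in> broken_space" "v \<in> broken_space" "z \<in> broken_space" for u v z c
      unfolding DG_inner_eq V.form_left[OF that] J.form_left[OF that] by (simp add: algebra_simps)
    show "DG_inner \<Omega> \<T> p \<epsilon> u v = DG_inner \<Omega> \<T> p \<epsilon> v u" for u v
      unfolding DG_inner_eq by (metis V.form_commute J.form_commute)
    show "0 \<le> DG_inner \<Omega> \<T> p \<epsilon> u u" if "u \<in> broken_space" for u
      unfolding DG_inner_eq using V.form_nonneg[OF that] J.form_nonneg[OF that] by simp
  qed (rule V.lincomb)
qed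

lemma jump_form_H10:
  assumes "u \<in> H10 \<Omega>"
  shows "jump_form c u v = 0"
proof -
  have "(LINT x|arc_length e. jump \<T> e u x \<bullet> jump \<T> e v x) = 0" if "e \<in> edges \<Omega> \<T>" for e
    using jump_H10[OF assms that] by (intro integral_eq_zero_AE) (auto elim: eventually_mono)
  then show ?thesis by (simp add: jump_form_sum)
qed

text \<open>Changing a function on a null set alters its weak gradients and its traces only on null
  sets, so the form does not distinguish representatives.\<close>

lemma DG_inner_null:
  assumes v: "v \<in> broken_space" and ae: "AE x in lebesgue_on \<Omega>. v x = 0"
  shows "DG_inner \<Omega> \<T> p \<epsilon> v v = 0"
proof -
  have z: "smooth (\<lambda>x::real^2. 0)" by (rule smooth_const)
  have ae_k: "AE x in lebesgue_on \<kappa>. v x = 0" if k: "\<kappa> \<in> \<T>" for \<kappa>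
    using element_properties(1)[OF k] element_subset[OF k]
    by (intro AE_lebesgue_on_subset[OF sets_dom _ _ ae]) auto
  have g: "grad (\<lambda>x::real^2. 0) x = 0" for x
    by (rule grad_eqI) simp
  have "AE x in lebesgue_on \<Omega>. broken_grad \<T> v x = 0"
  proof (rule AE_elementwise)
    fix \<kappa> assume k: "\<kappa> \<in> \<T>"
    interpret \<kappa>: open_bounded \<kappa> by (rule element_open_bounded[OF k])
    have "AE x in lebesgue_on \<kappa>. wgrad \<kappa> v x = wgrad \<kappa> (\<lambda>x. 0) x"
      by (rule \<kappa>.H1_cong_AE(2)[OF \<kappa>.H1_smooth(1)[OF z] L2_measurable[OF H1_L2[OF broken_space_H1[OF v k]]]])
        (use ae_k[OF k] in \<open>auto elim: eventually_mono\<close>)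
    moreover have "AE x in lebesgue_on \<kappa>. x \<in> \<kappa>" using AE_space[of "lebesgue_on \<kappa>"] by simp
    ultimately show "AE x in lebesgue_on \<kappa>. broken_grad \<T> v x = 0"
      using \<kappa>.H1_smooth(2)[OF z] by eventually_elim (simp add: broken_grad_element[OF k] g)
  qed
  with ae have "volume_form \<epsilon> v v = 0"
    unfolding volume_form_def by (intro integral_eq_zero_AE) (auto elim: eventually_elim2)
  moreover have "(LINT x|arc_length e. jump \<T> e v x \<bullet> jump \<T> e v x) = 0" if e: "e \<in> edges \<Omega> \<T>" for e
  proof -
    obtain a b where ce: "\<And>\<kappa>. \<kappa> \<in> edge_elements \<T> e \<Longrightarrow> convex_edge \<kappa> e a b"
      using edge_segment[OF e] by metis
    have "AE x in arc_length e. \<forall>\<kappa>\<in>edge_elements \<T> e. edge_trace \<kappa> e v x = 0"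
    proof (intro AE_finite_allI edge_elements_finite)
      fix \<kappa> assume k: "\<kappa> \<in> edge_elements \<T> e"
      then have k': "\<kappa> \<in> \<T>" by (simp add: edge_elements_def)
      interpret convex_edge \<kappa> e a b by (rule ce[OF k])
      show "AE x in arc_length e. edge_trace \<kappa> e v x = 0"
        by (rule edge_traceI(2)[OF broken_space_H1[OF v k'] is_trace_smooth[OF broken_space_H1[OF v k'] z ae_k[OF k']]])
    qed
    then show ?thesis
      by (intro integral_eq_zero_AE) (auto elim!: eventually_mono simp: jump_def)
  qed
  then have "jump_form (dg_weight p \<epsilon>) v v = 0" by (simp add: jump_form_sum)
  ultimately show ?thesis by (simp add: DG_inner_eq)
qed

lemma V_DG_lincomb:
  assumes "u \<in> V_DG \<Omega> \<T> \<Psi> p" "v \<in> V_DG \<Omega> \<T> \<Psi> p"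
  shows "(\<lambda>x. u x + c * v x) \<in> V_DG \<Omega> \<T> \<Psi> p"
  unfolding V_DG_def
proof (intro CollectI conjI ballI)
  show "(\<lambda>x. u x + c * v x) \<in> L2 (lebesgue_on \<Omega>)"
    using assms by (intro L2_add L2_cmult) (auto simp: V_DG_def)
  fix \<kappa> assume "\<kappa> \<in> \<T>"
  then obtain q r where q: "q \<in> tensor_polys (p \<kappa>)" "AE x in lebesgue_on ref_square. u (\<Psi> \<kappa> x) = q x"
    and r: "r \<in> tensor_polys (p \<kappa>)" "AE x in lebesgue_on ref_square. v (\<Psi> \<kappa> x) = r x"
    using assms by (fastforce simp: V_DG_def)
  obtain a b where "q = (\<lambda>x. \<Sum>i\<le>p \<kappa>. \<Sum>j\<le>p \<kappa>. a i j * (x $ 1)^i * (x $ 2)^j)"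
    "r = (\<lambda>x. \<Sum>i\<le>p \<kappa>. \<Sum>j\<le>p \<kappa>. b i j * (x $ 1)^i * (x $ 2)^j)"
    using q(1) r(1) by (auto simp: tensor_polys_def)
  then have "(\<lambda>x. q x + c * r x) = (\<lambda>x. \<Sum>i\<le>p \<kappa>. \<Sum>j\<le>p \<kappa>. (a i j + c * b i j) * (x $ 1)^i * (x $ 2)^j)"
    by (simp add: sum_distrib_left sum.distrib algebra_simps)
  then have "(\<lambda>x. q x + c * r x) \<in> tensor_polys (p \<kappa>)"
    unfolding tensor_polys_def by (intro CollectI exI)
  moreover have "AE x in lebesgue_on ref_square. u (\<Psi> \<kappa> x) + c * v (\<Psi> \<kappa> x) = q x + c * r x"
    using q(2) r(2) by eventually_elim simp
  ultimately show "\<exists>q\<in>tensor_polys (p \<kappa>). AE x in lebesgue_on ref_square. u (\<Psi> \<kappa> x) + c * v (\<Psi> \<kappa> x) = q x"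
    by (intro bexI[of _ "\<lambda>x. q x + c * r x"])
qed

text \<open>The constant 0 shows that \<open>V_DG \<inter> H10\<close> is nonempty; the constant 1
  is the nonzero test function for the case that \<open>u\<close> and \<open>w\<close>
  agree.\<close>

lemma const_V_DG: "(\<lambda>x. a) \<in> V_DG \<Omega> \<T> \<Psi> p"
proof -
  have "(\<lambda>x::real^2. a) = (\<lambda>x. \<Sum>i\<le>k. \<Sum>j\<le>k. (if i = 0 \<and> j = 0 then a else 0) * (x $ 1)^i * (x $ 2)^j)" for k
  proof
    fix x :: "real^2"
    have "(\<Sum>j\<le>k. (if i = 0 \<and> j = 0 then a else 0) * (x $ 1)^i * (x $ 2)^j) = (if i = 0 then a else 0)" for i
      by (subst sum.remove[of _ 0]) auto
    then show "a = (\<Sum>i\<le>k. \<Sum>j\<le>k. (if i = 0 \<and> j = 0 then a else 0) * (x $ 1)^i * (x $ 2)^j)"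
      by simp
  qed
  then have "(\<lambda>x. a) \<in> tensor_polys k" for k
    unfolding tensor_polys_def by (intro CollectI exI)
  moreover have "(\<lambda>x. a) \<in> L2 (lebesgue_on \<Omega>)"
    by (intro L2_smooth open_dom bounded_dom smooth_const)
  ultimately show ?thesis unfolding V_DG_def by auto
qed

text \<open>The separating functionals are the moments against the spanning functions of each
  element: if all of them vanish, the integral of \<open>z\<close> squared over an element is a
  combination of zeros.\<close>

lemma V_DG_projection:
  assumes eps: "0 \<le> \<epsilon>" and Z: "Z \<subseteq> V_DG \<Omega> \<T> \<Psi> p" "Z \<noteq> {}"
    "\<And>u v c. u \<in> Z \<Longrightarrow> v \<in> Z \<Longrightarrow> (\<lambda>x. u x + c * v x) \<in> Z" and v: "v \<in> V_DG \<Omega> \<T> \<Psi> p"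
  shows "\<exists>z\<in>Z. \<forall>y\<in>Z. DG_inner \<Omega> \<T> p \<epsilon> (\<lambda>x. v x + (- 1) * z x) y = 0"
proof -
  interpret semi_inner_on broken_space "DG_inner \<Omega> \<T> p \<epsilon>" by (rule DG_inner_semi_inner[OF eps])
  have "\<forall>\<kappa>\<in>\<T>. \<exists>m. (\<forall>i j. smooth (m i j)) \<and>
    (\<forall>v\<in>V_DG \<Omega> \<T> \<Psi> p. \<exists>c. AE y in lebesgue_on \<kappa>. v y = (\<Sum>i\<le>p \<kappa>. \<Sum>j\<le>p \<kappa>. c i j * m i j y))"
    using V_DG_element_basis[where \<Psi> = \<Psi>] element_affine by blast
  then obtain m where m: "\<And>\<kappa> i j. \<kappa> \<in> \<T> \<Longrightarrow> smooth (m \<kappa> i j)"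
    "\<And>\<kappa> v. \<kappa> \<in> \<T> \<Longrightarrow> v \<in> V_DG \<Omega> \<T> \<Psi> p \<Longrightarrow>
      \<exists>c. AE y in lebesgue_on \<kappa>. v y = (\<Sum>i\<le>p \<kappa>. \<Sum>j\<le>p \<kappa>. c i j * m \<kappa> i j y)"
    unfolding bchoice_iff by blast
  let ?J = "Sigma \<T> (\<lambda>\<kappa>. {..p \<kappa>} \<times> {..p \<kappa>})"
  define l where "l = (\<lambda>(\<kappa>, i, j) v. LINT y|lebesgue_on \<kappa>. v y * m \<kappa> i j y)"
  have L2k: "v \<in> L2 (lebesgue_on \<kappa>)" if "v \<in> V_DG \<Omega> \<T> \<Psi> p" "\<kappa> \<in> \<T>" for v \<kappa>
    using that V_DG_broken_space broken_space_H1 by (intro H1_L2) blast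
  have int: "integrable (lebesgue_on \<kappa>) (\<lambda>y. v y * m \<kappa> i j y)" if "v \<in> V_DG \<Omega> \<T> \<Psi> p" "\<kappa> \<in> \<T>" for v \<kappa> i j
    by (intro L2_mult_integrable L2k that L2_smooth element_properties m)
  show ?thesis
  proof (rule projection_exists[where J = ?J and l = l])
    show "finite ?J" using finite_elements by auto
    show "Z \<subseteq> broken_space" using Z(1) V_DG_broken_space by blast
    show "v \<in> broken_space" using v V_DG_broken_space by blast
    show "l j (\<lambda>x. u x + c * w x) = l j u + c * l j w" if J: "j \<in> ?J" and uw: "u \<in> Z" "w \<in> Z" for j u w c
    proof -
      obtain \<kappa> i i' where j: "j = (\<kappa>, i, i')" "\<kappa> \<in> \<T>" using J by auto
      have "u \<in> V_DG \<Omega> \<T> \<Psi> p" "w \<in> V_DG \<Omega> \<T> \<Psi> p" using uw Z(1) by auto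
      then show ?thesis
        using int[of u \<kappa> i i'] int[of w \<kappa> i i'] j(2)
        by (simp add: j l_def distrib_right mult.assoc)
    qed
    fix z assume z: "z \<in> Z" and l0: "\<And>j. j \<in> ?J \<Longrightarrow> l j z = 0"
    have zV: "z \<in> V_DG \<Omega> \<T> \<Psi> p" using z Z(1) by blast
    have "AE x in lebesgue_on \<Omega>. z x = 0"
    proof (rule AE_elementwise)
      fix \<kappa> assume k: "\<kappa> \<in> \<T>"
      obtain c where c: "AE y in lebesgue_on \<kappa>. z y = (\<Sum>i\<le>p \<kappa>. \<Sum>j\<le>p \<kappa>. c i j * m \<kappa> i j y)"
        using m(2)[OF k zV] by blast
      let ?r = "\<lambda>y. \<Sum>i\<le>p \<kappa>. \<Sum>j\<le>p \<kappa>. c i j * (z y * m \<kappa> i j y)"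
      have "(LINT y|lebesgue_on \<kappa>. (norm (z y))\<^sup>2) = (LINT y|lebesgue_on \<kappa>. ?r y)"
      proof (rule integral_cong_AE)
        show "AE y in lebesgue_on \<kappa>. (norm (z y))\<^sup>2 = ?r y"
          using c
        proof eventually_elim
          case (elim y)
          have "(norm (z y))\<^sup>2 = z y * (\<Sum>i\<le>p \<kappa>. \<Sum>j\<le>p \<kappa>. c i j * m \<kappa> i j y)"
            unfolding elim[symmetric] by (simp add: power2_eq_square)
          then show ?case by (simp add: sum_distrib_left mult.left_commute)
        qed
        show "?r \<in> borel_measurable (lebesgue_on \<kappa>)"
          using int[OF zV k] by (intro borel_measurable_sum borel_measurable_times borel_measurable_const borel_measurable_integrable) auto
      qed (use L2_integrable[OF L2k[OF zV k]] in auto)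
      also have "\<dots> = (\<Sum>i\<le>p \<kappa>. \<Sum>j\<le>p \<kappa>. c i j * l (\<kappa>, i, j) z)"
        using int[OF zV k] by (simp add: l_def)
      also have "\<dots> = 0" using l0 k by simp
      finally show "AE y in lebesgue_on \<kappa>. z y = 0"
        using integral_squared_eq_0_iff[OF L2k[OF zV k]] by blast
    qed
    then show "DG_inner \<Omega> \<T> p \<epsilon> z z = 0"
      using zV V_DG_broken_space by (intro DG_inner_null) auto
  qed (use Z in auto)
qed

lemma zero_H10: "(\<lambda>x. 0) \<in> H10 \<Omega>"
proof -
  have z: "smooth (\<lambda>x::real^2. 0)" by (rule smooth_const)
  have "(\<lambda>x. 0) \<in> test_functions \<Omega>"
    using z by (auto simp: test_functions_def intro: exI[of _ "{}"])
  moreover have "grad (\<lambda>x::real^2. 0) x = 0" for x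
    by (rule grad_eqI) simp
  then have "(H1_norm \<Omega> (\<lambda>x. 0))\<^sup>2 = 0" by (simp add: H1_smooth(3)[OF z])
  then have "H1_norm \<Omega> (\<lambda>x. 0 - 0) = 0" by simp
  ultimately show ?thesis
    unfolding H10_def using H1_smooth(1)[OF z] by (auto intro!: exI[of _ "\<lambda>n x. 0"])
qed

text \<open>The projection of the polynomial part onto \<open>V_DG \<inter> H10\<close> is moved to
  the conforming summand.\<close>

lemma W_DG_splitting:
  assumes eps: "0 \<le> \<epsilon>" and w: "w \<in> W_DG \<Omega> \<T> \<Psi> p"
  obtains w\<^sub>0 w\<^sub>1 where "w\<^sub>0 \<in> H10 \<Omega>" "w\<^sub>1 \<in> V_perp \<Omega> \<T> \<Psi> p \<epsilon>" "w = (\<lambda>x. w\<^sub>0 x + w\<^sub>1 x)"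
proof -
  obtain y v where yv: "w = (\<lambda>x. y x + v x)" "y \<in> H10 \<Omega>" "v \<in> V_DG \<Omega> \<T> \<Psi> p"
    using w by (auto simp: W_DG_def)
  let ?Z = "V_DG \<Omega> \<T> \<Psi> p \<inter> H10 \<Omega>"
  have "\<exists>z\<in>?Z. \<forall>y\<in>?Z. DG_inner \<Omega> \<T> p \<epsilon> (\<lambda>x. v x + (- 1) * z x) y = 0"
    using const_V_DG[of 0 p] zero_H10
    by (intro V_DG_projection eps yv) (auto intro: V_DG_lincomb H10_lincomb)
  then obtain z where z: "z \<in> ?Z" "\<forall>y\<in>?Z. DG_inner \<Omega> \<T> p \<epsilon> (\<lambda>x. v x + (- 1) * z x) y = 0" by blast
  show ?thesis
  proof (rule that)
    show "(\<lambda>x. y x + 1 * z x) \<in> H10 \<Omega>" using yv z by (intro H10_lincomb) auto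
    show "(\<lambda>x. v x + (- 1) * z x) \<in> V_perp \<Omega> \<T> \<Psi> p \<epsilon>"
      unfolding V_perp_def using z yv by (auto intro: V_DG_lincomb[of v p z "- 1", simplified])
    show "w = (\<lambda>x. (y x + 1 * z x) + (v x + (- 1) * z x))" unfolding yv by simp
  qed
qed

text \<open>Whatever splitting \<open>SOME\<close> selects, \<open>w - z\<close> equals
  \<open>w\<^sub>1 - I w\<^sub>1\<close>, and \<open>w\<^sub>1\<close> has the same jumps as
  \<open>w\<close>. Taken with the factors \<open>\<epsilon>\<close> and 1, the weights of the two
  averaging estimates add up to that of the DG norm.\<close>

lemma A_DG_properties:
  assumes eps: "0 \<le> \<epsilon>" and w: "w \<in> W_DG \<Omega> \<T> \<Psi> p" and I: "averaging_operator \<Omega> \<T> \<Psi> p C I"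
  defines "z \<equiv> A_DG \<Omega> \<T> \<Psi> p \<epsilon> I w"
  shows "z \<in> H10 \<Omega>"
    "volume_form \<epsilon> (\<lambda>x. w x - z x) (\<lambda>x. w x - z x) \<le> C * jump_form (dg_weight p \<epsilon>) w w"
proof -
  let ?P = "\<lambda>z. \<exists>w\<^sub>0 \<in> H10 \<Omega>. \<exists>w\<^sub>1 \<in> V_perp \<Omega> \<T> \<Psi> p \<epsilon>. w = (\<lambda>x. w\<^sub>0 x + w\<^sub>1 x) \<and> z = (\<lambda>x. w\<^sub>0 x + I w\<^sub>1 x)"
  have "\<exists>z. ?P z"
    using W_DG_splitting[OF eps w] by metis
  then have "?P z" unfolding z_def A_DG_def by (rule someI_ex)
  then obtain w\<^sub>0 w\<^sub>1 where *: "w\<^sub>0 \<in> H10 \<Omega>" "w\<^sub>1 \<in> V_perp \<Omega> \<T> \<Psi> p \<epsilon>"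
    "w = (\<lambda>x. w\<^sub>0 x + w\<^sub>1 x)" "z = (\<lambda>x. w\<^sub>0 x + I w\<^sub>1 x)" by blast
  then have V: "w\<^sub>1 \<in> V_DG \<Omega> \<T> \<Psi> p" by (simp add: V_perp_def)
  have Iw: "I w\<^sub>1 \<in> H10 \<Omega>" using I V by (auto simp: averaging_operator_def)
  show "z \<in> H10 \<Omega>" using H10_lincomb[OF *(1) Iw, of 1] by (simp add: *(4))
  have X: "w\<^sub>0 \<in> broken_space" "w\<^sub>1 \<in> broken_space" "I w\<^sub>1 \<in> broken_space"
    using *(1) V Iw H10_broken_space V_DG_broken_space by auto
  let ?d = "\<lambda>x. w\<^sub>1 x - I w\<^sub>1 x"
  have d: "?d \<in> broken_space" using broken_space_lincomb[OF X(2,3), of "- 1"] by simp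
  have "volume_form \<epsilon> ?d ?d = \<epsilon> * (L2_norm (lebesgue_on \<Omega>) (broken_grad \<T> ?d))\<^sup>2 + (L2_norm (lebesgue_on \<Omega>) ?d)\<^sup>2"
    unfolding volume_form_eq[OF d d] L2_norm_squared power2_norm_eq_inner by simp
  also have "\<dots> \<le> \<epsilon> * (C * jump_form (edge_sigma \<T> p) w\<^sub>1 w\<^sub>1) + C * jump_form (\<lambda>e. 1 / edge_sigma \<T> p e) w\<^sub>1 w\<^sub>1"
    using I V eps unfolding averaging_operator_def jump_form_def
    by (intro add_mono mult_left_mono) (auto simp: power2_norm_eq_inner)
  also have "\<dots> = C * jump_form (dg_weight p \<epsilon>) w\<^sub>1 w\<^sub>1"
    using jump_form_weight_add[of \<epsilon> "edge_sigma \<T> p" 1 "\<lambda>e. 1 / edge_sigma \<T> p e" w\<^sub>1 w\<^sub>1]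
    by (simp add: algebra_simps)
  also have "jump_form (dg_weight p \<epsilon>) w\<^sub>1 w\<^sub>1 = jump_form (dg_weight p \<epsilon>) w w"
  proof -
    interpret J: semi_inner_on broken_space "jump_form (dg_weight p \<epsilon>)"
      by (rule dg_jump_semi_inner[OF eps])
    show ?thesis
      using J.form_square[OF X(1,2), of 1] jump_form_H10[OF *(1)] by (simp add: *(3))
  qed
  finally show "volume_form \<epsilon> (\<lambda>x. w x - z x) (\<lambda>x. w x - z x) \<le> C * jump_form (dg_weight p \<epsilon>) w w"
    by (simp add: *(3,4))
qed

end

subsection \<open>The nonlinearity\<close>

text \<open>A fibre of \<open>K \<times> UNIV\<close> is a full line, so differentiability relative
  to this set gives a two-sided derivative in \<open>s\<close>, even over boundary points of
  \<open>K\<close>.\<close>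

lemma C1_on_section_derivative:
  fixes f :: "'a::real_normed_vector \<Rightarrow> real \<Rightarrow> real"
  assumes "C1_on (K \<times> UNIV) (\<lambda>(x, s). f x s)" "x \<in> K"
  shows "(f x has_real_derivative deriv (f x) s) (at s)"
proof -
  obtain D where D: "\<And>z. z \<in> K \<times> UNIV \<Longrightarrow>
      ((\<lambda>(x, s). f x s) has_derivative blinfun_apply (D z)) (at z within K \<times> UNIV)"
    using assms(1) by (auto simp: C1_on_def)
  have "((\<lambda>s. (x, s)) has_derivative (\<lambda>h. (0, h))) (at s)"
    by (auto intro!: derivative_eq_intros)
  then have "((\<lambda>s. case (x, s) of (x, s) \<Rightarrow> f x s) has_derivative (\<lambda>h. blinfun_apply (D (x, s)) (0, h))) (at s)"
    by (rule has_derivative_in_compose[OF _ has_derivative_subset[OF D]]) (use assms(2) in auto)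
  then have "f x differentiable at s"
    unfolding differentiable_def by auto
  then show ?thesis
    by (simp add: DERIV_deriv_iff_real_differentiable)
qed

lemma C1_on_continuous_on: "C1_on S g \<Longrightarrow> continuous_on S g"
  unfolding C1_on_def by (meson has_derivative_continuous_on)

lemma mean_value_deriv:
  fixes g :: "real \<Rightarrow> real"
  assumes "\<And>s. (g has_real_derivative deriv g s) (at s)"
  obtains r where "g s - g t = deriv g r * (s - t)"
proof (cases s t rule: linorder_cases)
  case less
  then obtain r where "g t - g s = (t - s) * deriv g r"
    using MVT2[of s t g "deriv g"] assms by blast
  then show ?thesis by (intro that[of r]) (simp add: algebra_simps)
next
  case greater
  then obtain r where "g s - g t = (s - t) * deriv g r"
    using MVT2[of t s g "deriv g"] assms by blast
  then show ?thesis by (intro that[of r]) (simp add: algebra_simps)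
qed (use that in auto)

text \<open>The growth is at most linear: \<open>f x 0\<close> is bounded on the compact closure,
  and the remainder is dominated by \<open>L\<close> times \<open>w\<close>.\<close>

lemma (in open_bounded) superposition_L2:
  fixes f :: "'a \<Rightarrow> real \<Rightarrow> real"
  assumes cont: "continuous_on (closure S \<times> UNIV) (\<lambda>(x, s). f x s)"
    and lip: "\<And>x s t. x \<in> closure S \<Longrightarrow> \<bar>f x s - f x t\<bar> \<le> L * \<bar>s - t\<bar>"
    and w: "w \<in> L2 (lebesgue_on S)"
  shows "(\<lambda>x. f x (w x)) \<in> L2 (lebesgue_on S)"
proof -
  interpret finite_measure "lebesgue_on S" by (rule finite_measure_open_bounded[OF open_dom bounded_dom])
  have sub: "x \<in> closure S" if "x \<in> space (lebesgue_on S)" for x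
    using that closure_subset[of S] by auto
  have meas: "(\<lambda>x. f x (v x)) \<in> borel_measurable (lebesgue_on S)"
    if v: "v \<in> borel_measurable (lebesgue_on S)" for v
  proof -
    \<comment> \<open>Extended by 0 off a closed set, \<open>f\<close> becomes a Borel function of
      the pair, which can be composed with the graph map of \<open>v\<close>.\<close>
    have "closed (closure S \<times> (UNIV :: real set))" by (intro closed_Times) auto
    then have "(\<lambda>z. indicator (closure S \<times> UNIV) z *\<^sub>R (case z of (x, s) \<Rightarrow> f x s)) \<in> borel_measurable borel"
      by (intro borel_measurable_continuous_on_indicator cont borel_closed)
    moreover have "(\<lambda>x. x) \<in> borel_measurable (lebesgue_on S)"
      by (intro continuous_imp_measurable_on_sets_lebesgue sets_dom continuous_on_id)
    then have "(\<lambda>x. (x, v x)) \<in> lebesgue_on S \<rightarrow>\<^sub>M borel"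
      using v by (intro borel_measurable_Pair)
    ultimately have "(\<lambda>x. indicator (closure S \<times> UNIV) (x, v x) *\<^sub>R (case (x, v x) of (x, s) \<Rightarrow> f x s)) \<in> borel_measurable (lebesgue_on S)"
      by (rule measurable_compose[rotated])
    then show ?thesis
      by (subst measurable_cong[where g = "\<lambda>x. indicator (closure S \<times> UNIV) (x, v x) *\<^sub>R (case (x, v x) of (x, s) \<Rightarrow> f x s)"])
        (use sub in auto)
  qed
  have "compact ((\<lambda>x. f x 0) ` closure S)"
  proof (rule compact_continuous_image)
    show "continuous_on (closure S) (\<lambda>x. f x 0)"
    proof -
      have "continuous_on (closure S) (\<lambda>x. case (x, 0) of (x, s) \<Rightarrow> f x s)"
        by (rule continuous_on_compose2[OF cont]) (auto intro!: continuous_intros)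
      then show ?thesis by simp
    qed
  qed (use bounded_dom in simp)
  then obtain C where "\<And>x. x \<in> closure S \<Longrightarrow> norm (f x 0) \<le> C"
    using compact_imp_bounded by (fastforce simp: bounded_iff)
  then have 0: "(\<lambda>x. f x 0) \<in> L2 (lebesgue_on S)"
    using sub by (intro L2_bounded meas) auto
  have "(\<lambda>x. f x (w x) - f x 0) \<in> L2 (lebesgue_on S)"
  proof (rule L2_dominated[OF _ w, of _ L])
    show "(\<lambda>x. f x (w x) - f x 0) \<in> borel_measurable (lebesgue_on S)"
      by (intro borel_measurable_diff meas L2_measurable[OF w]) auto
    show "AE x in lebesgue_on S. norm (f x (w x) - f x 0) \<le> L * norm (w x)"
    proof (intro AE_I2)
      fix x assume "x \<in> space (lebesgue_on S)"
      then show "norm (f x (w x) - f x 0) \<le> L * norm (w x)"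
        using lip[OF sub, of x "w x" 0] by simp
    qed
  qed
  from L2_add[OF this 0] show ?thesis by simp
qed

subsection \<open>The residual\<close>

context parallelogram_mesh
begin

text \<open>Cauchy-Schwarz for the form contributes the 1. The \<open>L\<close> arises because the
  L2 norm is dominated by the square root of the volume form.\<close>

lemma volume_form_perturbed_le:
  assumes eps: "0 \<le> \<epsilon>" and L: "0 \<le> L" and v: "v \<in> broken_space" and z: "z \<in> broken_space"
    and d: "d \<in> L2 (lebesgue_on \<Omega>)" "AE x in lebesgue_on \<Omega>. \<bar>d x\<bar> \<le> L * \<bar>v x\<bar>"
  shows "\<bar>volume_form \<epsilon> v z - (LINT x|lebesgue_on \<Omega>. d x * z x)\<bar> \<le>
    (1 + L) * (sqrt (volume_form \<epsilon> v v) * sqrt (volume_form \<epsilon> z z))"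
proof -
  interpret V: semi_inner_on broken_space "volume_form \<epsilon>" by (rule volume_form_semi_inner[OF eps])
  have N: "L2_norm (lebesgue_on \<Omega>) y \<le> sqrt (volume_form \<epsilon> y y)" if "y \<in> broken_space" for y
    unfolding L2_norm_def volume_form_eq[OF that that]
    by (intro real_sqrt_le_mono) (use eps in \<open>simp add: power2_eq_square\<close>)
  have "(L2_norm (lebesgue_on \<Omega>) d)\<^sup>2 \<le> (LINT x|lebesgue_on \<Omega>. L\<^sup>2 * (norm (v x))\<^sup>2)"
    unfolding L2_norm_squared
  proof (rule integral_mono_AE)
    show "AE x in lebesgue_on \<Omega>. (norm (d x))\<^sup>2 \<le> L\<^sup>2 * (norm (v x))\<^sup>2"
      using d(2)
    proof eventually_elim
      case (elim x)
      from power_mono[OF this, of 2] show ?case by (simp add: power_mult_distrib)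
    qed
  qed (use L2_integrable[OF d(1)] L2_integrable[OF broken_space_L2[OF v]] in auto)
  also have "\<dots> = (L * L2_norm (lebesgue_on \<Omega>) v)\<^sup>2"
    by (simp add: power_mult_distrib L2_norm_squared)
  finally have "L2_norm (lebesgue_on \<Omega>) d \<le> L * L2_norm (lebesgue_on \<Omega>) v"
    by (rule power2_le_imp_le) (intro mult_nonneg_nonneg L L2_norm_nonneg)
  also have "\<dots> \<le> L * sqrt (volume_form \<epsilon> v v)"
    by (intro mult_left_mono N v L)
  finally have dn: "L2_norm (lebesgue_on \<Omega>) d \<le> L * sqrt (volume_form \<epsilon> v v)" .
  have "\<bar>LINT x|lebesgue_on \<Omega>. d x * z x\<bar> \<le> L2_norm (lebesgue_on \<Omega>) d * L2_norm (lebesgue_on \<Omega>) z"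
    using L2_Cauchy_Schwarz[OF d(1) broken_space_L2[OF z]] by simp
  also have "\<dots> \<le> (L * sqrt (volume_form \<epsilon> v v)) * sqrt (volume_form \<epsilon> z z)"
    by (intro mult_mono dn N z L2_norm_nonneg mult_nonneg_nonneg L) (simp add: V.form_nonneg v)
  finally have "\<bar>LINT x|lebesgue_on \<Omega>. d x * z x\<bar> \<le> L * (sqrt (volume_form \<epsilon> v v) * sqrt (volume_form \<epsilon> z z))"
    by simp
  with V.form_Cauchy_Schwarz[OF v z] show ?thesis
    by (simp add: distrib_right)
qed

lemma residual_eq:
  fixes f w u p \<epsilon>
  defines "v \<equiv> \<lambda>x. w x - u x" and "d \<equiv> \<lambda>x. f x (w x) - f x (u x)"
  assumes eps: "0 \<le> \<epsilon>" and I: "averaging_operator \<Omega> \<T> \<Psi> p C I"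
    and u: "weak_solution \<Omega> \<epsilon> f u" and w: "w \<in> broken_space" and \<phi>: "\<phi> \<in> W_DG \<Omega> \<T> \<Psi> p"
    and f: "(\<lambda>x. f x (w x)) \<in> L2 (lebesgue_on \<Omega>)" "(\<lambda>x. f x (u x)) \<in> L2 (lebesgue_on \<Omega>)"
  shows "residual \<Omega> \<T> \<Psi> p \<epsilon> I f C\<^sub>\<sigma> w \<phi> =
    volume_form \<epsilon> v (A_DG \<Omega> \<T> \<Psi> p \<epsilon> I \<phi>) - (LINT x|lebesgue_on \<Omega>. d x * A_DG \<Omega> \<T> \<Psi> p \<epsilon> I \<phi> x) +
    C\<^sub>\<sigma> * jump_form (dg_weight p \<epsilon>) v \<phi>"
proof -
  interpret J: semi_inner_on broken_space "jump_form (dg_weight p \<epsilon>)" by (rule dg_jump_semi_inner[OF eps])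
  define z where "z = A_DG \<Omega> \<T> \<Psi> p \<epsilon> I \<phi>"
  have z: "z \<in> H10 \<Omega>" unfolding z_def by (rule A_DG_properties(1)[OF eps \<phi> I])
  have u0: "u \<in> H10 \<Omega>" using u by (simp add: weak_solution_def)
  have X: "u \<in> broken_space" "z \<in> broken_space" "\<phi> \<in> broken_space"
    using u0 z \<phi> H10_broken_space W_DG_broken_space by auto
  have vX: "v \<in> broken_space" unfolding v_def using broken_space_lincomb[OF w X(1), of "- 1"] by simp
  have jw: "jump_form (dg_weight p \<epsilon>) w \<phi> = jump_form (dg_weight p \<epsilon>) v \<phi>"
    unfolding v_def using J.form_left[OF w X(1,3), of "- 1"] jump_form_H10[OF u0] by simp
  have gw: "broken_grad \<T> w \<in> L2 (lebesgue_on \<Omega>)" by (rule broken_space_grad_L2[OF w])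
  have gu: "wgrad \<Omega> u \<in> L2 (lebesgue_on \<Omega>)" by (rule wgrad_L2[OF H10_H1[OF u0]])
  have gz: "wgrad \<Omega> z \<in> L2 (lebesgue_on \<Omega>)" by (rule wgrad_L2[OF H10_H1[OF z]])
  note zL = broken_space_L2[OF X(2)]
  note i = L2_inner_integrable[OF gw gz] L2_inner_integrable[OF gu gz]
    L2_mult_integrable[OF broken_space_L2[OF w] zL] L2_mult_integrable[OF broken_space_L2[OF X(1)] zL]
    L2_mult_integrable[OF f(1) zL] L2_mult_integrable[OF f(2) zL]
    volume_form_integrable[OF vX X(2)]
  let ?F = "\<lambda>x. \<epsilon> * (broken_grad \<T> w x \<bullet> wgrad \<Omega> z x) + w x * z x - f x (w x) * z x"
  let ?G = "\<lambda>x. \<epsilon> * (wgrad \<Omega> u x \<bullet> wgrad \<Omega> z x) + u x * z x - f x (u x) * z x"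
  let ?H = "\<lambda>x. \<epsilon> * (broken_grad \<T> v x \<bullet> broken_grad \<T> z x) + v x * z x - d x * z x"
  have iF: "integrable (lebesgue_on \<Omega>) ?F" and iG: "integrable (lebesgue_on \<Omega>) ?G"
    using i by auto
  have iH: "integrable (lebesgue_on \<Omega>) ?H"
    using i L2_mult_integrable[OF L2_diff[OF f] zL] by (simp add: d_def)
  \<comment> \<open>The weak equation tested with \<open>z\<close> says that \<open>?G\<close>
    integrates to zero, so it may be subtracted.\<close>
  have "(LINT x|lebesgue_on \<Omega>. ?F x) = (LINT x|lebesgue_on \<Omega>. ?F x) - (LINT x|lebesgue_on \<Omega>. ?G x)"
    using u z by (simp add: weak_solution_def)
  also have "\<dots> = (LINT x|lebesgue_on \<Omega>. ?F x - ?G x)"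
    by (rule Bochner_Integration.integral_diff[symmetric, OF iF iG])
  also have "\<dots> = (LINT x|lebesgue_on \<Omega>. ?H x)"
  \<comment> \<open>The residual and the weak equation involve \<open>wgrad \<Omega>\<close>, the
    volume form broken gradients; for functions in H^1 of the domain they agree almost
    everywhere.\<close>
  proof (rule integral_cong_AE)
    show "AE x in lebesgue_on \<Omega>. ?F x - ?G x = ?H x"
      using broken_grad_lincomb[OF w X(1), of "- 1"] broken_grad_H1[OF H10_H1[OF u0]] broken_grad_H1[OF H10_H1[OF z]]
    proof eventually_elim
      case (elim x)
      have gv: "broken_grad \<T> v x = broken_grad \<T> w x - wgrad \<Omega> u x"
        using elim(1,2) by (simp add: v_def)
      have vx: "v x = w x - u x" by (simp add: v_def)
      show ?case
        unfolding gv vx elim(3) d_def by (simp add: inner_diff_left algebra_simps)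
    qed
  qed (use iF iG iH in auto)
  also have "\<dots> = volume_form \<epsilon> v z - (LINT x|lebesgue_on \<Omega>. d x * z x)"
    unfolding volume_form_def using i L2_mult_integrable[OF L2_diff[OF f] zL] by (simp add: d_def)
  finally show ?thesis
    by (simp add: residual_def Let_def z_def[symmetric] jw[symmetric]) (simp add: jump_form_def)
qed

end

subsection \<open>The two-sided bound\<close>

theorem proposition4p1:
  fixes \<epsilon> \<theta> \<rho>\<^sub>1 \<rho>\<^sub>2 C\<^sub>A C\<^sub>s\<^sub>t\<^sub>a\<^sub>b C\<^sub>\<sigma> \<rho>\<^sub>0 L c\<^sub>0 :: real
    and \<Omega> :: "(real^2) set"
    and \<T> :: "(real^2) set set"
    and \<Psi> :: "(real^2) set \<Rightarrow> real^2 \<Rightarrow> real^2"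
    and p :: "(real^2) set \<Rightarrow> nat"
    and I\<^sub>h\<^sub>p :: "(real^2 \<Rightarrow> real) \<Rightarrow> (real^2 \<Rightarrow> real)"
    and f :: "real^2 \<Rightarrow> real \<Rightarrow> real"
    and u :: "real^2 \<Rightarrow> real"
  assumes eps: "0 < \<epsilon>" "\<epsilon> \<le> 1"
    and domain: "lipschitz_domain \<Omega>"
    and mesh: "admissible_mesh \<Omega> \<T> \<Psi> \<theta> \<rho>\<^sub>1"
    and degrees: "admissible_degrees \<Omega> \<T> p \<rho>\<^sub>2"
    and averaging: "0 < C\<^sub>A" "averaging_operator \<Omega> \<T> \<Psi> p C\<^sub>A I\<^sub>h\<^sub>p"
    and C_stab: "C\<^sub>s\<^sub>t\<^sub>a\<^sub>b = sqrt (2 * max 1 C\<^sub>A)"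
    and f_C1: "C1_on (closure \<Omega> \<times> UNIV) (\<lambda>(x, s). f x s)"
    and f_bounds: "- 1 < \<rho>\<^sub>0" "0 \<le> L"
      "\<And>x s. x \<in> closure \<Omega> \<Longrightarrow> \<rho>\<^sub>0 \<le> - deriv (f x) s"
      "\<And>x s. x \<in> closure \<Omega> \<Longrightarrow> \<bar>deriv (f x) s\<bar> \<le> L"
    and c0: "c\<^sub>0 = 1 + min 0 \<rho>\<^sub>0"
    and penalty: "0 \<le> C\<^sub>\<sigma>" "c\<^sub>0 / 2 + C\<^sub>A * (1 + L)\<^sup>2 / (2 * c\<^sub>0) \<le> C\<^sub>\<sigma>"
    and solution: "weak_solution \<Omega> \<epsilon> f u"
  shows "\<forall>w \<in> W_DG \<Omega> \<T> \<Psi> p.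
    ereal (c\<^sub>0 / 2 * DG_norm \<Omega> \<T> p \<epsilon> (\<lambda>x. u x - w x))
      \<le> residual_norm \<Omega> \<T> \<Psi> p \<epsilon> I\<^sub>h\<^sub>p f C\<^sub>\<sigma> w \<and>
    residual_norm \<Omega> \<T> \<Psi> p \<epsilon> I\<^sub>h\<^sub>p f C\<^sub>\<sigma> w
      \<le> ereal (sqrt 2 * max (C\<^sub>s\<^sub>t\<^sub>a\<^sub>b * (1 + L)) C\<^sub>\<sigma> * DG_norm \<Omega> \<T> p \<epsilon> (\<lambda>x. u x - w x))"
proof
  fix w assume w: "w \<in> W_DG \<Omega> \<T> \<Psi> p"
  interpret parallelogram_mesh \<Omega> \<T> \<Psi>
    using domain mesh by unfold_locales (auto simp: lipschitz_domain_def admissible_mesh_def)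
  have eps0: "0 \<le> \<epsilon>" using eps by simp
  interpret V: semi_inner_on broken_space "volume_form \<epsilon>" by (rule volume_form_semi_inner[OF eps0])
  interpret J: semi_inner_on broken_space "jump_form (dg_weight p \<epsilon>)" by (rule dg_jump_semi_inner[OF eps0])
  interpret D: semi_inner_on broken_space "DG_inner \<Omega> \<T> p \<epsilon>" by (rule DG_inner_semi_inner[OF eps0])
  let ?A = "A_DG \<Omega> \<T> \<Psi> p \<epsilon> I\<^sub>h\<^sub>p" and ?J = "jump_form (dg_weight p \<epsilon>)" and ?E = "volume_form \<epsilon>"
  let ?R = "residual \<Omega> \<T> \<Psi> p \<epsilon> I\<^sub>h\<^sub>p f C\<^sub>\<sigma> w" and ?N = "DG_norm \<Omega> \<T> p \<epsilon>"
  define v where "v = (\<lambda>x. w x - u x)"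
  define d where "d = (\<lambda>x. f x (w x) - f x (u x))"
  have u0: "u \<in> H10 \<Omega>" using solution by (simp add: weak_solution_def)
  have X: "w \<in> broken_space" "u \<in> broken_space"
    using w u0 W_DG_broken_space H10_broken_space by auto
  have vX: "v \<in> broken_space"
    using broken_space_lincomb[OF X, of "- 1"] by (simp add: v_def)
  \<comment> \<open>The error is going to be a test function itself; \<open>u\<close> is absorbed
    into the conforming summand of \<open>w\<close>.\<close>
  have vW: "v \<in> W_DG \<Omega> \<T> \<Psi> p"
  proof -
    obtain w\<^sub>0 y where y: "w = (\<lambda>x. w\<^sub>0 x + y x)" "w\<^sub>0 \<in> H10 \<Omega>" "y \<in> V_DG \<Omega> \<T> \<Psi> p"
      using w by (auto simp: W_DG_def)
    have "(\<lambda>x. w\<^sub>0 x + (- 1) * u x) \<in> H10 \<Omega>" by (rule H10_lincomb[OF y(2) u0])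
    moreover have "v = (\<lambda>x. (w\<^sub>0 x + (- 1) * u x) + y x)" by (simp add: v_def y(1) fun_eq_iff)
    ultimately show ?thesis
      using y(3) unfolding W_DG_def mem_Collect_eq
      by (intro exI[of _ "\<lambda>x. w\<^sub>0 x + (- 1) * u x"] exI[of _ y] conjI)
  qed
  have N2: "?N y = sqrt (?E y y + ?J y y)" for y
    by (simp add: DG_norm_def DG_inner_eq)
  have Nsq: "(?N y)\<^sup>2 = ?E y y + ?J y y" and N0: "0 \<le> ?N y" if "y \<in> broken_space" for y
    using V.form_nonneg[OF that] J.form_nonneg[OF that] by (simp_all add: N2)
  \<comment> \<open>For \<open>c = - 2\<close> the combination \<open>v + c * v\<close> is
    \<open>- v = u - w\<close>, and \<open>1 + 2 * c + c^2 = 1\<close>.\<close>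
  have Nuw: "?N (\<lambda>x. u x - w x) = ?N v"
    using D.form_square[OF vX vX, of "- 2"] by (simp add: DG_norm_def v_def)

  \<comment> \<open>Bounds on the nonlinearity and the residual identity\<close>
  have der: "(f x has_real_derivative deriv (f x) s) (at s)" if "x \<in> closure \<Omega>" for x s
    by (rule C1_on_section_derivative[OF f_C1 that])
  have lip: "\<bar>f x s - f x t\<bar> \<le> L * \<bar>s - t\<bar>" if x: "x \<in> closure \<Omega>" for x s t
  proof -
    obtain r where "f x s - f x t = deriv (f x) r * (s - t)"
      using mean_value_deriv[OF der[OF x]] .
    then show ?thesis using f_bounds(4)[OF x, of r] by (simp add: abs_mult mult_right_mono)
  qed
  have mono: "(f x s - f x t) * (s - t) \<le> - \<rho>\<^sub>0 * (s - t)\<^sup>2" if x: "x \<in> closure \<Omega>" for x s t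
  proof -
    obtain r where "f x s - f x t = deriv (f x) r * (s - t)"
      using mean_value_deriv[OF der[OF x]] .
    then have "(f x s - f x t) * (s - t) = deriv (f x) r * (s - t)\<^sup>2"
      by (simp add: power2_eq_square)
    also have "\<dots> \<le> - \<rho>\<^sub>0 * (s - t)\<^sup>2"
      using f_bounds(3)[OF x, of r] by (intro mult_right_mono) auto
    finally show ?thesis .
  qed
  have f_L2: "(\<lambda>x. f x (y x)) \<in> L2 (lebesgue_on \<Omega>)" if "y \<in> broken_space" for y
    by (rule superposition_L2[OF C1_on_continuous_on[OF f_C1] lip broken_space_L2[OF that]])
  have dL: "d \<in> L2 (lebesgue_on \<Omega>)"
    unfolding d_def by (intro L2_diff f_L2 X)
  have d_le: "AE x in lebesgue_on \<Omega>. \<bar>d x\<bar> \<le> L * \<bar>v x\<bar>"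
    using closure_subset[of \<Omega>] by (intro AE_I2) (auto simp: d_def v_def intro!: lip)
  have R: "?R \<phi> = ?E v (?A \<phi>) - (LINT x|lebesgue_on \<Omega>. d x * ?A \<phi> x) + C\<^sub>\<sigma> * ?J v \<phi>"
    if "\<phi> \<in> W_DG \<Omega> \<T> \<Psi> p" for \<phi>
    using residual_eq[OF eps0 averaging(2) solution X(1) that f_L2[OF X(1)] f_L2[OF X(2)]]
    by (simp add: v_def d_def)

  \<comment> \<open>Upper bound: continuity of the residual\<close>
  let ?M = "max (C\<^sub>s\<^sub>t\<^sub>a\<^sub>b * (1 + L)) C\<^sub>\<sigma>"
  have upper: "\<bar>?R \<phi>\<bar> \<le> (sqrt 2 * ?M * ?N v) * ?N \<phi>" if \<phi>: "\<phi> \<in> W_DG \<Omega> \<T> \<Psi> p" for \<phi>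
  proof -
    let ?z = "?A \<phi>"
    note A = A_DG_properties[OF eps0 \<phi> averaging(2)]
    have \<phi>X: "\<phi> \<in> broken_space" using \<phi> W_DG_broken_space by blast
    have zX: "?z \<in> broken_space" using A(1) H10_broken_space by blast
    have yX: "(\<lambda>x. \<phi> x - ?z x) \<in> broken_space" using broken_space_lincomb[OF \<phi>X zX, of "- 1"] by simp
    \<comment> \<open>\<open>?z\<close> is \<open>\<phi>\<close> minus the averaging error; the
      factor 2 and the maximum of 1 and \<open>C\<^sub>A\<close> make up the square of
      \<open>C\<^sub>s\<^sub>t\<^sub>a\<^sub>b\<close>.\<close>
    have "?E ?z ?z \<le> 2 * ?E \<phi> \<phi> + 2 * ?E (\<lambda>x. \<phi> x - ?z x) (\<lambda>x. \<phi> x - ?z x)"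
      using V.form_square_le[OF \<phi>X yX, of "- 1"] by simp
    also have "\<dots> \<le> 2 * ?E \<phi> \<phi> + 2 * (C\<^sub>A * ?J \<phi> \<phi>)"
      using A(2) by simp
    also have "\<dots> \<le> 2 * (max 1 C\<^sub>A * ?E \<phi> \<phi>) + 2 * (max 1 C\<^sub>A * ?J \<phi> \<phi>)"
      using mult_right_mono[OF max.cobounded1 V.form_nonneg[OF \<phi>X], of 1 C\<^sub>A]
        mult_right_mono[OF max.cobounded2 J.form_nonneg[OF \<phi>X], of C\<^sub>A 1] by simp
    also have "\<dots> = (C\<^sub>s\<^sub>t\<^sub>a\<^sub>b * ?N \<phi>)\<^sup>2"
      by (simp add: C_stab power_mult_distrib Nsq[OF \<phi>X] algebra_simps)
    finally have "sqrt (?E ?z ?z) \<le> C\<^sub>s\<^sub>t\<^sub>a\<^sub>b * ?N \<phi>"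
      by (intro real_le_lsqrt) (use C_stab N0[OF \<phi>X] in auto)
    have E0: "0 \<le> sqrt (?E v v)" and J0: "0 \<le> sqrt (?J v v)"
      using V.form_nonneg[OF vX] J.form_nonneg[OF vX] by auto
    have "\<bar>?E v ?z - (LINT x|lebesgue_on \<Omega>. d x * ?z x)\<bar> \<le> (1 + L) * (sqrt (?E v v) * sqrt (?E ?z ?z))"
      by (rule volume_form_perturbed_le[OF eps0 f_bounds(2) vX zX dL d_le])
    also have "\<dots> \<le> (1 + L) * (sqrt (?E v v) * (C\<^sub>s\<^sub>t\<^sub>a\<^sub>b * ?N \<phi>))"
      using f_bounds(2) E0 \<open>sqrt (?E ?z ?z) \<le> C\<^sub>s\<^sub>t\<^sub>a\<^sub>b * ?N \<phi>\<close> by (intro mult_left_mono) auto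
    also have "\<dots> = (C\<^sub>s\<^sub>t\<^sub>a\<^sub>b * (1 + L)) * (sqrt (?E v v) * ?N \<phi>)" by (simp add: algebra_simps)
    also have "\<dots> \<le> ?M * (sqrt (?E v v) * ?N \<phi>)"
      using E0 N0[OF \<phi>X] by (intro mult_right_mono) auto
    finally have 1: "\<bar>?E v ?z - (LINT x|lebesgue_on \<Omega>. d x * ?z x)\<bar> \<le> ?M * (sqrt (?E v v) * ?N \<phi>)" .
    have "\<bar>C\<^sub>\<sigma> * ?J v \<phi>\<bar> = C\<^sub>\<sigma> * \<bar>?J v \<phi>\<bar>" using penalty(1) by (simp add: abs_mult)
    also have "\<dots> \<le> C\<^sub>\<sigma> * (sqrt (?J v v) * sqrt (?J \<phi> \<phi>))"
      by (intro mult_left_mono J.form_Cauchy_Schwarz vX \<phi>X penalty)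
    also have "\<dots> \<le> ?M * (sqrt (?J v v) * ?N \<phi>)"
      using V.form_nonneg[OF \<phi>X] J.form_nonneg[OF \<phi>X] J0 penalty(1)
      by (intro mult_mono mult_left_mono) (auto simp: N2)
    finally have 2: "\<bar>C\<^sub>\<sigma> * ?J v \<phi>\<bar> \<le> ?M * (sqrt (?J v v) * ?N \<phi>)" .
    \<comment> \<open>The source of the factor sqrt 2: volume and jump terms were estimated
      separately and are recombined into one norm.\<close>
    have "(sqrt (?E v v) + sqrt (?J v v))\<^sup>2 \<le> 2 * (?E v v + ?J v v)"
      using sum_squares_bound[of "sqrt (?E v v)" "sqrt (?J v v)"] V.form_nonneg[OF vX] J.form_nonneg[OF vX]
      by (simp add: power2_sum)
    then have "sqrt (?E v v) + sqrt (?J v v) \<le> sqrt (2 * (?E v v + ?J v v))"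
      by (rule real_le_rsqrt)
    also have "\<dots> = sqrt 2 * ?N v" by (simp only: real_sqrt_mult N2)
    finally have 3: "sqrt (?E v v) + sqrt (?J v v) \<le> sqrt 2 * ?N v" .
    have "\<bar>?R \<phi>\<bar> \<le> ?M * (sqrt (?E v v) * ?N \<phi>) + ?M * (sqrt (?J v v) * ?N \<phi>)"
      unfolding R[OF \<phi>] using 1 2 by linarith
    also have "\<dots> = ?M * ((sqrt (?E v v) + sqrt (?J v v)) * ?N \<phi>)" by (simp add: algebra_simps)
    also have "\<dots> \<le> ?M * ((sqrt 2 * ?N v) * ?N \<phi>)"
      using penalty(1) by (intro mult_left_mono mult_right_mono 3 N0[OF \<phi>X]) auto
    finally show ?thesis by (simp add: algebra_simps)
  qed

  \<comment> \<open>Lower bound: testing with the error\<close>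
  have c0_pos: "0 < c\<^sub>0" using f_bounds(1) by (simp add: c0)
  have lower: "c\<^sub>0 / 2 * (?N v)\<^sup>2 \<le> ?R v"
  proof -
    let ?z = "?A v" and ?y = "\<lambda>x. v x - ?A v x"
    note A = A_DG_properties[OF eps0 vW averaging(2)]
    have zX: "?z \<in> broken_space" using A(1) H10_broken_space by blast
    have yX: "?y \<in> broken_space" using broken_space_lincomb[OF vX zX, of "- 1"] by simp
    have E0: "0 \<le> ?E v v" and J0: "0 \<le> ?J v v"
      using V.form_nonneg[OF vX] J.form_nonneg[OF vX] by auto
    note L = broken_space_L2[OF vX] broken_space_L2[OF zX]
    have i: "integrable (lebesgue_on \<Omega>) (\<lambda>x. d x * v x)" "integrable (lebesgue_on \<Omega>) (\<lambda>x. d x * ?z x)"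
      "integrable (lebesgue_on \<Omega>) (\<lambda>x. v x * v x)"
      by (intro L2_mult_integrable dL L)+
    have "(LINT x|lebesgue_on \<Omega>. d x * v x) \<le> (LINT x|lebesgue_on \<Omega>. - \<rho>\<^sub>0 * (v x * v x))"
    proof (rule integral_mono[OF i(1)])
      show "d x * v x \<le> - \<rho>\<^sub>0 * (v x * v x)" if "x \<in> space (lebesgue_on \<Omega>)" for x
        using mono[of x "w x" "u x"] that closure_subset[of \<Omega>] by (auto simp: d_def v_def power2_eq_square)
    qed (use i(3) in auto)
    also have "\<dots> = - \<rho>\<^sub>0 * (LINT x|lebesgue_on \<Omega>. v x * v x)" by simp
    finally have dv: "(LINT x|lebesgue_on \<Omega>. d x * v x) \<le> - \<rho>\<^sub>0 * (LINT x|lebesgue_on \<Omega>. v x * v x)" .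
    let ?I = "LINT x|lebesgue_on \<Omega>. v x * v x"
    have I: "0 \<le> ?I" "?I \<le> ?E v v"
      using eps0 by (auto simp: volume_form_eq[OF vX vX])
    \<comment> \<open>\<open>\<rho>\<^sub>0\<close> multiplies only the zeroth-order part
      \<open>?I\<close> of the volume form. If negative, the estimate enlarges this part to all of
      \<open>?E v v\<close>; otherwise its contribution is dropped. This explains the minimum in
      \<open>c\<^sub>0\<close>.\<close>
    have "c\<^sub>0 * ?E v v \<le> ?E v v + \<rho>\<^sub>0 * ?I"
    proof (cases "\<rho>\<^sub>0 \<ge> 0")
      case True
      then show ?thesis using I by (simp add: c0)
    next
      case False
      then have "\<rho>\<^sub>0 * ?E v v \<le> \<rho>\<^sub>0 * ?I" using I(2) by (intro mult_left_mono_neg) auto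
      then show ?thesis using False by (simp add: c0 algebra_simps)
    qed
    then have main: "c\<^sub>0 * ?E v v \<le> ?E v v - (LINT x|lebesgue_on \<Omega>. d x * v x)" using dv by simp
    \<comment> \<open>\<open>A_DG v\<close> is \<open>v\<close> minus the averaging error
      \<open>?y\<close>, which separates the coercive term from the perturbation.\<close>
    have split: "?E v ?z - (LINT x|lebesgue_on \<Omega>. d x * ?z x) =
        (?E v v - (LINT x|lebesgue_on \<Omega>. d x * v x)) - (?E v ?y - (LINT x|lebesgue_on \<Omega>. d x * ?y x))"
      using V.form_right[OF vX zX vX, of "- 1"] i by (simp add: algebra_simps)
    let ?a = "sqrt (?E v v)" and ?b = "(1 + L) * sqrt (C\<^sub>A * ?J v v)"
    have "\<bar>?E v ?y - (LINT x|lebesgue_on \<Omega>. d x * ?y x)\<bar> \<le> (1 + L) * (?a * sqrt (?E ?y ?y))"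
      by (rule volume_form_perturbed_le[OF eps0 f_bounds(2) vX yX dL d_le])
    also have "\<dots> \<le> (1 + L) * (?a * sqrt (C\<^sub>A * ?J v v))"
      using A(2) f_bounds(2) E0 by (intro mult_left_mono real_sqrt_le_mono) auto
    also have "\<dots> = ?a * ?b" by simp
    also have "\<dots> \<le> c\<^sub>0 / 2 * ?a\<^sup>2 + ?b\<^sup>2 / (2 * c\<^sub>0)"
    proof -
      \<comment> \<open>Young's inequality weighted by \<open>c\<^sub>0\<close>, so that exactly
        half of the coercive term is spent.\<close>
      have "x * y \<le> c\<^sub>0 / 2 * x\<^sup>2 + y\<^sup>2 / (2 * c\<^sub>0)" for x y :: real
      proof -
        have "0 \<le> (c\<^sub>0 * x - y)\<^sup>2 / (2 * c\<^sub>0)" using c0_pos by simp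
        also have "\<dots> = c\<^sub>0 / 2 * x\<^sup>2 + y\<^sup>2 / (2 * c\<^sub>0) - x * y"
          using c0_pos by (simp add: field_simps power2_eq_square)
        finally show ?thesis by simp
      qed
      then show ?thesis .
    qed
    also have "\<dots> = c\<^sub>0 / 2 * ?E v v + C\<^sub>A * (1 + L)\<^sup>2 / (2 * c\<^sub>0) * ?J v v"
      using E0 J0 averaging(1) by (simp add: power_mult_distrib)
    finally have pert: "\<bar>?E v ?y - (LINT x|lebesgue_on \<Omega>. d x * ?y x)\<bar> \<le>
        c\<^sub>0 / 2 * ?E v v + C\<^sub>A * (1 + L)\<^sup>2 / (2 * c\<^sub>0) * ?J v v" .
    \<comment> \<open>The second summand pays for the perturbation; \<open>c\<^sub>0 / 2\<close> is
      left over and matches the remaining half of the volume term.\<close>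
    have "(c\<^sub>0 / 2 + C\<^sub>A * (1 + L)\<^sup>2 / (2 * c\<^sub>0)) * ?J v v \<le> C\<^sub>\<sigma> * ?J v v"
      using penalty(2) J0 by (rule mult_right_mono)
    then have "c\<^sub>0 / 2 * ?J v v \<le> C\<^sub>\<sigma> * ?J v v - C\<^sub>A * (1 + L)\<^sup>2 / (2 * c\<^sub>0) * ?J v v"
      unfolding distrib_right by linarith
    then show ?thesis
      unfolding R[OF vW] split Nsq[OF vX] distrib_left using main pert by (simp add: abs_le_iff)
  qed

  \<comment> \<open>Passage to the supremum\<close>
  have pos: "0 < ?N \<phi>" if \<phi>: "\<phi> \<in> broken_space" "\<not> (AE x in lebesgue_on \<Omega>. \<phi> x = 0)" for \<phi>
  proof (rule ccontr)
    assume "\<not> 0 < ?N \<phi>"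
    then have "?N \<phi> = 0" using N0[OF \<phi>(1)] by simp
    then have "?E \<phi> \<phi> + ?J \<phi> \<phi> = 0" using Nsq[OF \<phi>(1)] by simp
    then have E: "?E \<phi> \<phi> = 0" using V.form_nonneg[OF \<phi>(1)] J.form_nonneg[OF \<phi>(1)] by linarith
    \<comment> \<open>The zeroth-order part of the volume form alone forces a function of norm 0 to
      vanish almost everywhere.\<close>
    have "0 \<le> (LINT x|lebesgue_on \<Omega>. broken_grad \<T> \<phi> x \<bullet> broken_grad \<T> \<phi> x)" by simp
    then have "0 \<le> \<epsilon> * (LINT x|lebesgue_on \<Omega>. broken_grad \<T> \<phi> x \<bullet> broken_grad \<T> \<phi> x)" using eps0 by simp
    moreover have "0 \<le> (LINT x|lebesgue_on \<Omega>. \<phi> x * \<phi> x)" by simp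
    ultimately have "(LINT x|lebesgue_on \<Omega>. \<phi> x * \<phi> x) = 0"
      using E unfolding volume_form_eq[OF \<phi>(1) \<phi>(1)] by linarith
    then have "(LINT x|lebesgue_on \<Omega>. (norm (\<phi> x))\<^sup>2) = 0" by (simp add: power2_eq_square)
    then show False
      using integral_squared_eq_0_iff[OF broken_space_L2[OF \<phi>(1)]] \<phi>(2) by blast
  qed
  let ?\<Phi> = "{\<phi> \<in> W_DG \<Omega> \<T> \<Psi> p. \<not> (AE x in lebesgue_on \<Omega>. \<phi> x = 0)}"
  have "residual_norm \<Omega> \<T> \<Psi> p \<epsilon> I\<^sub>h\<^sub>p f C\<^sub>\<sigma> w \<le> ereal (sqrt 2 * ?M * ?N v)"
    unfolding residual_norm_def
  proof (rule SUP_least)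
    fix \<phi> assume \<phi>: "\<phi> \<in> ?\<Phi>"
    then have "0 < ?N \<phi>" using W_DG_broken_space by (intro pos) auto
    moreover have "?R \<phi> \<le> (sqrt 2 * ?M * ?N v) * ?N \<phi>" using upper[of \<phi>] \<phi> by auto
    ultimately have "?R \<phi> / ?N \<phi> \<le> sqrt 2 * ?M * ?N v" by (simp only: pos_divide_le_eq)
    then show "ereal (?R \<phi> / ?N \<phi>) \<le> ereal (sqrt 2 * ?M * ?N v)" by simp
  qed
  moreover have "ereal (c\<^sub>0 / 2 * ?N v) \<le> residual_norm \<Omega> \<T> \<Psi> p \<epsilon> I\<^sub>h\<^sub>p f C\<^sub>\<sigma> w"
  proof (cases "AE x in lebesgue_on \<Omega>. v x = 0")
    case False
    then have Npos: "0 < ?N v" by (intro pos vX)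
    have "c\<^sub>0 / 2 * ?N v \<le> ?R v / ?N v"
      using lower Npos by (simp add: pos_le_divide_eq power2_eq_square mult.assoc)
    then have "ereal (c\<^sub>0 / 2 * ?N v) \<le> ereal (?R v / ?N v)" by simp
    also have "\<dots> \<le> residual_norm \<Omega> \<T> \<Psi> p \<epsilon> I\<^sub>h\<^sub>p f C\<^sub>\<sigma> w"
      unfolding residual_norm_def by (rule SUP_upper) (use vW False in auto)
    finally show ?thesis .
  next
    case True
    \<comment> \<open>Here \<open>v\<close> is excluded from the supremum. The claimed lower bound
      is 0, and by the upper bound any admissible function yields the quotient 0.\<close>
    then have N: "?N v = 0" by (simp add: DG_norm_def DG_inner_null[OF vX])
    let ?\<phi> = "\<lambda>x::real^2. 1::real"
    have "(\<lambda>x. 0 + ?\<phi> x) \<in> W_DG \<Omega> \<T> \<Psi> p"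
      unfolding W_DG_def mem_Collect_eq using zero_H10 const_V_DG[of 1 p]
      by (intro exI[of _ "\<lambda>x. 0"] exI[of _ ?\<phi>] conjI refl)
    then have \<phi>W: "?\<phi> \<in> W_DG \<Omega> \<T> \<Psi> p" by simp
    \<comment> \<open>A nonempty open set is not negligible, so the constant 1 is
      admissible.\<close>
    have "\<not> (AE x in lebesgue_on \<Omega>. ?\<phi> x = 0)"
    proof
      assume "AE x in lebesgue_on \<Omega>. ?\<phi> x = 0"
      then have "AE x in lebesgue. x \<in> \<Omega> \<longrightarrow> False"
        using open_dom by (subst (asm) AE_restrict_space_iff) auto
      then have "AE x in lebesgue. x \<notin> \<Omega>" by simp
      then have "negligible \<Omega>"
        using sets_dom by (simp add: AE_iff_null_sets negligible_iff_null_sets)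
      then show False
        using domain open_not_negligible[OF open_dom] by (auto simp: lipschitz_domain_def)
    qed
    with \<phi>W have "ereal (?R ?\<phi> / ?N ?\<phi>) \<le> residual_norm \<Omega> \<T> \<Psi> p \<epsilon> I\<^sub>h\<^sub>p f C\<^sub>\<sigma> w"
      unfolding residual_norm_def by (intro SUP_upper) auto
    moreover have "?R ?\<phi> = 0" using upper[OF \<phi>W] N by simp
    ultimately show ?thesis using N by (simp add: zero_ereal_def)
  qed
  ultimately show "ereal (c\<^sub>0 / 2 * ?N (\<lambda>x. u x - w x)) \<le> residual_norm \<Omega> \<T> \<Psi> p \<epsilon> I\<^sub>h\<^sub>p f C\<^sub>\<sigma> w \<and>
      residual_norm \<Omega> \<T> \<Psi> p \<epsilon> I\<^sub>h\<^sub>p f C\<^sub>\<sigma> w \<le> ereal (sqrt 2 * ?M * ?N (\<lambda>x. u x - w x))"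
    unfolding Nuw by blast
qed

end
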